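(* Let $b>0$, $\mu>0$ and $\gamma,\nu\in\mathbb{R}$ be fixed with $\gamma+\nu=-1$, $2\mu-\gamma>\tfrac12$, $\nu\notin\{-1,-2,-3,\ldots\}$, and either $\mu\notin\{1,2,3,\ldots\}$ or $\mu=1$. Put $\chi=b^2/4$, $B=(b/2)^\nu/(2\Gamma(\mu))$ and, for $a>0$, $$S_\nu(a,b)=\sum_{n=1}^\infty \frac{n^\gamma J_\nu(nb/a)}{(n^2+a^2)^\mu}.$$ Then, as $a\to+\infty$, one has the asymptotic expansion $$S_\nu(a,b)-a^{\gamma-2\mu}R(a)\sim\frac{a^{-\nu-2\mu}(b/2)^\nu}{\Gamma(1+\nu)}\sum_{k=1}^\infty\frac{(-1)^k}{k!}(\mu)_k\,\zeta(1-2k)\,F_k\,a^{-2k},$$ where, if $\mu\notin\{1,2,3,\ldots\}$, $$R(a)=\frac{2aB\,\Gamma(\mu)}{\Gamma(1+\nu)}\left\{\log a+\tfrac12\big(A+\hat\gamma-\psi(\mu)\big)\right\},$$ and, if $\mu=1$, $$R(a)=\frac{aB}{\Gamma(1+\nu)}\left\{2\log a+2\hat\gamma+\kappa\big(1-\mathcal{I}_\nu(b)\big)-\frac{\chi F_*}{1+\nu}\right\},$$ with $A$, $\kappa$, $\mathcal{I}_\nu(b)$, $F_*$ and $F_k$ as defined in the context.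
   Context: $J_\nu$ and $I_\nu$ are the Bessel and modified Bessel functions of the first kind, $\zeta$ is the Riemann zeta function, $\psi=\Gamma'/\Gamma$, $\hat\gamma=0.57721\ldots$ is the Euler–Mascheroni constant, and $(\alpha)_n=\Gamma(\alpha+n)/\Gamma(\alpha)$. Boldface hypergeometric functions are regularized: ${}_p\mathbf{F}_q$ with lower parameters $\beta_1,\ldots,\beta_q$ is ${}_pF_q/(\Gamma(\beta_1)\cdots\Gamma(\beta_q))$. For $\mu\notin\{1,2,3,\ldots\}$, $$A=\Gamma(1+\nu)\left\{\chi\,\Gamma(1-\mu)\,{}_2\mathbf{F}_3\left(\begin{array}{c}1,1\\2,\,2-\mu,\,2+\nu\end{array}\Big|\,\chi\right)-\frac{\pi\chi^\mu}{\sin\pi\mu}\,{}_1\mathbf{F}_2\left(\begin{array}{c}\mu\\1+\mu,\,1+\mu+\nu\end{array}\Big|\,\chi\right)\right\}.$$ For $\mu=1$: $\kappa=1-\hat\gamma+\psi(2+\nu)-\log\chi$, $\ \mathcal{I}_\nu(b)=\Gamma(1+\nu)(b/2)^{-\nu}I_\nu(b)$, and $$F_*=\sum_{n=0}^\infty\frac{\chi^n}{(2)_n(2+\nu)_n}\big[\Delta\psi(2+n)+\Delta\psi(2+\nu+n)\big],\qquad \Delta\psi(\alpha+n):=\psi(\alpha+n)-\psi(\alpha),$$ so the bracket is $\psi(2+n)-\psi(2)+\psi(2+\nu+n)-\psi(2+\nu)$. The $F_k$ are the polynomials of degree $k$ in $\chi$ $$F_k={}_1F_2\left(\begin{array}{c}-k\\1-\mu-k,\,1+\nu\end{array}\Big|\,\chi\right)=\sum_{j=0}^k\frac{(-k)_j}{(1-\mu-k)_j(1+\nu)_j}\frac{\chi^j}{j!}.$$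 The symbol $\sim$ is in the Poincaré sense: for each $K\ge1$, the left side minus the prefactor times $\sum_{k=1}^{K-1}$ of the series is $O(a^{-\nu-2\mu-2K})$ as $a\to+\infty$, all other parameters fixed. *)

theory Defs
  imports "HOL-Analysis.Analysis" "HOL-Library.Landau_Symbols"
begin

(* Bessel functions of real order on the positive half-line.  Using the reciprocal
   Gamma function makes the terms with nu + k + 1 a non-positive integer vanish. *)

definition bessel_J :: "real \<Rightarrow> real \<Rightarrow> real" where
  "bessel_J \<nu> x =
     (x / 2) powr \<nu> * (\<Sum>k. (-1) ^ k * rGamma (\<nu> + real k + 1) / fact k * (x / 2) ^ (2 * k))"

definition bessel_I :: "real \<Rightarrow> real \<Rightarrow> real" where
  "bessel_I \<nu> x =
     (x / 2) powr \<nu> * (\<Sum>k. rGamma (\<nu> + real k + 1) / fact k * (x / 2) ^ (2 * k))"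

(* The analytic continuation of the Dirichlet series; it is unique away from the pole,
   and the value at 1 is irrelevant. *)

definition riemann_zeta :: "complex \<Rightarrow> complex" where
  "riemann_zeta =
     (SOME f. f holomorphic_on (- {1}) \<and>
        (\<forall>s. Re s > 1 \<longrightarrow> (\<lambda>n. 1 / of_nat (Suc n) powr s) sums f s))"

(* Regularized pFq with lists of upper and lower parameters.  The reciprocal Gamma factors
   are distributed over the terms, 1/(Gamma(beta) (beta)_n) = 1/Gamma(beta + n), so that the
   function is also meaningful when a lower parameter is a non-positive integer. *)

definition hypergeo_reg :: "real list \<Rightarrow> real list \<Rightarrow> real \<Rightarrow> real" where
  "hypergeo_reg as bs z =
     (\<Sum>n. (\<Prod>\<alpha>\<leftarrow>as. pochhammer \<alpha> n) * (\<Prod>\<beta>\<leftarrow>bs. rGamma (\<beta> + real n)) * z ^ n / fact n)"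

definition bessel_sum :: "real \<Rightarrow> real \<Rightarrow> real \<Rightarrow> real \<Rightarrow> real \<Rightarrow> real" where
  "bessel_sum \<gamma> \<mu> \<nu> a b =
     (\<Sum>n. real (Suc n) powr \<gamma> * bessel_J \<nu> (real (Suc n) * b / a)
            / ((real (Suc n))\<^sup>2 + a\<^sup>2) powr \<mu>)"

definition chi :: "real \<Rightarrow> real" where
  "chi b = b\<^sup>2 / 4"

definition coeff_B :: "real \<Rightarrow> real \<Rightarrow> real \<Rightarrow> real" where
  "coeff_B \<mu> \<nu> b = (b / 2) powr \<nu> / (2 * Gamma \<mu>)"

definition coeff_A :: "real \<Rightarrow> real \<Rightarrow> real \<Rightarrow> real" where
  "coeff_A \<mu> \<nu> b =
     Gamma (1 + \<nu>) *
       (chi b * Gamma (1 - \<mu>) * hypergeo_reg [1, 1] [2, 2 - \<mu>, 2 + \<nu>] (chi b)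
        - pi * chi b powr \<mu> / sin (pi * \<mu>) * hypergeo_reg [\<mu>] [1 + \<mu>, 1 + \<mu> + \<nu>] (chi b))"

definition kappa :: "real \<Rightarrow> real \<Rightarrow> real" where
  "kappa \<nu> b = 1 - euler_mascheroni + Digamma (2 + \<nu>) - ln (chi b)"

definition normalized_I :: "real \<Rightarrow> real \<Rightarrow> real" where
  "normalized_I \<nu> b = Gamma (1 + \<nu>) * (b / 2) powr (- \<nu>) * bessel_I \<nu> b"

definition F_star :: "real \<Rightarrow> real \<Rightarrow> real" where
  "F_star \<nu> b =
     (\<Sum>n. chi b ^ n / (pochhammer 2 n * pochhammer (2 + \<nu>) n) *
        ((Digamma (2 + real n) - Digamma 2) + (Digamma (2 + \<nu> + real n) - Digamma (2 + \<nu>))))"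

(* The terminating 1F2(-k; 1 - mu - k, 1 + nu | chi).  For mu = 1 the lower parameter
   1 - mu - k equals -k; the sum up to j = k is the meaning intended also then. *)

definition F_poly :: "nat \<Rightarrow> real \<Rightarrow> real \<Rightarrow> real \<Rightarrow> real" where
  "F_poly k \<mu> \<nu> b =
     (\<Sum>j=0..k. pochhammer (- real k) j
        / (pochhammer (1 - \<mu> - real k) j * pochhammer (1 + \<nu>) j) * (chi b ^ j / fact j))"

definition main_term :: "real \<Rightarrow> real \<Rightarrow> real \<Rightarrow> real \<Rightarrow> real" where
  "main_term \<mu> \<nu> b a =
     (if \<mu> = 1 then
        a * coeff_B \<mu> \<nu> b / Gamma (1 + \<nu>) *
          (2 * ln a + 2 * euler_mascheroni + kappa \<nu> b * (1 - normalized_I \<nu> b)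
           - chi b * F_star \<nu> b / (1 + \<nu>))
      else
        2 * a * coeff_B \<mu> \<nu> b * Gamma \<mu> / Gamma (1 + \<nu>) *
          (ln a + (1 / 2) * (coeff_A \<mu> \<nu> b + euler_mascheroni - Digamma \<mu>)))"

end

theory Submission
  imports Defs "HOL-Complex_Analysis.Complex_Analysis" "HOL-Real_Asymp.Real_Asymp"
begin

text \<open>
  Write \<open>c = \<chi>\<close> and \<open>J\<^sub>\<nu>(x) = (x/2)\<^sup>\<nu> C(x\<^sup>2/4)\<close>, where \<open>C\<close> is the entire Bessel--Clifford function
  of order \<open>\<nu>\<close>. Since \<open>\<gamma> + \<nu> = -1\<close>, the powers of \<open>n\<close> in a summand collapse to \<open>1/n\<close> and
    \<open>S\<^sub>\<nu>(a,b) = a powr (-\<nu>-2\<mu>) (b/2)\<^sup>\<nu> (\<Sum>n\<ge>1. h(n/a) / n)\<close>  with  \<open>h(t) = C(c t\<^sup>2) (1+t\<^sup>2) powr (-\<mu>)\<close>,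
  a smooth even function of \<open>t\<close> (lemma \<open>bessel_sum_term\<close>). The exponent \<open>-1\<close> is the resonant case of
  such sums: \<open>h(t)/t\<close> is not integrable at 0, and this is where the logarithm comes from.

  Split \<open>h(t)/t = h(0)/t + q(t)\<close>, with \<open>q\<close> smooth and odd. The first part sums to harmonic numbers. To the second
  part the Euler--Maclaurin formula applies with step \<open>1/a\<close> and on the whole half line, because \<open>q\<close> is
  \<open>O(1/t)\<close> and its derivatives are integrable at infinity. The result is
    \<open>(\<Sum>n\<ge>1. h(n/a) / n) = h(0) (\<gamma>\<^sub>E + log a) + L - (\<Sum>j. (-1)\<^sup>j \<beta>\<^sub>j a powr (-j) q\<^bsup>(j-1)\<^esup>(0)) + O(a powr (-M-1))\<close>,
  where \<open>\<beta>\<^sub>j = B\<^sub>j/j!\<close> and \<open>L\<close> is the limit of \<open>h(0) log T\<close> plus the integral of \<open>q\<close> over \<open>[0,T]\<close>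
  (lemma \<open>profile_sum_euler_maclaurin\<close>). As \<open>q\<close> is odd only the even \<open>j = 2k\<close> remain. The derivative of \<open>q\<close> at 0 is then a
  Taylor coefficient of \<open>h\<close>, which is the Cauchy product of the series of \<open>C\<close> with a binomial series and
  is the polynomial \<open>F\<^sub>k\<close> up to a factor, and \<open>-\<beta>\<^sub>2\<^sub>k (2k-1)!\<close> is \<open>\<zeta>(1-2k)\<close> (lemma \<open>riemann_zeta_neg_odd\<close>). The value
  of zeta is found by continuing the Dirichlet series with the same Euler--Maclaurin formula: at a
  negative integer the summand becomes a monomial and the remainder term vanishes.

  It remains to compute \<open>L\<close>. The substitution \<open>y = c t\<^sup>2\<close> turns it into half of a regularized integral of
  \<open>C(y) (1+y/c) powr (-\<mu>) / y\<close>. Subtracting \<open>C(0)\<close> from \<open>C(y)\<close> leaves the absolutely convergent integral \<open>I(\<mu>)\<close> of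
  \<open>(C(y) - C(0)) (1+y/c) powr (-\<mu>) / y\<close>; what has been subtracted contributes
  \<open>-C(0) (\<psi>(\<mu>) + \<gamma>\<^sub>E)\<close> (lemma \<open>regularized_integral_limit\<close>). For \<open>\<mu>\<close> that is not an integer, \<open>I(\<mu>)\<close> is the sum of two
  residue series, which are the two hypergeometric series in \<open>A\<close>. These are obtained from real integrals, without a
  Mellin--Barnes contour: the integral is cut at \<open>y = 2c\<close>, \<open>C\<close> is expanded below the cut and the binomial above it, and
  the two families of boundary terms are the row sums and the column sums of one absolutely convergent
  double series, so that they cancel (lemma \<open>integral_regular_kernel\<close>). The input is the Mellin transform of \<open>C\<close> cut at a point (lemma
  \<open>mellin_tail_expansion\<close>). At \<open>\<mu> = 1\<close> both series have coinciding terms, while the prefactor has a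
  pole; the limit \<open>\<mu> \<rightarrow> 1\<close> is the derivative of the difference, which brings in the digamma functions of
  \<open>F\<^sub>*\<close> and \<open>\<kappa>\<close> (lemma \<open>integral_regular_kernel_1\<close>).
\<close>

section \<open>One step of the Euler--Maclaurin formula\<close>

text \<open>The numbers \<open>\<beta>\<^sub>m = B\<^sub>m/m!\<close>, the Taylor coefficients of \<open>x /
  (e\<^sup>x - 1)\<close>; the recursion clears the denominator.\<close>

fun bernoulli_coeff :: "nat \<Rightarrow> real" where
  "bernoulli_coeff 0 = 1"
| "bernoulli_coeff (Suc m) = - (\<Sum>i\<le>m. bernoulli_coeff i / fact (m + 2 - i))"

text \<open>The Bernoulli polynomial \<open>B\<^sub>m(t)/m!\<close>. With this normalization each function is exactly
  the derivative of the next one.\<close>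

definition bernoulli_fun :: "nat \<Rightarrow> real \<Rightarrow> real" where
  "bernoulli_fun m t = (\<Sum>i\<le>m. bernoulli_coeff (m - i) * t ^ i / fact i)"

lemma bernoulli_fun_0: "bernoulli_fun 0 t = 1"
  by (simp add: bernoulli_fun_def)

lemma bernoulli_fun_at_0: "bernoulli_fun m 0 = bernoulli_coeff m"
proof -
  have "bernoulli_fun m 0 = (\<Sum>i\<in>{0}. bernoulli_coeff (m - i) * 0 ^ i / fact i)"
    unfolding bernoulli_fun_def by (intro sum.mono_neutral_right) auto
  thus ?thesis by simp
qed

text \<open>The recursion for the coefficients says precisely that the values at both ends of the unit interval agree,
  apart from degree one. This makes boundary terms telescope when unit intervals are joined.\<close>

lemma bernoulli_fun_at_1:
  "bernoulli_fun (Suc m) 1 = bernoulli_coeff (Suc m) + (if m = 0 then 1 else 0)"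
proof (cases m)
  case 0
  thus ?thesis by (simp add: bernoulli_fun_def)
next
  case (Suc k)
  have "bernoulli_fun (Suc m) 1 = (\<Sum>j\<le>Suc m. bernoulli_coeff j / fact (Suc m - j))"
    unfolding bernoulli_fun_def
    by (rule sum.reindex_bij_witness[of _ "\<lambda>i. Suc m - i" "\<lambda>i. Suc m - i"]) auto
  also have "\<dots> = bernoulli_coeff (Suc m) + bernoulli_coeff m
               + (\<Sum>j\<le>k. bernoulli_coeff j / fact (k + 2 - j))"
    by (simp add: Suc del: bernoulli_coeff.simps)
  also have "(\<Sum>j\<le>k. bernoulli_coeff j / fact (k + 2 - j)) = - bernoulli_coeff m"
    by (simp add: Suc)
  finally show ?thesis by (simp add: Suc del: bernoulli_coeff.simps)
qed

lemma bernoulli_fun_deriv: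
  "(bernoulli_fun (Suc m) has_real_derivative bernoulli_fun m t) (at t)"
proof -
  have "bernoulli_fun (Suc m) = (\<lambda>t. bernoulli_coeff (Suc m)
          + (\<Sum>i\<le>m. bernoulli_coeff (m - i) * t ^ Suc i / fact (Suc i)))"
    unfolding bernoulli_fun_def by (subst sum.atMost_Suc_shift) (simp del: bernoulli_coeff.simps)
  moreover have "((\<lambda>t. bernoulli_coeff (Suc m)
          + (\<Sum>i\<le>m. bernoulli_coeff (m - i) * t ^ Suc i / fact (Suc i)))
        has_real_derivative (0 + (\<Sum>i\<le>m. bernoulli_coeff (m - i) * t ^ i / fact i))) (at t)"
  proof (intro DERIV_add DERIV_const DERIV_sum)
    fix i assume "i \<in> {..m}"
    have "((\<lambda>t. bernoulli_coeff (m - i) / fact (Suc i) * t ^ Suc i) has_real_derivative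
            bernoulli_coeff (m - i) / fact (Suc i) * (of_nat (Suc i) * t ^ i)) (at t)"
      by (rule DERIV_cmult) (use DERIV_pow[of "Suc i" t UNIV] in simp)
    moreover have "bernoulli_coeff (m - i) / fact (Suc i) * (of_nat (Suc i) * t ^ i)
                     = bernoulli_coeff (m - i) * t ^ i / fact i"
      unfolding fact_Suc of_nat_mult
      by (subst times_divide_eq_left, subst nonzero_divide_eq_eq)
         (simp_all add: field_simps del: of_nat_Suc)
    ultimately show "((\<lambda>t. bernoulli_coeff (m - i) * t ^ Suc i / fact (Suc i)) has_real_derivative
            bernoulli_coeff (m - i) * t ^ i / fact i) (at t)"
      by simp
  qed
  ultimately show ?thesis by (simp add: bernoulli_fun_def)
qed

lemma continuous_on_bernoulli_fun: "continuous_on A (bernoulli_fun m)"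
  unfolding bernoulli_fun_def by (intro continuous_intros) auto

lemma bernoulli_fun_bounded: "\<exists>Q>0. \<forall>t\<in>{0..1}. \<bar>bernoulli_fun m t\<bar> \<le> Q"
proof -
  have "compact (bernoulli_fun m ` {0..1})"
    by (intro compact_continuous_image continuous_on_bernoulli_fun compact_Icc)
  then obtain B where "\<forall>x\<in>bernoulli_fun m ` {0..1}. norm x \<le> B"
    using compact_imp_bounded bounded_iff by blast
  thus ?thesis by (intro exI[of _ "max B 1"]) auto
qed

definition em_remainder :: "nat \<Rightarrow> (real \<Rightarrow> complex) \<Rightarrow> real \<Rightarrow> complex" where
  "em_remainder m f x = integral {0..1} (\<lambda>t. of_real (bernoulli_fun m t) * f (x + t))"

text \<open>Integration by parts, with \<open>B\<^sub>m(t)/m!\<close> integrated and the other factor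
  differentiated.\<close>

lemma em_parts:
  fixes g g' :: "real \<Rightarrow> complex"
  assumes der: "\<And>t. t \<in> {x..x+1} \<Longrightarrow> (g has_vector_derivative g' t) (at t)"
    and cont: "continuous_on {x..x+1} g'"
  shows "em_remainder m g x
       = of_real (bernoulli_fun (Suc m) 1) * g (x + 1) - of_real (bernoulli_coeff (Suc m)) * g x
         - em_remainder (Suc m) g' x"
proof -
  have cg: "continuous_on {x..x+1} g"
    by (meson continuous_at_imp_continuous_on der has_vector_derivative_continuous)
  have shift: "continuous_on {0..1} (\<lambda>t. f (x + t))"
    if "continuous_on {x..x+1} f" for f :: "real \<Rightarrow> complex"
    by (rule continuous_on_compose2[OF that]) (auto intro!: continuous_intros)
  have int: "(\<lambda>t. of_real (bernoulli_fun k t) * f (x + t)) integrable_on {0..1}"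
    if "continuous_on {x..x+1} f" for f :: "real \<Rightarrow> complex" and k
    by (intro integrable_continuous_real continuous_intros continuous_on_bernoulli_fun shift that)
  have "((\<lambda>t. of_real (bernoulli_fun m t) * g (x + t) + of_real (bernoulli_fun (Suc m) t) * g' (x + t))
          has_integral (of_real (bernoulli_fun (Suc m) 1) * g (x + 1)
                       - of_real (bernoulli_fun (Suc m) 0) * g (x + 0))) {0..1}"
  proof (rule fundamental_theorem_of_calculus)
    fix t :: real assume t: "t \<in> {0..1}"
    have 1: "((\<lambda>t. complex_of_real (bernoulli_fun (Suc m) t)) has_vector_derivative of_real (bernoulli_fun m t)) (at t)"
      using bernoulli_fun_deriv[of m t]
      by (intro has_vector_derivative_of_real) (simp add: has_real_derivative_iff_has_vector_derivative)
    have 2: "((\<lambda>t. g (x + t)) has_vector_derivative g' (x + t)) (at t)"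
    proof -
      have "((g \<circ> (\<lambda>t. x + t)) has_vector_derivative (1 *\<^sub>R g' (x + t))) (at t)"
        using t by (intro vector_diff_chain_at der) (auto intro!: derivative_eq_intros)
      thus ?thesis by (simp add: o_def)
    qed
    have "((\<lambda>t. of_real (bernoulli_fun (Suc m) t) * g (x + t)) has_vector_derivative
           of_real (bernoulli_fun (Suc m) t) * g' (x + t) + of_real (bernoulli_fun m t) * g (x + t)) (at t)"
      by (rule has_vector_derivative_mult[OF 1 2])
    thus "((\<lambda>t. of_real (bernoulli_fun (Suc m) t) * g (x + t)) has_vector_derivative
           of_real (bernoulli_fun m t) * g (x + t) + of_real (bernoulli_fun (Suc m) t) * g' (x + t)) (at t within {0..1})"
      by (simp add: add.commute has_vector_derivative_at_within)
  qed auto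
  moreover have "((\<lambda>t. of_real (bernoulli_fun m t) * g (x + t) + of_real (bernoulli_fun (Suc m) t) * g' (x + t))
          has_integral (em_remainder m g x + em_remainder (Suc m) g' x)) {0..1}"
    unfolding em_remainder_def by (intro has_integral_add integrable_integral int cg cont)
  ultimately have "em_remainder m g x + em_remainder (Suc m) g' x
      = of_real (bernoulli_fun (Suc m) 1) * g (x + 1) - of_real (bernoulli_fun (Suc m) 0) * g (x + 0)"
    by (rule has_integral_unique[rotated])
  thus ?thesis
    by (simp only: bernoulli_fun_at_0 add_0_right eq_diff_eq)
qed

text \<open>Repeated integration by parts on one unit interval, starting with \<open>B\<^sub>0 = 1\<close>. The
  derivatives are given as a sequence \<open>F\<close>, where \<open>F 1\<close> is the function to be summed and
  \<open>F 0\<close> is a primitive of it; thus the integral itself is the term \<open>j = 0\<close> of the sum. The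
  sign \<open>(-1)\<^sup>j\<close> matters for \<open>j = 1\<close> only: it selects the value at the right
  end.\<close>

lemma euler_maclaurin_step:
  fixes F :: "nat \<Rightarrow> real \<Rightarrow> complex"
  assumes der: "\<And>j t. t \<in> {x..x+1} \<Longrightarrow> (F j has_vector_derivative F (Suc j) t) (at t)"
  shows "F 1 (x + 1) = (\<Sum>j\<le>Suc M. (-1) ^ j * of_real (bernoulli_coeff j) * (F j (x + 1) - F j x))
           + (-1) ^ M * em_remainder (Suc M) (F (M + 2)) x"
proof (induction M)
  have cont: "continuous_on {x..x+1} (F j)" for j
    by (meson continuous_at_imp_continuous_on der has_vector_derivative_continuous)
  case 0
  have "((\<lambda>t. F 1 (x + t)) has_integral (F 0 (x + 1) - F 0 (x + 0))) {0..1}"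
  proof (rule fundamental_theorem_of_calculus)
    fix t :: real assume t: "t \<in> {0..1}"
    have "((F 0 \<circ> (\<lambda>t. x + t)) has_vector_derivative (1 *\<^sub>R F (Suc 0) (x + t))) (at t)"
      using t by (intro vector_diff_chain_at der) (auto intro!: derivative_eq_intros)
    thus "((\<lambda>t. F 0 (x + t)) has_vector_derivative F 1 (x + t)) (at t within {0..1})"
      by (simp add: o_def has_vector_derivative_at_within)
  qed auto
  hence "em_remainder 0 (F 1) x = F 0 (x + 1) - F 0 x"
    unfolding em_remainder_def by (simp add: bernoulli_fun_0 integral_unique)
  moreover have "em_remainder 0 (F 1) x = F 1 (x + 1) / 2 + F 1 x / 2 - em_remainder 1 (F 2) x"
    using em_parts[of x "F 1" "F 2" 0] der[of _ 1] cont[of 2]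
    by (simp add: bernoulli_fun_at_1 eval_nat_numeral)
  ultimately have "F 0 (x + 1) - F 0 x = F 1 (x + 1) / 2 + F 1 x / 2 - em_remainder 1 (F 2) x"
    by simp
  thus ?case by (simp add: eval_nat_numeral) (simp add: field_simps)
next
  case (Suc M)
  have cont: "continuous_on {x..x+1} (F j)" for j
    by (meson continuous_at_imp_continuous_on der has_vector_derivative_continuous)
  have "em_remainder (Suc M) (F (M + 2)) x =
     of_real (bernoulli_coeff (Suc (Suc M))) * (F (M + 2) (x + 1) - F (M + 2) x)
     - em_remainder (Suc (Suc M)) (F (Suc M + 2)) x"
    using em_parts[of x "F (M + 2)" "F (Suc M + 2)" "Suc M"] der[of _ "M + 2"] cont[of "Suc M + 2"]
    by (simp add: bernoulli_fun_at_1 algebra_simps del: bernoulli_coeff.simps)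
  thus ?case
    by (subst Suc.IH, simp only: sum.atMost_Suc[of _ "Suc M"])
       (simp add: algebra_simps del: bernoulli_coeff.simps)
qed

text \<open>An integrable majorant is given by its tail function \<open>V\<close>, so that the bounds for consecutive
  intervals telescope.\<close>

lemma norm_em_remainder_le:
  assumes Q: "\<And>t. t \<in> {0..1} \<Longrightarrow> \<bar>bernoulli_fun m t\<bar> \<le> Q"
    and cont: "continuous_on {x..x+1} f"
    and der: "\<And>t. t \<in> {x..x+1} \<Longrightarrow> (V has_real_derivative - v t) (at t)"
    and bound: "\<And>t. t \<in> {x..x+1} \<Longrightarrow> norm (f t) \<le> v t"
  shows "norm (em_remainder m f x) \<le> Q * (V x - V (x + 1))"
proof -
  have "((\<lambda>t. Q * v (x + t)) has_integral (- (Q * V (x + 1)) - - (Q * V (x + 0)))) {0..1}"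
  proof (rule fundamental_theorem_of_calculus)
    fix t :: real assume t: "t \<in> {0..1}"
    have "((V \<circ> (\<lambda>t. x + t)) has_real_derivative (- v (x + t) * 1)) (at t)"
      using t by (intro DERIV_chain der) (auto intro!: derivative_eq_intros)
    hence "((\<lambda>t. - (Q * V (x + t))) has_real_derivative (Q * v (x + t))) (at t)"
      by (auto intro!: derivative_eq_intros simp: o_def)
    thus "((\<lambda>t. - (Q * V (x + t))) has_vector_derivative Q * v (x + t)) (at t within {0..1})"
      by (simp add: has_real_derivative_iff_has_vector_derivative has_vector_derivative_at_within)
  qed auto
  hence I: "((\<lambda>t. Q * v (x + t)) has_integral (Q * (V x - V (x + 1)))) {0..1}"
    by (simp add: algebra_simps)
  have "norm (em_remainder m f x) \<le> integral {0..1} (\<lambda>t. Q * v (x + t))"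
    unfolding em_remainder_def
  proof (rule integral_norm_bound_integral)
    have "continuous_on {0..1} (\<lambda>t. f (x + t))"
      by (rule continuous_on_compose2[OF cont]) (auto intro!: continuous_intros)
    thus "(\<lambda>t. of_real (bernoulli_fun m t) * f (x + t)) integrable_on {0..1}"
      by (intro integrable_continuous_real continuous_intros continuous_on_bernoulli_fun)
    show "(\<lambda>t. Q * v (x + t)) integrable_on {0..1}" using I by blast
    fix t :: real assume t: "t \<in> {0..1}"
    have "0 \<le> \<bar>bernoulli_fun m t\<bar>" by simp
    also have "\<dots> \<le> Q" using Q t by blast
    finally have "0 \<le> Q" .
    thus "norm (complex_of_real (bernoulli_fun m t) * f (x + t)) \<le> Q * v (x + t)"
      unfolding norm_mult using Q[OF t] bound[of "x + t"] t by (intro mult_mono) auto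
  qed
  also have "\<dots> = Q * (V x - V (x + 1))" using I by (rule integral_unique)
  finally show ?thesis .
qed

section \<open>Values of the Riemann zeta function at negative odd integers\<close>

text \<open>The function \<open>x powr (-s)\<close> (index 1) with a primitive (index 0) and its derivatives, as
  needed for Euler--Maclaurin summation of the Dirichlet series.\<close>

fun powr_family :: "complex \<Rightarrow> nat \<Rightarrow> real \<Rightarrow> complex" where
  "powr_family s 0 x = of_real x powr (1 - s) / (1 - s)"
| "powr_family s (Suc j) x = (-1) ^ j * pochhammer s j * of_real x powr (- s - of_nat j)"

lemma powr_family_deriv:
  assumes "x > 0" "s \<noteq> 1"
  shows "(powr_family s j has_vector_derivative powr_family s (Suc j) x) (at x)"
proof -
  have base: "((\<lambda>x. of_real x powr a :: complex) has_vector_derivative a * of_real x powr (a - 1)) (at x)" for a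
  proof -
    have "((\<lambda>z. z powr a) \<circ> of_real has_vector_derivative (1 * (a * of_real x powr (a - 1)))) (at x)"
      by (rule field_vector_diff_chain_at)
         (use assms in \<open>auto intro!: has_field_derivative_powr derivative_eq_intros has_vector_derivative_of_real\<close>)
    thus ?thesis by (simp add: o_def)
  qed
  show ?thesis
  proof (cases j)
    case 0
    have "((\<lambda>x. of_real x powr (1 - s) / (1 - s)) has_vector_derivative
            ((1 - s) * of_real x powr (1 - s - 1) / (1 - s))) (at x)"
      by (rule has_vector_derivative_divide[OF base])
    moreover have "powr_family s j = (\<lambda>x. of_real x powr (1 - s) / (1 - s))"
      by (simp add: 0 fun_eq_iff)
    ultimately show ?thesis using assms 0 by simp
  next
    case (Suc i)
    have "((\<lambda>x. ((-1) ^ i * pochhammer s i) * of_real x powr (- s - of_nat i)) has_vector_derivative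
           ((-1) ^ i * pochhammer s i) * ((- s - of_nat i) * of_real x powr (- s - of_nat i - 1))) (at x)"
      by (rule has_vector_derivative_mult_right[OF base])
    moreover have "((-1) ^ i * pochhammer s i) * ((- s - of_nat i) * of_real x powr (- s - of_nat i - 1))
      = powr_family s (Suc j) x"
      by (simp add: Suc pochhammer_rec' algebra_simps)
    moreover have "powr_family s j = (\<lambda>x. ((-1) ^ i * pochhammer s i) * of_real x powr (- s - of_nat i))"
      by (simp add: Suc fun_eq_iff)
    ultimately show ?thesis by simp
  qed
qed

text \<open>The Euler--Maclaurin remainder on \<open>[n+1, n+2]\<close>, written without an integral so that it is
  visibly holomorphic in \<open>s\<close>.\<close>

definition zeta_term :: "nat \<Rightarrow> nat \<Rightarrow> complex \<Rightarrow> complex" where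
  "zeta_term M n s = powr_family s 1 (real n + 1 + 1)
     - (\<Sum>j\<le>Suc M. (-1) ^ j * of_real (bernoulli_coeff j)
          * (powr_family s j (real n + 1 + 1) - powr_family s j (real n + 1)))"

text \<open>The Dirichlet series after \<open>M\<close> Euler--Maclaurin corrections; it converges for \<open>Re s >
  -M\<close>.\<close>

definition zeta_em :: "nat \<Rightarrow> complex \<Rightarrow> complex" where
  "zeta_em M s = 1 - (\<Sum>j\<le>Suc M. (-1) ^ j * of_real (bernoulli_coeff j) * powr_family s j 1)
     + (\<Sum>n. zeta_term M n s)"

lemma zeta_term_eq_remainder:
  assumes "s \<noteq> 1"
  shows "zeta_term M n s = (-1) ^ M * em_remainder (Suc M) (powr_family s (M + 2)) (real n + 1)"
proof -
  have "powr_family s 1 (real n + 1 + 1) =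
     (\<Sum>j\<le>Suc M. (-1) ^ j * of_real (bernoulli_coeff j)
          * (powr_family s j (real n + 1 + 1) - powr_family s j (real n + 1)))
     + (-1) ^ M * em_remainder (Suc M) (powr_family s (M + 2)) (real n + 1)"
    by (rule euler_maclaurin_step, rule powr_family_deriv) (use assms in auto)
  thus ?thesis unfolding zeta_term_def by (simp only: add_diff_cancel_left')
qed

text \<open>The remainder involves the derivative of order \<open>M + 1\<close> of \<open>x powr (-s)\<close>, which
  is smaller by \<open>M + 1\<close> powers of \<open>x\<close>. The bound is uniform on sets where the Pochhammer
  symbol is bounded and the real part is bounded below.\<close>

lemma zeta_term_bound:
  "\<exists>Q>0. \<forall>s n d P. s \<noteq> 1 \<longrightarrow> d \<ge> 0 \<longrightarrow> Re s + real M + 1 \<ge> d \<longrightarrow> norm (pochhammer s (Suc M)) \<le> P \<longrightarrow>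
      norm (zeta_term M n s) \<le> Q * (P * (real n + 1) powr (- d))"
proof -
  obtain Q where Q: "Q > 0" "\<And>t. t \<in> {0..1} \<Longrightarrow> \<bar>bernoulli_fun (Suc M) t\<bar> \<le> Q"
    using bernoulli_fun_bounded by blast
  show ?thesis
  proof (intro exI[of _ Q] conjI allI impI)
    fix s :: complex and n :: nat and d P :: real
    assume s: "s \<noteq> 1" "d \<ge> 0" "Re s + real M + 1 \<ge> d" "norm (pochhammer s (Suc M)) \<le> P"
    define c where "c = P * (real n + 1) powr (- d)"
    have "norm (em_remainder (Suc M) (powr_family s (M + 2)) (real n + 1))
        \<le> Q * ((- c * (real n + 1)) - (- c * (real n + 1 + 1)))"
    proof (rule norm_em_remainder_le)
      show "continuous_on {real n + 1..real n + 1 + 1} (powr_family s (M + 2))"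
        by (rule continuous_at_imp_continuous_on)
           (use s(1) in \<open>auto intro!: has_vector_derivative_continuous powr_family_deriv\<close>)
      show "((\<lambda>t. - c * t) has_real_derivative - c) (at t)" for t
        by (auto intro!: derivative_eq_intros)
    next
      fix t assume t: "t \<in> {real n + 1..real n + 1 + 1}"
      have "norm (powr_family s (M + 2) t) = norm (pochhammer s (Suc M)) * t powr (- (Re s + real M + 1))"
        using t by (simp add: norm_mult norm_power norm_powr_real_powr del: pochhammer_Suc)
                   (simp add: algebra_simps del: pochhammer_Suc)
      also have "\<dots> \<le> P * (real n + 1) powr (- d)"
      proof (rule mult_mono)
        have "t powr (- (Re s + real M + 1)) \<le> t powr (- d)"
          using s t by (intro powr_mono) auto
        also have "\<dots> \<le> (real n + 1) powr (- d)"
          using s t by (intro powr_mono2') auto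
        finally show "t powr (- (Re s + real M + 1)) \<le> (real n + 1) powr (- d)" .
        have "0 \<le> norm (pochhammer s (Suc M))" by simp
        also have "\<dots> \<le> P" by fact
        finally show "0 \<le> P" .
      qed (use s in auto)
      finally show "norm (powr_family s (M + 2) t) \<le> c" by (simp add: c_def)
    qed (use Q in auto)
    also have "\<dots> = Q * c" by (simp add: algebra_simps)
    finally show "norm (zeta_term M n s) \<le> Q * (P * (real n + 1) powr (- d))"
      using s(1) by (simp add: zeta_term_eq_remainder norm_mult norm_power c_def)
  qed (use Q in auto)
qed

lemma summable_Suc_powr: "p > 1 \<Longrightarrow> summable (\<lambda>n. (real n + 1) powr (- p))"
proof -
  assume "p > 1"
  hence "summable (\<lambda>n. real n powr (- p))" by (subst summable_real_powr_iff) auto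
  hence "summable (\<lambda>n. real (Suc n) powr (- p))" by (subst summable_Suc_iff)
  thus ?thesis by (simp add: add.commute)
qed

lemma holomorphic_on_powr_family:
  "x > 0 \<Longrightarrow> (\<lambda>s. powr_family s j x) holomorphic_on - {1}"
proof (cases j)
  case (Suc i)
  assume "x > 0"
  have poch: "(\<lambda>s::complex. pochhammer s i) holomorphic_on - {1}"
    unfolding pochhammer_prod by (intro holomorphic_intros)
  show ?thesis unfolding Suc powr_family.simps
    by (intro holomorphic_intros poch) (use \<open>x > 0\<close> in auto)
qed (auto intro!: holomorphic_intros)

lemma holomorphic_zeta_term: "zeta_term M n holomorphic_on - {1}"
  unfolding zeta_term_def[abs_def] by (intro holomorphic_intros holomorphic_on_powr_family) auto

lemma half_plane_minus_point:
  "open ({s::complex. Re s > c} - {1})" "connected ({s::complex. Re s > c} - {1})"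
proof -
  have op: "open {s::complex. Re s > c}" by (rule open_halfspace_Re_gt)
  thus "open ({s::complex. Re s > c} - {1})" by auto
  have "convex {s::complex. Re s > c}" by (rule convex_halfspace_Re_gt)
  hence "connected {s::complex. Re s > c}" by (rule convex_connected)
  thus "connected ({s::complex. Re s > c} - {1})"
    by (intro connected_open_delete op) auto
qed

lemma zeta_term_series:
  obtains g where "\<And>s. Re s > - real M \<Longrightarrow> s \<noteq> 1 \<Longrightarrow> (\<lambda>n. zeta_term M n s) sums g s"
    "g holomorphic_on ({s. Re s > - real M} - {1})"
proof -
  obtain Q where Q: "Q > 0" "\<And>s n d P. s \<noteq> 1 \<Longrightarrow> d \<ge> 0 \<Longrightarrow> Re s + real M + 1 \<ge> d \<Longrightarrow>
      norm (pochhammer s (Suc M)) \<le> P \<Longrightarrow> norm (zeta_term M n s) \<le> Q * (P * (real n + 1) powr (- d))"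
    using zeta_term_bound[of M] by blast
  let ?S = "{s. Re s > - real M} - {1}"
  obtain g where g: "\<forall>s\<in>?S. (\<lambda>n. zeta_term M n s) sums g s \<and> g field_differentiable (at s)"
  proof (rule series_differentiable_comparison_complex[of ?S "zeta_term M"])
    show op: "open ?S" by (rule half_plane_minus_point)
    show "zeta_term M n field_differentiable (at s)" if "s \<in> ?S" for n s
      using holomorphic_zeta_term[of M n] that
      by (metis Diff_iff holomorphic_on_imp_differentiable_at Compl_iff open_Compl closed_singleton)
  next
    fix s assume s: "s \<in> ?S"
    \<comment> \<open>With radius half the distance to the boundary line the terms are uniformly \<open>O(n powr (-1-r))\<close>.\<close>
    define r where "r = (Re s + real M) / 2"
    have r: "r > 0" using s by (simp add: r_def)
    have "continuous_on (cball s r) (\<lambda>s. pochhammer s (Suc M))"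
      unfolding pochhammer_prod by (intro continuous_intros)
    hence "bounded ((\<lambda>s. pochhammer s (Suc M)) ` cball s r)"
      by (intro compact_imp_bounded compact_continuous_image compact_cball)
    then obtain P where P: "\<And>z. z \<in> cball s r \<Longrightarrow> norm (pochhammer z (Suc M)) \<le> P"
      unfolding bounded_iff by blast
    have "0 \<le> norm (pochhammer s (Suc M))" by simp
    also have "\<dots> \<le> P" using P[of s] r by simp
    finally have P0: "P \<ge> 0" .
    let ?h = "\<lambda>n. complex_of_real (Q * (P * (real n + 1) powr (- (1 + r))))"
    show "\<exists>d h. 0 < d \<and> summable h \<and> range h \<subseteq> \<real>\<^sub>\<ge>\<^sub>0 \<and>
        (\<forall>\<^sub>F n in sequentially. \<forall>y\<in>ball s d \<inter> ?S. cmod (zeta_term M n y) \<le> cmod (h n))"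
    proof (intro exI[of _ r] exI[of _ ?h] conjI always_eventually allI ballI)
      show "summable ?h"
        by (intro summable_of_real summable_mult summable_Suc_powr) (use r in auto)
      show "range ?h \<subseteq> \<real>\<^sub>\<ge>\<^sub>0" using Q P0 by (auto simp del: of_real_mult)
      fix n y assume y: "y \<in> ball s r \<inter> ?S"
      have "\<bar>Re (s - y)\<bar> \<le> norm (s - y)" by (rule abs_Re_le_cmod)
      hence "Re y \<ge> Re s - r" using y by (auto simp: dist_norm)
      moreover have "Re s + real M = 2 * r" by (simp add: r_def)
      ultimately have "Re y + real M + 1 \<ge> 1 + r" by linarith
      hence "norm (zeta_term M n y) \<le> Q * (P * (real n + 1) powr (- (1 + r)))"
        using y r P[of y] by (intro Q) (auto simp del: pochhammer_Suc)
      also have "\<dots> = cmod (?h n)" unfolding norm_of_real using Q P0 by simp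
      finally show "cmod (zeta_term M n y) \<le> cmod (?h n)" .
    qed (use r in auto)
  qed
  show ?thesis
    by (rule that[of g]) (use g in \<open>auto simp: holomorphic_on_def field_differentiable_at_within\<close>)
qed

lemma holomorphic_zeta_em: "zeta_em M holomorphic_on ({s. Re s > - real M} - {1})"
proof -
  obtain g where g: "\<And>s. Re s > - real M \<Longrightarrow> s \<noteq> 1 \<Longrightarrow> (\<lambda>n. zeta_term M n s) sums g s"
    "g holomorphic_on ({s. Re s > - real M} - {1})"
    using zeta_term_series[of M] by blast
  have "(\<lambda>s. 1 - (\<Sum>j\<le>Suc M. (-1) ^ j * of_real (bernoulli_coeff j) * powr_family s j 1) + g s)
          holomorphic_on ({s. Re s > - real M} - {1})"
    by (intro holomorphic_intros g(2) holomorphic_on_subset[OF holomorphic_on_powr_family]) auto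
  thus ?thesis
    by (rule holomorphic_transform) (use g(1) sums_unique in \<open>auto simp: zeta_em_def\<close>)
qed

text \<open>The subtracted terms telescope, and for \<open>Re s > 1\<close> the boundary terms at infinity
  vanish.\<close>

lemma zeta_em_sums:
  assumes "Re s > 1"
  shows "(\<lambda>n. 1 / of_nat (Suc n) powr s) sums zeta_em M s"
proof -
  from assms have s1: "s \<noteq> 1" by auto
  let ?c = "\<lambda>j. (-1) ^ j * complex_of_real (bernoulli_coeff j)"
  have lim: "(\<lambda>N. powr_family s j (real N + 1)) \<longlonglongrightarrow> 0" for j
  proof -
    have top: "filterlim (\<lambda>N. real N + 1) at_top sequentially"
      by real_asymp
    have pow: "(\<lambda>N. of_real (real N + 1) powr a :: complex) \<longlonglongrightarrow> 0" if "Re a < 0" for a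
    proof (rule tendsto_norm_zero_cancel)
      have "((\<lambda>x. x powr Re a) \<longlongrightarrow> 0) at_top"
        using tendsto_neg_powr[OF that filterlim_ident] .
      from filterlim_compose[OF this top]
      have "(\<lambda>N. (real N + 1) powr Re a) \<longlonglongrightarrow> 0" .
      thus "(\<lambda>N. norm (of_real (real N + 1) powr a :: complex)) \<longlonglongrightarrow> 0"
        by (simp add: norm_powr_real_powr del: of_real_add)
    qed
    show ?thesis
    proof (cases j)
      case 0
      show ?thesis unfolding 0 powr_family.simps
        by (rule tendsto_divide_zero, rule pow) (use assms in auto)
    next
      case (Suc i)
      show ?thesis unfolding Suc powr_family.simps
        by (rule tendsto_mult_right_zero, rule pow) (use assms in auto)
    qed
  qed
  obtain g where g: "\<And>s. Re s > - real M \<Longrightarrow> s \<noteq> 1 \<Longrightarrow> (\<lambda>n. zeta_term M n s) sums g s"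
    "g holomorphic_on ({s. Re s > - real M} - {1})"
    using zeta_term_series[of M] by blast
  have "Re s > - real M" using assms of_nat_0_le_iff[of M, where ?'a = real] by linarith
  hence "(\<lambda>n. zeta_term M n s) sums (\<Sum>n. zeta_term M n s)"
    using g(1)[of s] s1 by (simp add: sums_iff)
  hence lim1: "(\<lambda>N. \<Sum>n<N. zeta_term M n s) \<longlonglongrightarrow> (\<Sum>n. zeta_term M n s)"
    by (simp add: sums_def)
  have tel: "(\<Sum>n<N. zeta_term M n s) = (\<Sum>n<N. powr_family s 1 (real n + 1 + 1))
     - (\<Sum>j\<le>Suc M. ?c j * (powr_family s j (real N + 1) - powr_family s j 1))" for N
    by (induction N) (simp_all add: zeta_term_def sum_subtractf right_diff_distrib add.commute)
  have eq: "(\<Sum>n<Suc N. 1 / of_nat (Suc n) powr s) = 1 + (\<Sum>n<N. zeta_term M n s)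
     + (\<Sum>j\<le>Suc M. ?c j * (powr_family s j (real N + 1) - powr_family s j 1))" for N
    unfolding tel by (subst sum.lessThan_Suc_shift) (simp add: powr_minus_divide add_ac)
  have "(\<lambda>N. \<Sum>n<Suc N. 1 / of_nat (Suc n) powr s) \<longlonglongrightarrow>
      1 + (\<Sum>n. zeta_term M n s) + (\<Sum>j\<le>Suc M. ?c j * (0 - powr_family s j 1))"
    unfolding eq by (intro tendsto_intros lim1 lim)
  also have "1 + (\<Sum>n. zeta_term M n s) + (\<Sum>j\<le>Suc M. ?c j * (0 - powr_family s j 1)) = zeta_em M s"
    by (simp add: zeta_em_def sum_negf)
  finally show ?thesis unfolding sums_def by (rule LIMSEQ_imp_Suc[unfolded o_def])
qed

lemma zeta_em_unique:
  assumes f: "f holomorphic_on (- {1})"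
    and f': "\<And>s. Re s > 1 \<Longrightarrow> (\<lambda>n. 1 / of_nat (Suc n) powr s) sums f s"
    and s: "Re s > - real M" "s \<noteq> 1"
  shows "f s = zeta_em M s"
proof (rule analytic_continuation_open[of "{s. Re s > 1}" "{s. Re s > - real M} - {1}" f "zeta_em M"])
  show "open {s. Re s > 1}" by (rule open_halfspace_Re_gt)
  show "{s. Re s > 1} \<noteq> {}" by (auto intro: exI[of _ 2])
  show "f holomorphic_on ({s. Re s > - real M} - {1})"
    by (rule holomorphic_on_subset[OF f]) auto
  show "f z = zeta_em M z" if "z \<in> {s. Re s > 1}" for z
    using that f' zeta_em_sums sums_unique2 by blast
qed (use s half_plane_minus_point holomorphic_zeta_em in auto)

text \<open>By the identity theorem the continuations to the half planes \<open>Re s > -M\<close> agree, and these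
  half planes exhaust the plane. Existence is needed since the zeta function is defined by choice.\<close>

lemma riemann_zeta_exists:
  "\<exists>f. f holomorphic_on (- {1}) \<and> (\<forall>s. Re s > 1 \<longrightarrow> (\<lambda>n. 1 / of_nat (Suc n) powr s) sums f s)"
proof -
  define L where "L s = Suc (nat \<lceil>\<bar>Re s\<bar>\<rceil>)" for s :: complex
  have L: "Re s > - real (L s)" for s
    unfolding L_def by linarith
  define f where "f s = zeta_em (L s) s" for s
  have agree: "zeta_em M s = zeta_em N s"
    if "M \<le> N" "Re s > - real M" "s \<noteq> 1" for M N s
  proof (rule analytic_continuation_open[of "{s. Re s > 1}" "{s. Re s > - real M} - {1}" "zeta_em M" "zeta_em N"])
    show "open {s. Re s > 1}" by (rule open_halfspace_Re_gt)
    show "{s. Re s > 1} \<noteq> {}" by (auto intro: exI[of _ 2])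
    show "zeta_em N holomorphic_on ({s. Re s > - real M} - {1})"
      by (rule holomorphic_on_subset[OF holomorphic_zeta_em[of N]]) (use that in auto)
    show "zeta_em M z = zeta_em N z" if "z \<in> {s. Re s > 1}" for z
      using that zeta_em_sums sums_unique2 by blast
  qed (use that half_plane_minus_point holomorphic_zeta_em in auto)
  have f_eq: "f s = zeta_em M s" if "Re s > - real M" "s \<noteq> 1" for M s
  proof (cases "M \<le> L s")
    case True
    show ?thesis unfolding f_def by (rule agree[OF True that, symmetric])
  next
    case False
    hence "L s \<le> M" by simp
    show ?thesis unfolding f_def by (rule agree[OF \<open>L s \<le> M\<close> L that(2)])
  qed
  have "f holomorphic_on (\<Union>M. {s. Re s > - real M} - {1})"
  proof (rule holomorphic_on_UN_open)
    show "f holomorphic_on {s. Re s > - real M} - {1}" for M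
      by (rule holomorphic_transform[OF holomorphic_zeta_em[of M]]) (auto simp: f_eq)
  qed (rule half_plane_minus_point)
  also have "(\<Union>M. {s. Re s > - real M} - {1}) = - {1}"
  proof (intro subset_antisym subsetI)
    fix s :: complex assume "s \<in> - {1}"
    thus "s \<in> (\<Union>M. {s. Re s > - real M} - {1})"
      using L[of s] by (intro UN_I[of "L s"]) simp_all
  qed blast
  finally have "f holomorphic_on (- {1})" .
  moreover have "(\<lambda>n. 1 / of_nat (Suc n) powr s) sums f s" if "Re s > 1" for s
    using zeta_em_sums[OF that] by (simp add: f_def)
  ultimately show ?thesis by (intro exI[of _ f] conjI allI impI)
qed

lemma riemann_zeta_eq_zeta_em:
  assumes "Re s > - real M" "s \<noteq> 1"
  shows "riemann_zeta s = zeta_em M s"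
proof -
  have *: "riemann_zeta holomorphic_on (- {1}) \<and>
      (\<forall>s. Re s > 1 \<longrightarrow> (\<lambda>n. 1 / of_nat (Suc n) powr s) sums riemann_zeta s)"
    unfolding riemann_zeta_def by (rule someI_ex[OF riemann_zeta_exists])
  show ?thesis by (rule zeta_em_unique) (use * assms in auto)
qed

lemma monomial_over_fact_deriv:
  "((\<lambda>x. c / fact (Suc p) * x ^ Suc p) has_real_derivative c / fact p * x ^ p) (at x)"
proof -
  have "((\<lambda>x. c / fact (Suc p) * x ^ Suc p) has_real_derivative
          c / fact (Suc p) * (of_nat (Suc p) * x ^ p)) (at x)"
    by (rule DERIV_cmult) (use DERIV_pow[of "Suc p" x UNIV] in simp)
  moreover have "c / fact (Suc p) * (of_nat (Suc p) * x ^ p) = c / fact p * x ^ p"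
    unfolding fact_Suc of_nat_mult by (simp add: field_simps del: of_nat_Suc)
  ultimately show ?thesis by simp
qed

text \<open>The iterated derivatives of a monomial: with \<open>s = -m\<close> the coefficients of
  \<open>powr_family\<close> become falling factorials.\<close>

lemma pochhammer_minus_of_nat:
  "i \<le> m \<Longrightarrow> (- 1) ^ i * pochhammer (- of_nat m) i = (fact m / fact (m - i) :: complex)"
proof (induction i)
  case (Suc i)
  then obtain p where m: "m = Suc (i + p)" by (metis add_Suc less_iff_Suc_add Suc_le_eq)
  hence IH: "(- 1) ^ i * pochhammer (- of_nat m) i = (fact m / fact (Suc p) :: complex)"
    using Suc by simp
  have "(- 1) ^ Suc i * pochhammer (- of_nat m) (Suc i)
          = ((- 1) ^ i * pochhammer (- of_nat m) i) * (of_nat (Suc p) :: complex)"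
    by (simp add: pochhammer_Suc m algebra_simps)
  also have "\<dots> = fact m / fact p"
    unfolding IH fact_Suc[of p] by (simp add: field_simps del: of_nat_Suc fact_Suc)
  finally show ?case by (simp add: m)
qed auto

text \<open>For \<open>s = -m\<close> the function \<open>x powr (-s)\<close> is a monomial, so Euler--Maclaurin
  summation to a higher order is exact and \<open>\<zeta>(s)\<close> is a finite sum of derivatives at 1. Exactness on
  \<open>[0,1]\<close> moves these derivatives to 0, where only the one of order \<open>m\<close> survives.\<close>

lemma riemann_zeta_neg_odd:
  assumes "k \<ge> 1"
  shows "riemann_zeta (1 - 2 * of_nat k) = - of_real (bernoulli_coeff (2 * k) * fact (2 * k - 1))"
proof -
  define s :: complex where "s = 1 - 2 * of_nat k"
  define m where "m = 2 * k - 1"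
  have m: "2 * k = Suc m" "s = - of_nat m" "m \<ge> 1" using assms by (auto simp: m_def s_def of_nat_diff)
  have "Re s = - real m" by (simp add: m(2))
  hence s1: "s \<noteq> 1" by auto
  \<comment> \<open>The scaled primitive of \<open>x\<^sup>m\<close> and its derivatives, which extend \<open>powr_family\<close> to 0.\<close>
  define F :: "nat \<Rightarrow> real \<Rightarrow> complex" where
    "F j x = (if j \<le> Suc m then of_real (fact m / fact (Suc m - j) * x ^ (Suc m - j)) else 0)" for j x
  have Fder: "(F j has_vector_derivative F (Suc j) x) (at x)" for j x
  proof (cases "j \<le> m")
    case True
    have "((\<lambda>x. fact m / fact (Suc m - j) * x ^ (Suc m - j)) has_real_derivative
            fact m / fact (m - j) * x ^ (m - j)) (at x)"
      using monomial_over_fact_deriv[of "fact m" "m - j" x] True by (simp only: Suc_diff_le)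
    hence "((\<lambda>x. complex_of_real (fact m / fact (Suc m - j) * x ^ (Suc m - j))) has_vector_derivative
            of_real (fact m / fact (m - j) * x ^ (m - j))) (at x)"
      by (intro has_vector_derivative_of_real) (simp add: has_real_derivative_iff_has_vector_derivative)
    thus ?thesis using True by (simp add: F_def[abs_def])
  next
    case False
    hence "F j = (\<lambda>x. if j = Suc m then of_real (fact m) else 0)" "F (Suc j) x = 0"
      by (auto simp: F_def fun_eq_iff)
    thus ?thesis by auto
  qed
  have F1: "F j x = powr_family s j x" if "x > 0" for j x
  proof (cases j)
    case 0
    have "1 - s = of_nat (Suc m)" by (simp add: m(2))
    thus ?thesis unfolding 0 powr_family.simps using that
      by (simp only: powr_nat' of_real_eq_0_iff) (simp add: F_def powr_nat' del: of_nat_Suc power_Suc)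
  next
    case (Suc i)
    show ?thesis
    proof (cases "i \<le> m")
      case True
      have "- s - of_nat i = of_nat (m - i)" using True by (simp add: m(2) of_nat_diff)
      hence "of_real x powr (- s - of_nat i) = (of_real x ^ (m - i) :: complex)"
        using that by (simp add: powr_nat')
      moreover have "(- 1) ^ i * pochhammer s i = fact m / fact (m - i)"
        unfolding m(2) by (rule pochhammer_minus_of_nat[OF True])
      ultimately show ?thesis using True unfolding Suc powr_family.simps by (simp add: F_def)
    next
      case False
      hence "pochhammer s i = 0"
        using m(2) by (auto simp: pochhammer_eq_0_iff)
      thus ?thesis using False Suc by (simp add: F_def)
    qed
  qed
  have F_last: "F (Suc m + 2) = (\<lambda>_. 0)" by (simp add: F_def fun_eq_iff)
  have step: "F 1 (x + 1) = (\<Sum>j\<le>Suc (Suc m). (-1) ^ j * of_real (bernoulli_coeff j) * (F j (x + 1) - F j x))" for x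
    using euler_maclaurin_step[of x F "Suc m"] Fder F_last
    by (simp add: em_remainder_def del: bernoulli_coeff.simps sum.atMost_Suc)
  have "zeta_term (Suc m) n s = 0" for n
    unfolding zeta_term_def using step[of "real n + 1"] F1 by simp
  hence zeta: "riemann_zeta s = 1 - (\<Sum>j\<le>Suc (Suc m). (-1) ^ j * of_real (bernoulli_coeff j) * F j 1)"
    using riemann_zeta_eq_zeta_em[of "Suc m" s] m(2) s1 F1
    by (simp add: zeta_em_def del: bernoulli_coeff.simps sum.atMost_Suc)
  \<comment> \<open>The formula is exact also on \<open>[0,1]\<close>, as the monomial is smooth at 0.\<close>
  have e1: "F 1 (0 + 1) = (\<Sum>j\<le>Suc (Suc m). (-1) ^ j * of_real (bernoulli_coeff j) * F j 1)
       - (\<Sum>j\<le>Suc (Suc m). (-1) ^ j * of_real (bernoulli_coeff j) * F j 0)"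
    by (subst step) (simp add: sum_subtractf right_diff_distrib del: bernoulli_coeff.simps sum.atMost_Suc)
  have e2: "F 1 (0 + 1) = 1" by (simp add: F_def)
  have e3: "(\<Sum>j\<le>Suc (Suc m). (-1) ^ j * of_real (bernoulli_coeff j) * F j 0)
     = (\<Sum>j\<in>{Suc m}. (-1) ^ j * of_real (bernoulli_coeff j) * F j 0)"
    by (rule sum.mono_neutral_right) (auto simp: F_def)
  have e4: "(\<Sum>j\<in>{Suc m}. (-1) ^ j * of_real (bernoulli_coeff j) * F j 0) = of_real (bernoulli_coeff (2 * k) * fact (2 * k - 1))"
  proof -
    have "(-1::complex) ^ Suc m = 1" unfolding m(1)[symmetric] by simp
    moreover have "F (Suc m) 0 = fact m" by (simp add: F_def)
    ultimately show ?thesis by (simp add: m(1) del: bernoulli_coeff.simps power_Suc)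
  qed
  have "1 = (\<Sum>j\<le>Suc (Suc m). (-1) ^ j * complex_of_real (bernoulli_coeff j) * F j 1)
       - of_real (bernoulli_coeff (2 * k) * fact (2 * k - 1))"
    using e1 unfolding e2 e3 e4 .
  moreover have "1 - A = - B" if "1 = A - B" for A B :: complex
    using that by (simp add: algebra_simps)
  ultimately have "riemann_zeta s = - of_real (bernoulli_coeff (2 * k) * fact (2 * k - 1))"
    unfolding zeta by blast
  thus ?thesis by (simp only: s_def)
qed

section \<open>The Bessel--Clifford function\<close>

definition clifford_coeff :: "real \<Rightarrow> nat \<Rightarrow> real" where
  "clifford_coeff \<nu> k = (-1) ^ k * rGamma (\<nu> + real k + 1) / fact k"

text \<open>The entire function with \<open>J\<^sub>\<nu>(x) = (x/2)\<^sup>\<nu> C(x\<^sup>2/4)\<close>. It has no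
  branch point and obeys simpler recurrences than \<open>J\<^sub>\<nu>\<close>. It is used with real and with complex
  arguments.\<close>

definition clifford :: "real \<Rightarrow> 'a::{real_normed_field,banach} \<Rightarrow> 'a" where
  "clifford \<nu> z = (\<Sum>k. of_real (clifford_coeff \<nu> k) * z ^ k)"

lemma clifford_coeff_0: "clifford_coeff \<nu> 0 = rGamma (1 + \<nu>)"
  by (simp add: clifford_coeff_def add.commute)

lemma clifford_coeff_Suc: "of_nat (Suc k) * clifford_coeff \<nu> (Suc k) = - clifford_coeff (\<nu> + 1) k"
  unfolding clifford_coeff_def fact_Suc
  by (simp add: field_simps del: of_nat_Suc) (simp add: algebra_simps)

lemma of_real_clifford_coeff_Suc:
  "of_nat (Suc k) * (of_real (clifford_coeff \<nu> (Suc k)) :: 'a::real_normed_field)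
     = - of_real (clifford_coeff (\<nu> + 1) k)"
  using arg_cong[OF clifford_coeff_Suc[of k \<nu>], of "of_real :: real \<Rightarrow> 'a"]
  by (simp del: of_nat_Suc)

lemma clifford_coeff_shift: "clifford_coeff \<nu> k = (\<nu> + 1 + real k) * clifford_coeff (\<nu> + 1) k"
proof -
  have "rGamma (\<nu> + real k + 1) = (\<nu> + real k + 1) * rGamma (\<nu> + real k + 1 + 1)"
    by (rule rGamma_plus1[symmetric])
  thus ?thesis by (simp add: clifford_coeff_def algebra_simps)
qed

text \<open>The ratio of consecutive coefficients tends to 0.\<close>

lemma summable_norm_clifford:
  fixes z :: "'a::{real_normed_field,banach}"
  shows "summable (\<lambda>k. norm (of_real (clifford_coeff \<nu> k) * z ^ k))"
proof (rule summable_ratio_test)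
  show "1 / 2 < (1::real)" by simp
  fix k :: nat
  assume k: "k \<ge> nat \<lceil>\<bar>\<nu>\<bar> + 2 * norm z\<rceil> + 1"
  have k': "real k \<ge> \<bar>\<nu>\<bar> + 2 * norm z" using k by linarith
  have "\<bar>rGamma (\<nu> + real k + 1)\<bar> = \<bar>\<nu> + real k + 1\<bar> * \<bar>rGamma (\<nu> + real k + 2)\<bar>"
    using rGamma_plus1[of "\<nu> + real k + 1"] by (simp add: abs_mult[symmetric] add.assoc)
  moreover have "\<bar>\<nu> + real k + 1\<bar> \<ge> 1" using k' norm_ge_zero[of z] by linarith
  ultimately have r: "\<bar>rGamma (\<nu> + real k + 2)\<bar> \<le> \<bar>rGamma (\<nu> + real k + 1)\<bar>"
    using mult_right_mono[of 1 "\<bar>\<nu> + real k + 1\<bar>" "\<bar>rGamma (\<nu> + real k + 2)\<bar>"] by simp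
  have z: "norm z / (1 + real k) \<le> 1 / 2" using k' by (simp add: field_simps)
  have "norm (of_real (clifford_coeff \<nu> (Suc k)) * z ^ Suc k)
      = \<bar>rGamma (\<nu> + real k + 2)\<bar> / fact k * norm z ^ k * (norm z / (1 + real k))"
    unfolding norm_mult norm_power norm_of_real clifford_coeff_def fact_Suc
    by (simp add: abs_mult add_ac mult_ac power_abs)
  also have "\<dots> \<le> \<bar>rGamma (\<nu> + real k + 1)\<bar> / fact k * norm z ^ k * (1 / 2)"
    by (intro mult_mono divide_right_mono r z) auto
  also have "\<dots> = 1 / 2 * norm (of_real (clifford_coeff \<nu> k) * z ^ k)"
    unfolding norm_mult norm_power norm_of_real clifford_coeff_def
    by (simp add: abs_mult power_abs)
  finally show "norm (norm (of_real (clifford_coeff \<nu> (Suc k)) * z ^ Suc k))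
     \<le> 1 / 2 * norm (norm (of_real (clifford_coeff \<nu> k) * z ^ k))" by simp
qed

lemma clifford_sums:
  fixes z :: "'a::{real_normed_field,banach}"
  shows "(\<lambda>k. of_real (clifford_coeff \<nu> k) * z ^ k) sums clifford \<nu> z"
  unfolding clifford_def by (intro summable_sums summable_norm_cancel[OF summable_norm_clifford])

lemma clifford_of_real:
  "clifford \<nu> (of_real x :: 'a::{real_normed_field,banach}) = of_real (clifford \<nu> x)"
proof -
  have "(\<lambda>k. of_real (clifford_coeff \<nu> k * x ^ k) :: 'a) sums of_real (clifford \<nu> x)"
    using clifford_sums[of \<nu> x] by (intro sums_of_real) simp
  thus ?thesis using clifford_sums[of \<nu> "of_real x :: 'a"] sums_unique2 by force
qed

lemma clifford_at_0: "clifford \<nu> (0::'a::{real_normed_field,banach}) = of_real (rGamma (1 + \<nu>))"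
  using clifford_sums[of \<nu> "0::'a"] powser_sums_zero_iff[of "\<lambda>k. of_real (clifford_coeff \<nu> k) :: 'a"]
  by (simp add: clifford_coeff_0)

lemma clifford_deriv:
  fixes z :: "'a::{real_normed_field,banach}"
  shows "(clifford \<nu> has_field_derivative - clifford (\<nu> + 1) z) (at z)"
proof -
  have "((\<lambda>z. \<Sum>k. of_real (clifford_coeff \<nu> k) * z ^ k) has_field_derivative
          (\<Sum>k. diffs (\<lambda>k. of_real (clifford_coeff \<nu> k)) k * z ^ k)) (at z)"
    by (rule termdiffs_strong_converges_everywhere)
       (rule summable_norm_cancel[OF summable_norm_clifford])
  also have "diffs (\<lambda>k. of_real (clifford_coeff \<nu> k)) = (\<lambda>k. - (of_real (clifford_coeff (\<nu> + 1) k) :: 'a))"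
    unfolding diffs_def of_real_clifford_coeff_Suc ..
  also have "(\<Sum>k. - of_real (clifford_coeff (\<nu> + 1) k) * z ^ k) = - clifford (\<nu> + 1) z"
    using sums_minus[OF clifford_sums[of "\<nu> + 1" z]] by (simp add: sums_iff)
  finally show ?thesis by (simp add: clifford_def[abs_def])
qed

lemmas clifford_deriv' [derivative_intros] = DERIV_chain2[OF clifford_deriv]

lemma continuous_on_clifford [continuous_intros]:
  "continuous_on A f \<Longrightarrow> continuous_on A (\<lambda>x. clifford \<nu> (f x :: 'a::{real_normed_field,banach}))"
  by (rule continuous_on_compose2[of UNIV "clifford \<nu>"])
     (auto intro!: continuous_at_imp_continuous_on DERIV_isCont clifford_deriv)

text \<open>The three-term recurrence of the Bessel functions.\<close>

lemma clifford_rec: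
  fixes z :: "'a::{real_normed_field,banach}"
  shows "clifford \<nu> z = of_real (\<nu> + 1) * clifford (\<nu> + 1) z - z * clifford (\<nu> + 2) z"
proof -
  let ?c = "\<lambda>k. of_real (clifford_coeff (\<nu> + 1) k) :: 'a"
  have "(\<lambda>k. of_nat (Suc k) * ?c (Suc k) * z ^ k) sums (- clifford (\<nu> + 2) z)"
    using sums_minus[OF clifford_sums[of "\<nu> + 1 + 1" z]]
    unfolding of_real_clifford_coeff_Suc by (simp add: add.assoc)
  hence "(\<lambda>k. z * (of_nat (Suc k) * ?c (Suc k) * z ^ k)) sums (z * - clifford (\<nu> + 2) z)"
    by (rule sums_mult)
  hence "(\<lambda>k. of_nat (Suc k) * ?c (Suc k) * z ^ Suc k) sums (- z * clifford (\<nu> + 2) z)"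
    by (simp add: mult_ac del: of_nat_Suc)
  hence "(\<lambda>k. of_nat k * ?c k * z ^ k) sums (- z * clifford (\<nu> + 2) z)"
    by (subst (asm) sums_Suc_iff) simp
  from sums_add[OF sums_mult[OF clifford_sums[of "\<nu> + 1" z], of "of_real (\<nu> + 1)"] this]
  have "(\<lambda>k. of_real (\<nu> + 1) * (?c k * z ^ k) + of_nat k * ?c k * z ^ k)
      sums (of_real (\<nu> + 1) * clifford (\<nu> + 1) z + - z * clifford (\<nu> + 2) z)" .
  also have "(\<lambda>k. of_real (\<nu> + 1) * (?c k * z ^ k) + of_nat k * ?c k * z ^ k)
      = (\<lambda>k. of_real (clifford_coeff \<nu> k) * z ^ k)"
    unfolding clifford_coeff_shift[of \<nu>] by (simp add: fun_eq_iff algebra_simps)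
  finally show ?thesis using clifford_sums[of \<nu> z] sums_unique2 by force
qed

text \<open>The system rotates the vector \<open>(y\<^sub>1, y\<^sub>2)\<close>, with an indefinite perturbation of
  size \<open>c/x\<close> that is not integrable at infinity. Adding the cross term \<open>-2 c x powr (-1/2)
  y\<^sub>1 y\<^sub>2\<close> to the square of the length cancels the perturbation to leading order, because the
  rotation turns \<open>y\<^sub>1 y\<^sub>2\<close> into \<open>y\<^sub>1\<^sup>2 - y\<^sub>2\<^sup>2\<close>. What is
  left is of size \<open>x powr (-3/2)\<close>, hence integrable.\<close>

lemma rotating_system_bounded:
  fixes y1 y2 :: "real \<Rightarrow> real"
  assumes d1: "\<And>x. x > 0 \<Longrightarrow> (y1 has_real_derivative (c / x * y1 x - x powr (-1/2) * y2 x)) (at x)"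
    and d2: "\<And>x. x > 0 \<Longrightarrow> (y2 has_real_derivative (x powr (-1/2) * y1 x - c / x * y2 x)) (at x)"
  shows "\<exists>B. \<forall>x\<ge>max 1 (4 * c\<^sup>2). (y1 x)\<^sup>2 + (y2 x)\<^sup>2 \<le> B"
proof -
  define X where "X = max 1 (4 * c\<^sup>2)"
  \<comment> \<open>The energy with its correction; \<open>\<Phi>\<close> absorbs the remaining growth into an integrating factor.\<close>
  define E where "E x = (y1 x)\<^sup>2 + (y2 x)\<^sup>2 - 2 * c * (x powr (-1/2) * (y1 x * y2 x))" for x
  define \<Phi> where "\<Phi> x = E x * exp (2 * \<bar>c\<bar> * x powr (-1/2))" for x
  have Ed: "(E has_real_derivative c * x powr (-3/2) * (y1 x * y2 x)) (at x)" if x: "x > 0" for x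
  proof -
    have w: "x powr (-1/2) * x powr (-1/2) = 1 / x"
      using x by (simp add: powr_add[symmetric] powr_minus_divide)
    have "((\<lambda>x. x powr (-1/2)) has_real_derivative (-1/2) * x powr (-1/2 - 1)) (at x)"
      by (rule has_real_derivative_powr[OF x])
    hence wd: "((\<lambda>x. x powr (-1/2)) has_real_derivative (-1/2) * x powr (-3/2)) (at x)" by simp
    let ?w = "x powr (-1/2)" and ?p = "y1 x" and ?q = "y2 x"
    have "(E has_real_derivative
        (2 * ?p * (c / x * ?p - ?w * ?q) + 2 * ?q * (?w * ?p - c / x * ?q)
         - 2 * c * ((-1/2) * x powr (-3/2) * (?p * ?q)
              + ?w * ((c / x * ?p - ?w * ?q) * ?q + ?p * (?w * ?p - c / x * ?q))))) (at x)"
      unfolding E_def[abs_def] by (rule derivative_eq_intros d1 d2 wd x refl | simp)+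
    also have "2 * ?p * (c / x * ?p - ?w * ?q) + 2 * ?q * (?w * ?p - c / x * ?q)
         - 2 * c * ((-1/2) * x powr (-3/2) * (?p * ?q)
              + ?w * ((c / x * ?p - ?w * ?q) * ?q + ?p * (?w * ?p - c / x * ?q)))
       = 2 * c * (1 / x) * (?p * ?p - ?q * ?q) - 2 * c * (?w * ?w) * (?p * ?p - ?q * ?q)
         + c * x powr (-3/2) * (?p * ?q)"
      by (simp add: algebra_simps)
    finally show ?thesis unfolding w by simp
  qed
  \<comment> \<open>Beyond \<open>4 c\<^sup>2\<close> the cross term is at most half of the square of the length.\<close>
  have small: "\<bar>2 * c * (x powr (-1/2) * (y1 x * y2 x))\<bar> \<le> ((y1 x)\<^sup>2 + (y2 x)\<^sup>2) / 2" if x: "x \<ge> X" for x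
  proof -
    have x1: "x \<ge> 1" "x \<ge> 4 * c\<^sup>2" using x by (auto simp: X_def)
    have "2 * \<bar>c\<bar> = sqrt (4 * c\<^sup>2)" by (simp add: real_sqrt_mult)
    also have "\<dots> \<le> sqrt x" using x1 by simp
    also have "\<dots> = x powr (1/2)" using x1 by (simp add: powr_half_sqrt)
    finally have "2 * \<bar>c\<bar> * x powr (-1/2) \<le> x powr (1/2) * x powr (-1/2)"
      by (intro mult_right_mono) auto
    also have "\<dots> = 1" using x1 by (simp add: powr_add[symmetric])
    finally have a: "2 * \<bar>c\<bar> * x powr (-1/2) \<le> 1" .
    have b: "\<bar>y1 x * y2 x\<bar> \<le> ((y1 x)\<^sup>2 + (y2 x)\<^sup>2) / 2"
      using sum_squares_bound[of "\<bar>y1 x\<bar>" "\<bar>y2 x\<bar>"] by (simp add: abs_mult)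
    have "\<bar>2 * c * (x powr (-1/2) * (y1 x * y2 x))\<bar> = (2 * \<bar>c\<bar> * x powr (-1/2)) * \<bar>y1 x * y2 x\<bar>"
      by (simp add: abs_mult)
    also have "\<dots> \<le> 1 * (((y1 x)\<^sup>2 + (y2 x)\<^sup>2) / 2)"
      by (intro mult_mono a b) auto
    finally show ?thesis by simp
  qed
  have mono: "\<Phi> x \<le> \<Phi> X" if x: "x \<ge> X" for x
  proof (rule DERIV_nonpos_imp_nonincreasing[OF x])
    fix t assume t: "X \<le> t" "t \<le> x"
    hence t0: "t > 0" by (auto simp: X_def)
    have "((\<lambda>x. x powr (-1/2)) has_real_derivative (-1/2) * t powr (-1/2 - 1)) (at t)"
      by (rule has_real_derivative_powr[OF t0])
    hence wd: "((\<lambda>x. x powr (-1/2)) has_real_derivative (-1/2) * t powr (-3/2)) (at t)" by simp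
    let ?e = "exp (2 * \<bar>c\<bar> * t powr (-1/2))"
    have "(\<Phi> has_real_derivative (c * t powr (-3/2) * (y1 t * y2 t) - \<bar>c\<bar> * t powr (-3/2) * E t) * ?e) (at t)"
      unfolding \<Phi>_def[abs_def]
      by (rule derivative_eq_intros Ed wd t0 refl)+ (simp add: algebra_simps)
    moreover have "c * t powr (-3/2) * (y1 t * y2 t) \<le> \<bar>c\<bar> * t powr (-3/2) * E t"
    proof -
      have "c * t powr (-3/2) * (y1 t * y2 t) \<le> \<bar>c * t powr (-3/2) * (y1 t * y2 t)\<bar>" by simp
      also have "\<dots> = \<bar>c\<bar> * t powr (-3/2) * \<bar>y1 t * y2 t\<bar>" by (simp add: abs_mult)
      also have "\<dots> \<le> \<bar>c\<bar> * t powr (-3/2) * E t"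
      proof (rule mult_left_mono)
        have "\<bar>y1 t * y2 t\<bar> \<le> ((y1 t)\<^sup>2 + (y2 t)\<^sup>2) / 2"
          using sum_squares_bound[of "\<bar>y1 t\<bar>" "\<bar>y2 t\<bar>"] by (simp add: abs_mult)
        also have "\<dots> \<le> E t" using small[OF t(1)] by (simp add: E_def)
        finally show "\<bar>y1 t * y2 t\<bar> \<le> E t" .
      qed auto
      finally show ?thesis .
    qed
    ultimately show "\<exists>y. (\<Phi> has_real_derivative y) (at t) \<and> y \<le> 0"
      by (intro exI conjI) (auto intro!: mult_nonpos_nonneg)
  qed
  have "(y1 x)\<^sup>2 + (y2 x)\<^sup>2 \<le> 2 * \<Phi> X" if x: "x \<ge> X" for x
  proof -
    have E: "((y1 x)\<^sup>2 + (y2 x)\<^sup>2) / 2 \<le> E x" using small[OF x] by (simp add: E_def)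
    have "0 \<le> ((y1 x)\<^sup>2 + (y2 x)\<^sup>2) / 2" by simp
    hence "E x \<ge> 0" using E by linarith
    hence "E x * 1 \<le> \<Phi> x" unfolding \<Phi>_def by (intro mult_left_mono) auto
    hence "E x \<le> \<Phi> x" by simp
    hence "((y1 x)\<^sup>2 + (y2 x)\<^sup>2) / 2 \<le> \<Phi> X"
      using E mono[OF x] by (meson order_trans)
    thus ?thesis by (simp only: divide_le_eq_numeral1 mult.commute)
  qed
  thus ?thesis unfolding X_def by blast
qed

text \<open>This is \<open>J\<^sub>\<nu>(x) = O(x powr (-1/2))\<close> for real order. Suitable powers of
  \<open>x\<close> times the functions of orders \<open>\<nu>\<close> and \<open>\<nu> + 1\<close> form a rotating
  system, so the energy estimate replaces an asymptotic formula for the Bessel function.\<close>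

lemma clifford_bound:
  assumes x0: "x0 > 0"
  obtains C where "C > 0" "\<And>x::real. x \<ge> x0 \<Longrightarrow> \<bar>clifford \<nu> x\<bar> \<le> C * x powr (- \<nu> / 2 - 1 / 4)"
proof -
  \<comment> \<open>The exponent for which the diagonal entries of the system are opposite.\<close>
  define c where "c = \<nu> / 2 + 1 / 4"
  define y1 where "y1 x = x powr c * clifford \<nu> x" for x :: real
  define y2 where "y2 x = x powr (c + 1 / 2) * clifford (\<nu> + 1) x" for x :: real
  have d1: "(y1 has_real_derivative (c / x * y1 x - x powr (-1/2) * y2 x)) (at x)" if x: "x > 0" for x
  proof -
    have "(y1 has_real_derivative (c * x powr (c - 1)) * clifford \<nu> x
            + - clifford (\<nu> + 1) x * x powr c) (at x)"
      unfolding y1_def[abs_def] by (rule DERIV_mult has_real_derivative_powr[OF x] clifford_deriv)+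
    moreover have "x powr (c - 1) = x powr c / x" using x by (simp add: powr_diff)
    moreover have "x powr (-1/2) * y2 x = x powr c * clifford (\<nu> + 1) x"
      unfolding y2_def mult.assoc[symmetric] by (simp add: powr_add[symmetric])
    ultimately show ?thesis by (simp add: y1_def mult_ac)
  qed
  have d2: "(y2 has_real_derivative (x powr (-1/2) * y1 x - c / x * y2 x)) (at x)" if x: "x > 0" for x
  proof -
    have "(y2 has_real_derivative ((c + 1/2) * x powr (c + 1/2 - 1)) * clifford (\<nu> + 1) x
            + - clifford (\<nu> + 1 + 1) x * x powr (c + 1/2)) (at x)"
      unfolding y2_def[abs_def] by (rule DERIV_mult has_real_derivative_powr[OF x] clifford_deriv)+
    moreover have "x powr (c + 1/2 - 1) = x powr (c + 1/2) / x"
      using x by (subst powr_diff) simp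
    moreover have "clifford (\<nu> + 1 + 1) x = ((\<nu> + 1) * clifford (\<nu> + 1) x - clifford \<nu> x) / x"
      using clifford_rec[of \<nu> x] x by (simp add: add.assoc field_simps)
    moreover have "x powr (-1/2) * y1 x = x powr (c + 1/2) / x * clifford \<nu> x"
    proof -
      have "x powr (-1/2) * x powr c = x powr (-1/2 + c)" by (rule powr_add[symmetric])
      also have "-1/2 + c = c + 1/2 - 1" by simp
      also have "x powr \<dots> = x powr (c + 1/2) / x" using x by (subst powr_diff) simp
      finally show ?thesis unfolding y1_def mult.assoc[symmetric] by simp
    qed
    moreover have "\<nu> = 2 * c - 1 / 2" by (simp add: c_def)
    moreover have "((c + 1/2) * (P / x)) * G1 + - (((2 * c - 1/2 + 1) * G1 - G0) / x) * P
        = P / x * G0 - c / x * (P * G1)" for P G0 G1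
      using x by (simp add: divide_simps) (simp add: algebra_simps)
    ultimately show ?thesis by (simp only: y2_def)
  qed
  obtain B where B: "\<And>x. x \<ge> max 1 (4 * c\<^sup>2) \<Longrightarrow> (y1 x)\<^sup>2 + (y2 x)\<^sup>2 \<le> B"
    using rotating_system_bounded[of y1 c y2, OF d1 d2] by blast
  define X where "X = max 1 (4 * c\<^sup>2)"
  have "continuous_on {x0..X} y1"
    unfolding y1_def by (intro continuous_intros) (use x0 in auto)
  hence "bounded (y1 ` {x0..X})"
    by (intro compact_imp_bounded compact_continuous_image compact_Icc)
  then obtain D where D: "\<And>x. x \<in> {x0..X} \<Longrightarrow> \<bar>y1 x\<bar> \<le> D"
    unfolding bounded_iff real_norm_def by blast
  define C where "C = max 1 (max D (sqrt B))"
  have y1: "\<bar>y1 x\<bar> \<le> C" if "x \<ge> x0" for x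
  proof (cases "x \<le> X")
    case True
    thus ?thesis using D[of x] that by (simp add: C_def)
  next
    case False
    hence "(y1 x)\<^sup>2 \<le> B" using B[of x] zero_le_power2[of "y2 x"] unfolding X_def by linarith
    hence "\<bar>y1 x\<bar> \<le> sqrt B" using real_le_rsqrt by simp
    thus ?thesis by (simp add: C_def)
  qed
  show ?thesis
  proof (rule that)
    show "C > 0" by (simp add: C_def)
    fix x assume x: "x \<ge> x0"
    hence x': "x > 0" using x0 by simp
    have "clifford \<nu> x = y1 x * x powr (- c)"
      using x' by (simp add: y1_def powr_minus field_simps)
    hence "\<bar>clifford \<nu> x\<bar> = \<bar>y1 x\<bar> * x powr (- c)" by (simp add: abs_mult)
    also have "\<dots> \<le> C * x powr (- c)" by (intro mult_right_mono y1 x) auto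
    finally show "\<bar>clifford \<nu> x\<bar> \<le> C * x powr (- \<nu> / 2 - 1 / 4)" by (simp add: c_def)
  qed
qed

section \<open>The Mellin transform of the Bessel--Clifford function on a half line\<close>

lemma powr_mult_powr: "a + b = c \<Longrightarrow> x powr a * x powr b = x powr c" for x :: real
  by (metis powr_add)

lemma lborel_of_nonneg_has_integral:
  fixes f :: "real \<Rightarrow> real"
  assumes [measurable]: "A \<in> sets borel" "f \<in> borel_measurable borel"
    and I: "(f has_integral I) A" and nn: "\<And>x. x \<in> A \<Longrightarrow> f x \<ge> 0"
  shows "set_integrable lborel A f" "(LINT x:A|lborel. f x) = I"
proof -
  have "f absolutely_integrable_on A"
    using I nn by (intro nonnegative_absolutely_integrable_1) auto
  hence "integrable lebesgue (\<lambda>x. indicator A x *\<^sub>R f x)"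
    by (simp add: set_integrable_def)
  moreover have "(\<lambda>x. indicator A x *\<^sub>R f x) \<in> borel_measurable lborel" by measurable
  ultimately show *: "set_integrable lborel A f"
    unfolding set_integrable_def by (simp add: integrable_completion)
  show "(LINT x:A|lborel. f x) = I"
    using set_borel_integral_eq_integral(2)[OF *] I by (simp add: integral_unique)
qed

lemma has_integral_drop_zeros:
  fixes f :: "'a::euclidean_space \<Rightarrow> 'b::banach"
  assumes "(f has_integral I) T" "S \<subseteq> T" "\<And>x. x \<in> T - S \<Longrightarrow> f x = 0"
  shows "(f has_integral I) S"
proof -
  have "((\<lambda>x. if x \<in> S then f x else 0) has_integral I) T"
    by (rule has_integral_eq[OF _ assms(1)]) (use assms(3) in auto)
  thus ?thesis using has_integral_restrict[OF assms(2)] by blast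
qed

lemma set_integral_sums:
  fixes f :: "nat \<Rightarrow> real \<Rightarrow> real"
  assumes int: "\<And>k. set_integrable lborel A (f k)"
    and le: "\<And>k. (LINT x:A|lborel. \<bar>f k x\<bar>) \<le> B k" and B: "summable B"
    and abs: "\<And>x. x \<in> A \<Longrightarrow> summable (\<lambda>k. \<bar>f k x\<bar>)"
    and g: "\<And>x. x \<in> A \<Longrightarrow> (\<lambda>k. f k x) sums g x"
  shows "set_integrable lborel A g" "(\<lambda>k. LINT x:A|lborel. f k x) sums (LINT x:A|lborel. g x)"
proof -
  let ?f = "\<lambda>k x. indicator A x *\<^sub>R f k x"
  have 1: "integrable lborel (?f k)" for k using int[of k] by (simp add: set_integrable_def)
  have 2: "AE x in lborel. summable (\<lambda>k. norm (?f k x))"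
    using abs by (intro AE_I2) (auto simp: indicator_def)
  have eq: "(\<integral>x. norm (?f k x) \<partial>lborel) = (LINT x:A|lborel. \<bar>f k x\<bar>)" for k
    unfolding set_lebesgue_integral_def by (intro Bochner_Integration.integral_cong) (auto simp: abs_mult)
  have 3: "summable (\<lambda>k. \<integral>x. norm (?f k x) \<partial>lborel)"
  proof (rule summable_comparison_test'[OF B, of 0])
    fix k show "norm (\<integral>x. norm (?f k x) \<partial>lborel) \<le> B k"
      using le[of k] by (simp add: eq integral_nonneg_AE flip: eq)
  qed
  have g': "(\<Sum>k. ?f k x) = indicator A x *\<^sub>R g x" for x
    using g[of x] by (auto simp: indicator_def sums_iff)
  show "set_integrable lborel A g"
    using integrable_suminf[OF 1 2 3] unfolding set_integrable_def g' .
  show "(\<lambda>k. LINT x:A|lborel. f k x) sums (LINT x:A|lborel. g x)"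
    using sums_integral[OF 1 2 3] unfolding set_lebesgue_integral_def g' .
qed

lemma set_integral_tail_FTC:
  fixes F f :: "real \<Rightarrow> real"
  assumes der: "\<And>x. x \<ge> X \<Longrightarrow> (F has_real_derivative f x) (at x)"
    and int: "set_integrable lborel {X..} f" and lim: "(F \<longlongrightarrow> 0) at_top"
  shows "(LINT x:{X..}|lborel. f x) = - F X"
proof -
  have "((\<lambda>b. LINT x:{X..b}|lborel. f x) \<longlongrightarrow> (LINT x:{X..}|lborel. f x)) at_top"
    by (rule tendsto_set_lebesgue_integral_at_top) (use int in auto)
  moreover have "((\<lambda>b. LINT x:{X..b}|lborel. f x) \<longlongrightarrow> 0 - F X) at_top"
  proof (rule Lim_transform_eventually)
    show "((\<lambda>b. F b - F X) \<longlongrightarrow> 0 - F X) at_top" by (intro tendsto_intros lim)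
    show "\<forall>\<^sub>F b in at_top. F b - F X = (LINT x:{X..b}|lborel. f x)"
      using eventually_ge_at_top[of X]
    proof eventually_elim
      case (elim b)
      have "set_integrable lborel {X..b} f"
        by (rule set_integrable_subset[OF int]) auto
      hence "(LINT x:{X..b}|lborel. f x) = integral {X..b} f"
        by (rule set_borel_integral_eq_integral)
      also have "\<dots> = F b - F X"
      proof (intro integral_unique fundamental_theorem_of_calculus)
        show "X \<le> b" by fact
        fix x assume "x \<in> {X..b}"
        thus "(F has_vector_derivative f x) (at x within {X..b})"
          using der[of x] by (simp add: has_real_derivative_iff_has_vector_derivative has_vector_derivative_at_within)
      qed
      finally show ?case by simp
    qed
  qed
  ultimately show ?thesis using tendsto_unique[OF trivial_limit_at_top_linorder] by fastforce
qed

lemma borel_measurable_clifford [measurable]: "clifford \<nu> \<in> borel_measurable (borel :: real measure)"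
  by (intro borel_measurable_continuous_onI continuous_on_clifford continuous_on_id)

lemma gamma_integral_scaled:
  fixes p y :: real
  assumes "p > 0" "y > 0"
  shows "set_integrable lborel {0<..} (\<lambda>x. x powr (p - 1) * exp (- (x * y)))"
    "(LINT x:{0<..}|lborel. x powr (p - 1) * exp (- (x * y))) = Gamma p * y powr (- p)"
proof -
  let ?g = "\<lambda>t::real. t powr (p - 1) / exp t"
  have "(?g has_integral Gamma p) {0<..}"
    using Gamma_integral_real[OF assms(1)]
    by (rule has_integral_drop_zeros) auto
  moreover have "?g absolutely_integrable_on {0<..}"
    using calculation by (intro nonnegative_absolutely_integrable_1) auto
  moreover have img: "(\<lambda>x. x * y) ` {0<..} = {0<..}"
  proof (intro equalityI subsetI)
    fix x :: real assume "x \<in> {0<..}"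
    thus "x \<in> (\<lambda>x. x * y) ` {0<..}" using assms by (intro image_eqI[of _ _ "x / y"]) auto
  qed (use assms in auto)
  moreover have "(\<lambda>x. \<bar>y\<bar> * ?g (x * y)) absolutely_integrable_on {0<..} \<and>
      integral {0<..} (\<lambda>x. \<bar>y\<bar> * ?g (x * y)) = Gamma p \<longleftrightarrow>
      ?g absolutely_integrable_on ((\<lambda>x. x * y) ` {0<..}) \<and> integral ((\<lambda>x. x * y) ` {0<..}) ?g = Gamma p"
    by (rule has_absolute_integral_change_of_variables_1')
       (use assms in \<open>auto intro!: derivative_eq_intros inj_onI\<close>)
  ultimately have "(\<lambda>x. \<bar>y\<bar> * ?g (x * y)) absolutely_integrable_on {0<..}"
      "integral {0<..} (\<lambda>x. \<bar>y\<bar> * ?g (x * y)) = Gamma p"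
    by (auto simp: integral_unique)
  hence "((\<lambda>x. \<bar>y\<bar> * ?g (x * y)) has_integral Gamma p) {0<..}"
    using set_lebesgue_integral_eq_integral(1) has_integral_integral by metis
  hence "((\<lambda>x. y powr (- p) * (\<bar>y\<bar> * ?g (x * y))) has_integral y powr (- p) * Gamma p) {0<..}"
    by (rule has_integral_mult_right)
  moreover have "y powr (- p) * (\<bar>y\<bar> * ?g (x * y)) = x powr (p - 1) * exp (- (x * y))" if "x \<in> {0<..}" for x
  proof -
    have "y powr (- p) * (\<bar>y\<bar> * ?g (x * y)) = (y powr (- p) * (y powr 1 * y powr (p - 1))) * (x powr (p - 1) * exp (- (x * y)))"
      using assms that by (simp add: powr_mult exp_minus field_simps)
    also have "y powr (- p) * (y powr 1 * y powr (p - 1)) = 1"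
      using assms by (simp only: powr_add[symmetric]) simp
    finally show ?thesis by simp
  qed
  ultimately have I: "((\<lambda>x. x powr (p - 1) * exp (- (x * y))) has_integral Gamma p * y powr (- p)) {0<..}"
    by (subst has_integral_cong[of "{0<..}" _ "\<lambda>x. y powr (- p) * (\<bar>y\<bar> * ?g (x * y))"]) (auto simp: mult.commute)
  show "set_integrable lborel {0<..} (\<lambda>x. x powr (p - 1) * exp (- (x * y)))"
    "(LINT x:{0<..}|lborel. x powr (p - 1) * exp (- (x * y))) = Gamma p * y powr (- p)"
    by (rule lborel_of_nonneg_has_integral[OF _ _ I]; simp)+
qed

text \<open>Euler's integral after the substitution \<open>x \<mapsto> 1/x\<close>.\<close>

lemma gamma_integral_inverse:
  fixes p :: real
  assumes "p > 0"
  shows "(LINT x:{0<..}|lborel. x powr (- p - 1) * exp (- (1 / x))) = Gamma p"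
proof -
  let ?g = "\<lambda>t::real. t powr (p - 1) / exp t"
  have "(?g has_integral Gamma p) {0<..}"
    using Gamma_integral_real[OF assms(1)]
    by (rule has_integral_drop_zeros) auto
  moreover have "?g absolutely_integrable_on {0<..}"
    using calculation by (intro nonnegative_absolutely_integrable_1) auto
  moreover have img: "(\<lambda>x. inverse x) ` {0<..} = ({0<..} :: real set)"
  proof (intro equalityI subsetI)
    fix x :: real assume "x \<in> {0<..}"
    thus "x \<in> (\<lambda>x. inverse x) ` {0<..}" by (intro image_eqI[of _ _ "inverse x"]) auto
  qed auto
  moreover have "(\<lambda>x. \<bar>- (inverse x ^ 2)\<bar> * ?g (inverse x)) absolutely_integrable_on {0<..} \<and>
      integral {0<..} (\<lambda>x. \<bar>- (inverse x ^ 2)\<bar> * ?g (inverse x)) = Gamma p \<longleftrightarrow>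
      ?g absolutely_integrable_on ((\<lambda>x. inverse x) ` {0<..}) \<and> integral ((\<lambda>x. inverse x) ` {0<..}) ?g = Gamma p"
    by (rule has_absolute_integral_change_of_variables_1')
       (auto intro!: derivative_eq_intros inj_onI simp: power2_eq_square)
  ultimately have "(\<lambda>x. \<bar>- (inverse x ^ 2)\<bar> * ?g (inverse x)) absolutely_integrable_on {0<..}"
      "integral {0<..} (\<lambda>x. \<bar>- (inverse x ^ 2)\<bar> * ?g (inverse x)) = Gamma p"
    by (auto simp: integral_unique)
  hence "((\<lambda>x. \<bar>- (inverse x ^ 2)\<bar> * ?g (inverse x)) has_integral Gamma p) {0<..}"
    using set_lebesgue_integral_eq_integral(1) has_integral_integral by metis
  moreover have "\<bar>- (inverse x ^ 2)\<bar> * ?g (inverse x) = x powr (- p - 1) * exp (- (1 / x))" if "x \<in> {0<..}" for x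
  proof -
    have x: "x > 0" using that by simp
    have "\<bar>- (inverse x ^ 2)\<bar> = x powr (- 2)"
      using x by (simp add: powr_minus powr_numeral power_inverse)
    moreover have "inverse x powr (p - 1) = x powr (- (p - 1))"
      using x by (subst powr_minus) (simp add: inverse_powr)
    moreover have "x powr (- 2) * x powr (- (p - 1)) = x powr (- p - 1)"
      by (rule powr_mult_powr) simp
    ultimately show ?thesis by (simp add: exp_minus field_simps)
  qed
  ultimately have I: "((\<lambda>x. x powr (- p - 1) * exp (- (1 / x))) has_integral Gamma p) {0<..}"
    by (subst has_integral_cong[of "{0<..}" _ "\<lambda>x. \<bar>- (inverse x ^ 2)\<bar> * ?g (inverse x)"]) auto
  show ?thesis
    by (rule lborel_of_nonneg_has_integral[OF _ _ I]; simp)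
qed

lemma set_integral_powr_from_0:
  fixes e X :: real
  assumes "e > -1" "X \<ge> 0"
  shows "set_integrable lborel {0<..X} (\<lambda>x. x powr e)"
    "(LINT x:{0<..X}|lborel. x powr e) = X powr (e + 1) / (e + 1)"
proof -
  have "((\<lambda>x. x powr e) has_integral (X powr (e + 1) / (e + 1))) {0..X}"
    by (rule has_integral_powr_from_0) (use assms in auto)
  hence I: "((\<lambda>x. x powr e) has_integral (X powr (e + 1) / (e + 1))) {0<..X}"
    by (rule has_integral_drop_zeros) auto
  show "set_integrable lborel {0<..X} (\<lambda>x. x powr e)"
    "(LINT x:{0<..X}|lborel. x powr e) = X powr (e + 1) / (e + 1)"
    by (rule lborel_of_nonneg_has_integral[OF _ _ I]; simp)+
qed

lemma set_integrable_powr_tail: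
  fixes e X :: real
  assumes "e < -1" "X > 0"
  shows "set_integrable lborel {X..} (\<lambda>x. x powr e)"
  by (rule lborel_of_nonneg_has_integral(1)[OF _ _ has_integral_powr_to_inf[OF assms]]) auto

text \<open>With \<open>C(x) = O(x powr (-\<nu>/2 - 1/4))\<close> the condition on \<open>s\<close> says that the
  integrand decays faster than \<open>1/x\<close>.\<close>

lemma set_integrable_clifford_tail:
  assumes "X > 0" "2 * s + \<nu> > - 1 / 2"
  shows "set_integrable lborel {X..} (\<lambda>x. clifford \<nu> x * x powr (- s - 1))"
proof -
  obtain C where C: "C > 0" "\<And>x::real. x \<ge> X \<Longrightarrow> \<bar>clifford \<nu> x\<bar> \<le> C * x powr (- \<nu> / 2 - 1 / 4)"
    using clifford_bound[OF assms(1)] by blast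
  show ?thesis
  proof (rule set_integrable_bound)
    show "set_integrable lborel {X..} (\<lambda>x. C * x powr (- \<nu> / 2 - 1 / 4 + (- s - 1)))"
      by (intro set_integrable_mult_right set_integrable_powr_tail) (use assms in \<open>auto simp: field_simps\<close>)
    show "AE x in lborel. x \<in> {X..} \<longrightarrow> norm (clifford \<nu> x * x powr (- s - 1))
         \<le> norm (C * x powr (- \<nu> / 2 - 1 / 4 + (- s - 1)))"
    proof (intro AE_I2 impI)
      fix x assume x: "x \<in> {X..}"
      have "norm (clifford \<nu> x * x powr (- s - 1)) \<le> (C * x powr (- \<nu> / 2 - 1 / 4)) * x powr (- s - 1)"
        using C(2)[of x] x by (simp add: abs_mult mult_right_mono)
      also have "\<dots> = norm (C * x powr (- \<nu> / 2 - 1 / 4 + (- s - 1)))"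
        unfolding powr_add using C(1) by (simp add: abs_mult mult.assoc)
      finally show "norm (clifford \<nu> x * x powr (- s - 1)) \<le> norm (C * x powr (- \<nu> / 2 - 1 / 4 + (- s - 1)))" .
    qed
  qed (simp add: set_borel_measurable_def)
qed

lemma clifford_tendsto_0:
  assumes "2 * s + \<nu> > - 1 / 2"
  shows "((\<lambda>x::real. x powr (- s) * clifford \<nu> x) \<longlongrightarrow> 0) at_top"
proof -
  obtain C where C: "C > 0" "\<And>x::real. x \<ge> 1 \<Longrightarrow> \<bar>clifford \<nu> x\<bar> \<le> C * x powr (- \<nu> / 2 - 1 / 4)"
    using clifford_bound[of 1] by (metis zero_less_one)
  show ?thesis
  proof (rule Lim_null_comparison)
    show "\<forall>\<^sub>F x in at_top. norm (x powr (- s) * clifford \<nu> x) \<le> C * x powr (- s + (- \<nu> / 2 - 1 / 4))"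
      using eventually_ge_at_top[of 1]
    proof eventually_elim
      case (elim x)
      have "norm (x powr (- s) * clifford \<nu> x) \<le> x powr (- s) * (C * x powr (- \<nu> / 2 - 1 / 4))"
        using C(2)[of x] elim by (simp add: abs_mult mult_left_mono)
      also have "\<dots> = C * x powr (- s + (- \<nu> / 2 - 1 / 4))"
        unfolding powr_add by (simp only: mult_ac)
      finally show ?case .
    qed
    have "((\<lambda>x::real. x powr (- s + (- \<nu> / 2 - 1 / 4))) \<longlongrightarrow> 0) at_top"
      by (rule tendsto_neg_powr[OF _ filterlim_ident]) (use assms in \<open>simp add: field_simps\<close>)
    thus "((\<lambda>x::real. C * x powr (- s + (- \<nu> / 2 - 1 / 4))) \<longlongrightarrow> 0) at_top"
      by (rule tendsto_mult_right_zero)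
  qed
qed

text \<open>Weber's first exponential integral. Termwise integration is legitimate as each Gamma function produced
  cancels the one in the coefficient and an exponential series remains.\<close>

lemma weber_exponential_integral:
  assumes nu: "\<nu> > -1" and y: "y > 0"
  shows "set_integrable lborel {0<..} (\<lambda>x. clifford \<nu> x * x powr \<nu> * exp (- (x * y)))"
    "(LINT x:{0<..}|lborel. clifford \<nu> x * x powr \<nu> * exp (- (x * y))) = y powr (- \<nu> - 1) * exp (- (1 / y))"
proof -
  let ?c = "clifford_coeff \<nu>"
  let ?m = "\<lambda>k x. x powr (\<nu> + real k + 1 - 1) * exp (- (x * y))"
  let ?f = "\<lambda>k x. ?c k * ?m k x"
  have p: "\<nu> + real k + 1 > 0" for k using nu by simp
  note G = gamma_integral_scaled[OF p y]
  have nn: "\<bar>?f k x\<bar> = \<bar>?c k\<bar> * ?m k x" for k x by (simp add: abs_mult)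
  have val: "?c k * (Gamma (\<nu> + real k + 1) * y powr (- (\<nu> + real k + 1)))
      = y powr (- \<nu> - 1) * ((- (1 / y)) ^ k /\<^sub>R fact k)" for k
  proof -
    have "Gamma (\<nu> + real k + 1) * rGamma (\<nu> + real k + 1) = 1"
      using Gamma_real_pos[OF p[of k]] by (simp add: rGamma_inverse_Gamma)
    moreover have "y powr (- (\<nu> + real k + 1)) = y powr (- \<nu> - 1) * (1 / y) ^ k"
    proof -
      have "- (\<nu> + real k + 1) = (- \<nu> - 1) + - real k" by simp
      hence "y powr (- (\<nu> + real k + 1)) = y powr ((- \<nu> - 1) + - real k)" by (simp only:)
      also have "\<dots> = y powr (- \<nu> - 1) * y powr (- real k)" by (rule powr_add)
      also have "y powr (- real k) = (1 / y) ^ k"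
        using y by (simp add: powr_minus powr_realpow power_one_over inverse_eq_divide)
      finally show ?thesis .
    qed
    ultimately have "?c k * (Gamma (\<nu> + real k + 1) * y powr (- (\<nu> + real k + 1)))
      = (-1) ^ k / fact k * (Gamma (\<nu> + real k + 1) * rGamma (\<nu> + real k + 1)) * (y powr (- \<nu> - 1) * (1 / y) ^ k)"
      unfolding clifford_coeff_def by (simp only: times_divide_eq_left times_divide_eq_right mult_ac)
    also have "Gamma (\<nu> + real k + 1) * rGamma (\<nu> + real k + 1) = 1" by fact
    finally show ?thesis
      by (simp add: divide_inverse power_mult_distrib[symmetric] mult_ac)
  qed
  have absval: "(LINT x:{0<..}|lborel. \<bar>?f k x\<bar>) = y powr (- \<nu> - 1) * ((1 / y) ^ k /\<^sub>R fact k)" for k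
  proof -
    have "(LINT x:{0<..}|lborel. \<bar>?f k x\<bar>) = \<bar>?c k\<bar> * (Gamma (\<nu> + real k + 1) * y powr (- (\<nu> + real k + 1)))"
      unfolding nn set_integral_mult_right G(2) ..
    also have "\<dots> = \<bar>?c k * (Gamma (\<nu> + real k + 1) * y powr (- (\<nu> + real k + 1)))\<bar>"
      using Gamma_real_pos[OF p[of k]] by (simp add: abs_mult)
    also have "\<dots> = y powr (- \<nu> - 1) * ((1 / y) ^ k /\<^sub>R fact k)"
      unfolding val using y by (simp add: abs_mult power_abs)
    finally show ?thesis .
  qed
  have sum: "(\<lambda>k. ?f k x) sums (clifford \<nu> x * x powr \<nu> * exp (- (x * y)))"
    and abs: "summable (\<lambda>k. \<bar>?f k x\<bar>)" if "x \<in> {0<..}" for x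
  proof -
    have "?f k x = (?c k * x ^ k) * (x powr \<nu> * exp (- (x * y)))" for k
      using that by (simp add: powr_add powr_realpow)
    moreover have "(\<lambda>k. (?c k * x ^ k) * (x powr \<nu> * exp (- (x * y)))) sums (clifford \<nu> x * (x powr \<nu> * exp (- (x * y))))"
      using clifford_sums[of \<nu> x] by (intro sums_mult2) simp
    moreover have "summable (\<lambda>k. \<bar>?c k * x ^ k\<bar> * \<bar>x powr \<nu> * exp (- (x * y))\<bar>)"
      using summable_norm_clifford[of \<nu> x] by (intro summable_mult2) simp
    ultimately show "(\<lambda>k. ?f k x) sums (clifford \<nu> x * x powr \<nu> * exp (- (x * y)))"
        "summable (\<lambda>k. \<bar>?f k x\<bar>)"
      by (simp_all only: abs_mult mult.assoc)
  qed
  have "summable (\<lambda>k. y powr (- \<nu> - 1) * ((1 / y) ^ k /\<^sub>R fact k))"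
    by (intro summable_mult sums_summable[OF exp_converges])
  note T = set_integral_sums[where f = ?f, OF set_integrable_mult_right[OF G(1)] eq_refl[OF absval] this abs sum]
  show "set_integrable lborel {0<..} (\<lambda>x. clifford \<nu> x * x powr \<nu> * exp (- (x * y)))"
    by (rule T(1))
  have "(\<lambda>k. y powr (- \<nu> - 1) * ((- (1 / y)) ^ k /\<^sub>R fact k)) sums (y powr (- \<nu> - 1) * exp (- (1 / y)))"
    by (intro sums_mult exp_converges)
  moreover have "(LINT x:{0<..}|lborel. ?f k x) = y powr (- \<nu> - 1) * ((- (1 / y)) ^ k /\<^sub>R fact k)" for k
    unfolding set_integral_mult_right G(2) val ..
  ultimately show "(LINT x:{0<..}|lborel. clifford \<nu> x * x powr \<nu> * exp (- (x * y))) = y powr (- \<nu> - 1) * exp (- (1 / y))"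
    using T(2) sums_unique2 by fastforce
qed

lemma set_integrable_clifford_positive:
  assumes "s < 0" "2 * s + \<nu> > - 1 / 2"
  shows "set_integrable lborel {0<..} (\<lambda>x. clifford \<nu> x * x powr (- s - 1))"
proof -
  have "compact (clifford \<nu> ` {0..1::real})"
    by (intro compact_continuous_image continuous_on_clifford continuous_on_id compact_Icc)
  then obtain B where B: "\<And>x. x \<in> {0..1} \<Longrightarrow> \<bar>clifford \<nu> (x::real)\<bar> \<le> B"
    using compact_imp_bounded bounded_iff by (metis imageI real_norm_def)
  have B0: "B \<ge> 0" using B[of 0] by (meson abs_ge_zero atLeastAtMost_iff order_refl order_trans zero_le_one)
  have 1: "set_integrable lborel {0<..1} (\<lambda>x. clifford \<nu> x * x powr (- s - 1))"
  proof (rule set_integrable_bound)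
    show "set_integrable lborel {0<..1} (\<lambda>x. B * x powr (- s - 1))"
      by (intro set_integrable_mult_right set_integral_powr_from_0) (use assms in auto)
    show "AE x in lborel. x \<in> {0<..1} \<longrightarrow> norm (clifford \<nu> x * x powr (- s - 1)) \<le> norm (B * x powr (- s - 1))"
      using B B0 by (intro AE_I2) (auto simp: abs_mult intro!: mult_right_mono)
  qed (simp add: set_borel_measurable_def)
  have 2: "set_integrable lborel {1..} (\<lambda>x. clifford \<nu> x * x powr (- s - 1))"
    by (rule set_integrable_clifford_tail) (use assms in auto)
  have "{0<..} = {0<..1} \<union> {1::real..}" by auto
  thus ?thesis using set_integrable_Un[OF 1 2] by simp
qed

text \<open>Writing \<open>x powr (-s-\<nu>-1)\<close> as a Gamma integral over \<open>y\<close> and exchanging the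
  integrations reduces the transform to Weber's integral and to one more Gamma integral. The hypotheses make the
  double integral absolutely convergent.\<close>

lemma mellin_transform_clifford:
  assumes s: "s < 0" and nu: "\<nu> > -1" and c: "2 * s + \<nu> > - 1 / 2"
  shows "(LINT x:{0<..}|lborel. clifford \<nu> x * x powr (- s - 1)) = Gamma (- s) * rGamma (\<nu> + 1 + s)"
proof -
  have p: "s + \<nu> + 1 > 0" using s c by linarith
  let ?I = "indicator {0<..} :: real \<Rightarrow> real"
  define f where "f x y = (?I x * (clifford \<nu> x * x powr \<nu>)) * (?I y * (y powr (s + \<nu>) * exp (- (x * y))))" for x y
  have iy: "integrable lborel (\<lambda>y. ?I y * (y powr (s + \<nu>) * exp (- (x * y))))"
    "(\<integral>y. ?I y * (y powr (s + \<nu>) * exp (- (x * y))) \<partial>lborel) = Gamma (s + \<nu> + 1) * x powr (- (s + \<nu> + 1))"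
    if "x > 0" for x
    using gamma_integral_scaled[OF p that]
    by (simp_all add: set_integrable_def set_lebesgue_integral_def mult.commute[of x])
  have G0: "Gamma (s + \<nu> + 1) > 0" using p by (rule Gamma_real_pos)
  have inner: "(\<integral>y. f x y \<partial>lborel) = Gamma (s + \<nu> + 1) * (?I x * (clifford \<nu> x * x powr (- s - 1)))" for x
  proof (cases "x > 0")
    case True
    have "x powr \<nu> * x powr (- (s + \<nu> + 1)) = x powr (- s - 1)"
      by (simp add: powr_add[symmetric])
    moreover have "(\<integral>y. f x y \<partial>lborel)
        = (clifford \<nu> x * x powr \<nu>) * (\<integral>y. ?I y * (y powr (s + \<nu>) * exp (- (x * y))) \<partial>lborel)"
      using True unfolding f_def by (subst integral_mult_right_zero) simp
    ultimately show ?thesis using True unfolding iy(2)[OF True]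
      by (simp only: mult_ac) simp
  qed (simp add: f_def)
  have innernorm: "(\<integral>y. norm (f x y) \<partial>lborel) = Gamma (s + \<nu> + 1) * \<bar>?I x * (clifford \<nu> x * x powr (- s - 1))\<bar>" for x
  proof (cases "x > 0")
    case True
    have "norm (f x y) = \<bar>clifford \<nu> x\<bar> * x powr \<nu> * (?I y * (y powr (s + \<nu>) * exp (- (x * y))))" for y
      using True by (simp add: f_def abs_mult)
    moreover have "x powr \<nu> * x powr (- (s + \<nu> + 1)) = x powr (- s - 1)"
      by (simp add: powr_add[symmetric])
    moreover have "(\<integral>y. norm (f x y) \<partial>lborel)
        = (\<bar>clifford \<nu> x\<bar> * x powr \<nu>) * (\<integral>y. ?I y * (y powr (s + \<nu>) * exp (- (x * y))) \<partial>lborel)"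
      unfolding calculation(1) by (rule integral_mult_right_zero)
    moreover have "(a * x powr \<nu>) * (b * x powr (- (s + \<nu> + 1))) = b * (a * (x powr \<nu> * x powr (- (s + \<nu> + 1))))" for a b
      by (simp only: mult_ac)
    ultimately have "(\<integral>y. norm (f x y) \<partial>lborel) = Gamma (s + \<nu> + 1) * (\<bar>clifford \<nu> x\<bar> * x powr (- s - 1))"
      unfolding iy(2)[OF True] by presburger
    thus ?thesis using True by (simp add: abs_mult)
  qed (simp add: f_def)
  have int: "integrable lborel (\<lambda>x. ?I x * (clifford \<nu> x * x powr (- s - 1)))"
    using set_integrable_clifford_positive[OF s c] by (simp add: set_integrable_def)
  have fint: "integrable (lborel \<Otimes>\<^sub>M lborel) (case_prod f)"
  proof (rule lborel_pair.Fubini_integrable)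
    show "case_prod f \<in> borel_measurable (lborel \<Otimes>\<^sub>M lborel)"
      unfolding f_def by measurable
    show "integrable lborel (\<lambda>x. \<integral>y. norm (case_prod f (x, y)) \<partial>lborel)"
      unfolding prod.case innernorm by (intro integrable_mult_right integrable_abs int)
    show "AE x in lborel. integrable lborel (\<lambda>y. case_prod f (x, y))"
    proof (intro AE_I2)
      fix x :: real
      show "integrable lborel (\<lambda>y. case_prod f (x, y))"
      proof (cases "x > 0")
        case True
        show ?thesis unfolding prod.case f_def by (intro integrable_mult_right iy True)
      qed (simp add: f_def)
    qed
  qed
  have outer: "(\<integral>x. f x y \<partial>lborel) = ?I y * (y powr (s - 1) * exp (- (1 / y)))" for y
  proof (cases "y > 0")
    case True
    have "(\<integral>x. f x y \<partial>lborel) = (\<integral>x. y powr (s + \<nu>) * (?I x * (clifford \<nu> x * x powr \<nu> * exp (- (x * y)))) \<partial>lborel)"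
      using True by (intro Bochner_Integration.integral_cong) (auto simp: f_def mult_ac)
    also have "\<dots> = y powr (s + \<nu>) * (y powr (- \<nu> - 1) * exp (- (1 / y)))"
      using weber_exponential_integral(2)[OF nu True] by (simp add: set_lebesgue_integral_def)
    also have "\<dots> = y powr (s - 1) * exp (- (1 / y))"
      by (simp add: mult.assoc[symmetric] powr_add[symmetric])
    finally show ?thesis using True by simp
  qed (simp add: f_def)
  have "Gamma (s + \<nu> + 1) * (LINT x:{0<..}|lborel. clifford \<nu> x * x powr (- s - 1)) = (\<integral>x. (\<integral>y. f x y \<partial>lborel) \<partial>lborel)"
    unfolding inner by (simp add: set_lebesgue_integral_def)
  also have "\<dots> = (\<integral>y. (\<integral>x. f x y \<partial>lborel) \<partial>lborel)"
    by (rule lborel_pair.Fubini_integral[OF fint, symmetric])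
  also have "\<dots> = (LINT y:{0<..}|lborel. y powr (- (- s) - 1) * exp (- (1 / y)))"
    unfolding outer by (simp add: set_lebesgue_integral_def)
  also have "\<dots> = Gamma (- s)" by (rule gamma_integral_inverse) (use s in simp)
  finally show ?thesis using G0 by (simp add: rGamma_inverse_Gamma field_simps add_ac)
qed

definition mellin_tail :: "real \<Rightarrow> real \<Rightarrow> real \<Rightarrow> real" where
  "mellin_tail \<nu> s X = (LINT x:{X..}|lborel. clifford \<nu> x * x powr (- s - 1))"

text \<open>The expansion of the tail in powers of the cut, with the Gamma quotient as the value of the complete
  Mellin transform. As a predicate it can be moved along the recurrences in \<open>\<nu>\<close> and
  \<open>s\<close>.\<close>

definition mellin_tail_expansion :: "real \<Rightarrow> real \<Rightarrow> real \<Rightarrow> bool" where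
  "mellin_tail_expansion X \<nu> s \<longleftrightarrow>
     (\<lambda>k. clifford_coeff \<nu> k * X powr (real k - s) / (real k - s))
        sums (Gamma (- s) * rGamma (\<nu> + 1 + s) - mellin_tail \<nu> s X)"

lemma clifford_sums_powr:
  "X > 0 \<Longrightarrow> (\<lambda>k. clifford_coeff \<nu> k * X powr (real k - s)) sums (clifford \<nu> X * X powr (- s))"
proof -
  assume X: "X > 0"
  have "(\<lambda>k. (of_real (clifford_coeff \<nu> k) * X ^ k) * X powr (- s)) sums (clifford \<nu> X * X powr (- s))"
    by (intro sums_mult2 clifford_sums)
  moreover have "X ^ k * X powr (- s) = X powr (real k - s)" for k
    using X by (simp add: powr_diff powr_minus divide_inverse powr_realpow)
  ultimately show ?thesis by (simp add: mult.assoc)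
qed

text \<open>In this range the full Mellin transform converges, and the series is the integral over \<open>(0,
  X]\<close>, computed term by term.\<close>

lemma mellin_tail_expansion_negative:
  assumes X: "X > 0" and s: "s < 0" and nu: "\<nu> > -1" and c: "2 * s + \<nu> > - 1 / 2"
  shows "mellin_tail_expansion X \<nu> s"
proof -
  let ?F = "\<lambda>x. clifford \<nu> x * x powr (- s - 1)"
  let ?m = "\<lambda>k x. x powr (real k - s - 1)"
  let ?f = "\<lambda>k x. clifford_coeff \<nu> k * ?m k x"
  have e: "real k - s - 1 > -1" for k using s by simp
  note P = set_integral_powr_from_0[OF e less_imp_le[OF X]]
  have val: "(LINT x:{0<..X}|lborel. ?f k x) = clifford_coeff \<nu> k * X powr (real k - s) / (real k - s)" for k
    unfolding set_integral_mult_right P(2) by simp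
  have le: "(LINT x:{0<..X}|lborel. \<bar>?f k x\<bar>) \<le> (X powr (- s) / (- s)) * norm (clifford_coeff \<nu> k * X ^ k)" for k
  proof -
    have "(LINT x:{0<..X}|lborel. \<bar>?f k x\<bar>) = \<bar>clifford_coeff \<nu> k\<bar> * (X powr (real k - s) / (real k - s))"
    proof -
      have "\<bar>?f k x\<bar> = \<bar>clifford_coeff \<nu> k\<bar> * ?m k x" for x by (simp add: abs_mult)
      thus ?thesis by (simp only: set_integral_mult_right P(2)) simp
    qed
    also have "X powr (real k - s) = X ^ k * X powr (- s)"
      using X by (simp add: powr_diff powr_minus divide_inverse powr_realpow)
    also have "\<bar>clifford_coeff \<nu> k\<bar> * (X ^ k * X powr (- s) / (real k - s))
        \<le> \<bar>clifford_coeff \<nu> k\<bar> * (X ^ k * X powr (- s) / (- s))"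
      using s X by (intro mult_left_mono frac_le) auto
    also have "\<dots> = (X powr (- s) / (- s)) * norm (clifford_coeff \<nu> k * X ^ k)"
      using X by (simp add: abs_mult)
    finally show ?thesis .
  qed
  have sum: "(\<lambda>k. ?f k x) sums ?F x" and abs: "summable (\<lambda>k. \<bar>?f k x\<bar>)" if "x \<in> {0<..X}" for x
  proof -
    have x: "x > 0" using that by simp
    show "(\<lambda>k. ?f k x) sums ?F x"
      using clifford_sums_powr[OF x, of \<nu> "s + 1"] unfolding diff_diff_eq[symmetric] minus_add_distrib add_uminus_conv_diff .
    have "x powr (real k - s - 1) = x ^ k * x powr (- s - 1)" for k
      using x by (simp add: powr_diff powr_minus divide_inverse powr_realpow)
    hence "\<bar>?f k x\<bar> = norm (clifford_coeff \<nu> k * x ^ k) * x powr (- s - 1)" for k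
      by (simp add: abs_mult mult.assoc)
    thus "summable (\<lambda>k. \<bar>?f k x\<bar>)"
      using summable_norm_clifford[of \<nu> x] by (simp add: summable_mult2)
  qed
  have "summable (\<lambda>k. (X powr (- s) / (- s)) * norm (clifford_coeff \<nu> k * X ^ k))"
    using summable_norm_clifford[of \<nu> X] by (intro summable_mult) simp
  note T = set_integral_sums[where f = ?f, OF set_integrable_mult_right[OF P(1)] le this abs sum]
  have "(LINT x:{0<..X}|lborel. ?F x) = Gamma (- s) * rGamma (\<nu> + 1 + s) - mellin_tail \<nu> s X"
  proof -
    note full = set_integrable_clifford_positive[OF s c]
    have "set_integrable lborel {X<..} ?F" by (rule set_integrable_subset[OF full]) (use X in auto)
    hence "(LINT x:{0<..X} \<union> {X<..}|lborel. ?F x) = (LINT x:{0<..X}|lborel. ?F x) + (LINT x:{X<..}|lborel. ?F x)"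
      by (intro set_integral_Un T(1)) auto
    also have "{0<..X} \<union> {X<..} = {0<..}" using X by auto
    also have "(LINT x:{X<..}|lborel. ?F x) = mellin_tail \<nu> s X"
      unfolding mellin_tail_def set_lebesgue_integral_def
      by (intro integral_cong_AE) (auto intro: AE_mp[OF AE_lborel_singleton[of X]] simp: indicator_def)
    finally show ?thesis using mellin_transform_clifford[OF s nu c] by simp
  qed
  with T(2) show ?thesis unfolding mellin_tail_expansion_def val by simp
qed

text \<open>Integration of the derivative of \<open>x powr (-s) C\<close> for order \<open>\<nu> + 1\<close>, combined
  with the three-term recurrence.\<close>

lemma mellin_tail_recurrence_order:
  assumes X: "X > 0" and c: "2 * s + \<nu> > - 1 / 2"
  shows "mellin_tail \<nu> s X = (s + \<nu> + 1) * mellin_tail (\<nu> + 1) s X - clifford (\<nu> + 1) X * X powr (- s)"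
proof -
  let ?F = "\<lambda>x. x powr (- s) * clifford (\<nu> + 1) x"
  let ?f = "\<lambda>x. clifford \<nu> x * x powr (- s - 1) - (s + \<nu> + 1) * (clifford (\<nu> + 1) x * x powr (- s - 1))"
  have i1: "set_integrable lborel {X..} (\<lambda>x. clifford \<nu> x * x powr (- s - 1))"
    by (rule set_integrable_clifford_tail[OF X c])
  have i2: "set_integrable lborel {X..} (\<lambda>x. (s + \<nu> + 1) * (clifford (\<nu> + 1) x * x powr (- s - 1)))"
    by (intro set_integrable_mult_right set_integrable_clifford_tail[OF X]) (use c in simp)
  have "(LINT x:{X..}|lborel. ?f x) = - ?F X"
  proof (rule set_integral_tail_FTC)
    fix x assume "x \<ge> X"
    hence x: "x > 0" using X by simp
    have "(?F has_real_derivative (- s * x powr (- s - 1)) * clifford (\<nu> + 1) x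
            + - clifford (\<nu> + 1 + 1) x * x powr (- s)) (at x)"
      by (rule DERIV_mult has_real_derivative_powr[OF x] clifford_deriv)+
    moreover have "clifford (\<nu> + 1 + 1) x = ((\<nu> + 1) * clifford (\<nu> + 1) x - clifford \<nu> x) / x"
      using clifford_rec[of \<nu> x] x by (simp add: add.assoc field_simps)
    moreover have "x powr (- s) = x * x powr (- s - 1)"
      using x powr_mult_base[of x "- s - 1"] by simp
    moreover have "(- s * P) * G1 + - (((\<nu> + 1) * G1 - G0) / x) * (x * P) = G0 * P - (s + \<nu> + 1) * (G1 * P)" for P G0 G1
      using x by (simp add: field_simps)
    ultimately show "(?F has_real_derivative ?f x) (at x)" by (simp only:)
  next
    show "set_integrable lborel {X..} ?f" by (rule set_integral_diff(1)[OF i1 i2])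
    show "(?F \<longlongrightarrow> 0) at_top" by (rule clifford_tendsto_0) (use c in simp)
  qed
  moreover have "(LINT x:{X..}|lborel. ?f x) = mellin_tail \<nu> s X - (s + \<nu> + 1) * mellin_tail (\<nu> + 1) s X"
    unfolding mellin_tail_def set_integral_diff(2)[OF i1 i2] set_integral_mult_right ..
  ultimately show ?thesis by (simp add: mult.commute)
qed

text \<open>Integration by parts of the power against \<open>C\<close>, whose derivative is minus the function of the
  next order.\<close>

lemma mellin_tail_recurrence_both:
  assumes X: "X > 0" and c: "2 * s + \<nu> > 1 / 2"
  shows "s * mellin_tail \<nu> s X = clifford \<nu> X * X powr (- s) - mellin_tail (\<nu> + 1) (s - 1) X"
proof -
  let ?F = "\<lambda>x. x powr (- s) * clifford \<nu> x"
  let ?f = "\<lambda>x. (- s) * (clifford \<nu> x * x powr (- s - 1)) - clifford (\<nu> + 1) x * x powr (- (s - 1) - 1)"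
  have i1: "set_integrable lborel {X..} (\<lambda>x. (- s) * (clifford \<nu> x * x powr (- s - 1)))"
    by (intro set_integrable_mult_right set_integrable_clifford_tail[OF X]) (use c in simp)
  have i2: "set_integrable lborel {X..} (\<lambda>x. clifford (\<nu> + 1) x * x powr (- (s - 1) - 1))"
    by (intro set_integrable_clifford_tail[OF X]) (use c in simp)
  have "(LINT x:{X..}|lborel. ?f x) = - ?F X"
  proof (rule set_integral_tail_FTC)
    fix x assume "x \<ge> X"
    hence x: "x > 0" using X by simp
    have "(?F has_real_derivative (- s * x powr (- s - 1)) * clifford \<nu> x
            + - clifford (\<nu> + 1) x * x powr (- s)) (at x)"
      by (rule DERIV_mult has_real_derivative_powr[OF x] clifford_deriv)+
    thus "(?F has_real_derivative ?f x) (at x)" by (simp add: mult_ac)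
  next
    show "set_integrable lborel {X..} ?f" by (rule set_integral_diff(1)[OF i1 i2])
    show "(?F \<longlongrightarrow> 0) at_top" by (rule clifford_tendsto_0) (use c in simp)
  qed
  moreover have "(LINT x:{X..}|lborel. ?f x) = (- s) * mellin_tail \<nu> s X - mellin_tail (\<nu> + 1) (s - 1) X"
    unfolding mellin_tail_def set_integral_diff(2)[OF i1 i2] set_integral_mult_right ..
  ultimately show ?thesis by (simp add: mult.commute)
qed

text \<open>The series and the Gamma quotient satisfy the same recurrence as the tail, which lets the order descend at
  fixed \<open>s\<close>.\<close>

lemma mellin_tail_expansion_lower:
  assumes X: "X > 0" and c: "2 * s + \<nu> > - 1 / 2" and s: "\<And>n. s \<noteq> real n"
    and E: "mellin_tail_expansion X (\<nu> + 1) s"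
  shows "mellin_tail_expansion X \<nu> s"
proof -
  let ?c = "clifford_coeff (\<nu> + 1)"
  have "(\<lambda>k. ?c k * X powr (real k - s) + (s + \<nu> + 1) * (?c k * X powr (real k - s) / (real k - s)))
     sums (clifford (\<nu> + 1) X * X powr (- s)
           + (s + \<nu> + 1) * (Gamma (- s) * rGamma (\<nu> + 1 + 1 + s) - mellin_tail (\<nu> + 1) s X))"
    using E unfolding mellin_tail_expansion_def
    by (intro sums_add sums_mult clifford_sums_powr X)
  moreover have "?c k * X powr (real k - s) + (s + \<nu> + 1) * (?c k * X powr (real k - s) / (real k - s))
      = clifford_coeff \<nu> k * X powr (real k - s) / (real k - s)" for k
  proof -
    have "real k - s \<noteq> 0" using s[of k] by simp
    thus ?thesis unfolding clifford_coeff_shift[of \<nu>] by (simp add: field_simps)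
  qed
  moreover have "rGamma (\<nu> + 1 + s) = (s + \<nu> + 1) * rGamma (\<nu> + 1 + 1 + s)"
    using rGamma_plus1[of "\<nu> + 1 + s"] by (simp add: add_ac)
  ultimately show ?thesis
    unfolding mellin_tail_expansion_def mellin_tail_recurrence_order[OF X c]
    by (simp add: algebra_simps)
qed

text \<open>As before, but \<open>s\<close> and the order change together.\<close>

lemma mellin_tail_expansion_raise:
  assumes X: "X > 0" and c: "2 * s + \<nu> > 1 / 2" and s: "\<And>n. s \<noteq> real n"
    and E: "mellin_tail_expansion X (\<nu> + 1) (s - 1)"
  shows "mellin_tail_expansion X \<nu> s"
proof -
  have s0: "s \<noteq> 0" using s[of 0] by simp
  let ?c = "clifford_coeff \<nu>"
  let ?g = "\<lambda>k. real k * ?c k * X powr (real k - s) / (real k - s)"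
  have "(\<lambda>k. - (clifford_coeff (\<nu> + 1) k * X powr (real k - (s - 1)) / (real k - (s - 1))))
      sums (- (Gamma (- (s - 1)) * rGamma (\<nu> + 1 + 1 + (s - 1)) - mellin_tail (\<nu> + 1) (s - 1) X))"
    using E unfolding mellin_tail_expansion_def by (rule sums_minus)
  also have "(\<lambda>k. - (clifford_coeff (\<nu> + 1) k * X powr (real k - (s - 1)) / (real k - (s - 1)))) = (\<lambda>k. ?g (Suc k))"
    unfolding clifford_coeff_Suc[of _ \<nu>] by (simp add: fun_eq_iff algebra_simps)
  finally have "?g sums (- (Gamma (- (s - 1)) * rGamma (\<nu> + 1 + 1 + (s - 1)) - mellin_tail (\<nu> + 1) (s - 1) X))"
    by (subst (asm) sums_Suc_iff) simp
  from sums_mult[OF sums_diff[OF this clifford_sums_powr[OF X, of \<nu> s]], of "1 / s"]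
  have "(\<lambda>k. 1 / s * (?g k - ?c k * X powr (real k - s))) sums
     (1 / s * (- (Gamma (- (s - 1)) * rGamma (\<nu> + 1 + 1 + (s - 1)) - mellin_tail (\<nu> + 1) (s - 1) X)
        - clifford \<nu> X * X powr (- s)))" .
  also have "(\<lambda>k. 1 / s * (?g k - ?c k * X powr (real k - s))) = (\<lambda>k. ?c k * X powr (real k - s) / (real k - s))"
  proof
    fix k
    have "real k - s \<noteq> 0" using s[of k] by simp
    thus "1 / s * (?g k - ?c k * X powr (real k - s)) = ?c k * X powr (real k - s) / (real k - s)"
      using s0 by (simp add: field_simps)
  qed
  also have "Gamma (- (s - 1)) = - s * Gamma (- s)"
  proof -
    have "- s \<notin> \<int>\<^sub>\<le>\<^sub>0" using s by (auto elim!: nonpos_Ints_cases')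
    from Gamma_plus1[OF this] show ?thesis by (simp add: add.commute)
  qed
  also have "\<nu> + 1 + 1 + (s - 1) = \<nu> + 1 + s" by simp
  also have "1 / s * (- (- s * Gamma (- s) * rGamma (\<nu> + 1 + s) - mellin_tail (\<nu> + 1) (s - 1) X) - clifford \<nu> X * X powr (- s))
      = Gamma (- s) * rGamma (\<nu> + 1 + s) - mellin_tail \<nu> s X"
    using mellin_tail_recurrence_both[OF X c] s0 by (simp add: field_simps)
  finally show ?thesis unfolding mellin_tail_expansion_def .
qed

text \<open>Both sides satisfy the same recurrences, so the case \<open>s < 0\<close> of large order suffices: a
  negative \<open>s\<close> is reached by lowering \<open>s\<close> and raising the order together, and a large order
  by raising it alone. The exclusion of \<open>s \<in> \<nat>\<close> avoids the poles.\<close>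

theorem mellin_tail_expansion:
  assumes X: "X > 0" and c: "2 * s + \<nu> > - 1 / 2" and s: "\<And>n. s \<noteq> real n"
  shows "mellin_tail_expansion X \<nu> s"
proof -
  have lower: "mellin_tail_expansion X \<nu>' s'"
    if "2 * s' + \<nu>' > - 1 / 2" and s': "\<And>n. s' \<noteq> real n"
      and "mellin_tail_expansion X (\<nu>' + real N) s'" for N \<nu>' s'
    using that(1,3)
  proof (induction N arbitrary: \<nu>')
    case 0
    thus ?case by simp
  next
    case (Suc N)
    have "mellin_tail_expansion X (\<nu>' + 1) s'"
    proof (rule Suc.IH)
      show "2 * s' + (\<nu>' + 1) > - 1 / 2" using Suc.prems(1) by simp
      show "mellin_tail_expansion X (\<nu>' + 1 + real N) s'"
        using Suc.prems(2) by (simp add: add_ac)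
    qed
    thus ?case by (rule mellin_tail_expansion_lower[OF X Suc.prems(1) s'])
  qed
  have large: "mellin_tail_expansion X \<nu>' s'"
    if "s' < real m" "2 * s' + \<nu>' - real m > - 1 / 2" "\<And>n. s' \<noteq> real n" for m \<nu>' s'
    using that
  proof (induction m arbitrary: \<nu>' s')
    case 0
    have n: "\<bar>\<nu>'\<bar> \<le> real (nat \<lceil>\<bar>\<nu>'\<bar>\<rceil>)" by linarith
    have E: "mellin_tail_expansion X (\<nu>' + real (Suc (nat \<lceil>\<bar>\<nu>'\<bar>\<rceil>))) s'"
    proof (rule mellin_tail_expansion_negative[OF X])
      show "s' < 0" using 0(1) by simp
      show "\<nu>' + real (Suc (nat \<lceil>\<bar>\<nu>'\<bar>\<rceil>)) > -1" using n by linarith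
      show "2 * s' + (\<nu>' + real (Suc (nat \<lceil>\<bar>\<nu>'\<bar>\<rceil>))) > - 1 / 2" using n 0(2) by linarith
    qed
    have "2 * s' + \<nu>' > - 1 / 2" using 0(2) by simp
    thus ?case by (rule lower[OF _ 0(3) E])
  next
    case (Suc m)
    show ?case
    proof (cases "s' < real m")
      case True
      show ?thesis by (rule Suc.IH[OF True _ Suc.prems(3)]) (use Suc.prems(2) in simp)
    next
      case False
      have ns: "s' - 1 \<noteq> real n" for n using Suc.prems(3)[of "Suc n"] by auto
      have "mellin_tail_expansion X (\<nu>' + 1) (s' - 1)"
        by (rule Suc.IH[OF _ _ ns]) (use Suc.prems(1,2) in simp_all)
      moreover have "2 * s' + \<nu>' > 1 / 2" using Suc.prems(2) by simp
      ultimately show ?thesis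
        by (intro mellin_tail_expansion_raise[OF X _ Suc.prems(3)]) simp_all
    qed
  qed
  obtain m :: nat where m: "s < real m" using reals_Archimedean2 by blast
  have "mellin_tail_expansion X (\<nu> + real m) s"
    by (rule large[OF m _ s]) (use c in simp)
  thus ?thesis by (rule lower[OF c s])
qed

section \<open>The integral of the regular kernel for non-integral exponents\<close>

text \<open>Fubini's theorem for a double series dominated by a product.\<close>

lemma sums_swap:
  fixes F :: "nat \<Rightarrow> nat \<Rightarrow> real"
  assumes le: "\<And>n k. \<bar>F n k\<bar> \<le> A n * B k" and A: "summable A" and B: "summable B"
    and A0: "\<And>n. A n \<ge> 0" and B0: "\<And>k. B k \<ge> 0"
    and r: "\<And>n. (\<lambda>k. F n k) sums r n" and c: "\<And>k. (\<lambda>n. F n k) sums c k"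
  shows "\<exists>S. r sums S \<and> c sums S"
proof -
  let ?M = "count_space (UNIV :: nat set)"
  have sB: "summable (\<lambda>k. \<bar>F n k\<bar>)" for n
    by (rule summable_comparison_test'[of "\<lambda>k. A n * B k" 0]) (use le B in \<open>auto intro: summable_mult\<close>)
  have sA: "summable (\<lambda>n. \<bar>F n k\<bar>)" for k
    by (rule summable_comparison_test'[of "\<lambda>n. A n * B k" 0]) (use le A in \<open>auto intro: summable_mult2\<close>)
  have 1: "integrable ?M (F n)" for n
    using sB[of n] by (simp add: integrable_count_space_nat_iff)
  have 2: "AE k in ?M. summable (\<lambda>n. norm (F n k))"
    using sA by (intro AE_I2) simp
  have iN: "(\<integral>k. norm (F n k) \<partial>?M) = (\<Sum>k. \<bar>F n k\<bar>)" for n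
    using sB[of n] by (subst integral_count_space_nat) (simp_all add: integrable_count_space_nat_iff)
  have 3: "summable (\<lambda>n. \<integral>k. norm (F n k) \<partial>?M)"
  proof (rule summable_comparison_test'[of "\<lambda>n. A n * (\<Sum>k. B k)" 0])
    show "summable (\<lambda>n. A n * (\<Sum>k. B k))" by (intro summable_mult2 A)
    fix n
    have "(\<Sum>k. \<bar>F n k\<bar>) \<le> (\<Sum>k. A n * B k)"
      by (intro suminf_le le sB summable_mult B)
    also have "\<dots> = A n * (\<Sum>k. B k)" by (rule suminf_mult[OF B])
    finally show "norm (\<integral>k. norm (F n k) \<partial>?M) \<le> A n * (\<Sum>k. B k)"
      unfolding iN using suminf_nonneg[OF sB[of n]] by simp
  qed
  have rn: "(\<integral>k. F n k \<partial>?M) = r n" for n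
    using 1[of n] r[of n] by (subst integral_count_space_nat) (simp_all add: sums_iff)
  have ck: "(\<Sum>n. F n k) = c k" for k using c[of k] by (simp add: sums_iff)
  have "r sums (\<integral>k. c k \<partial>?M)"
    using sums_integral[OF 1 2 3] unfolding rn ck .
  moreover have "c sums (\<integral>k. c k \<partial>?M)"
    using integrable_suminf[OF 1 2 3] unfolding ck by (rule sums_integral_count_space_nat)
  ultimately show ?thesis by blast
qed

text \<open>The binomial series converges absolutely inside the unit disc. The point 1/2 occurs because the integral
  is cut at \<open>y = 2c\<close>, where \<open>c/y = 1/2\<close>.\<close>

lemma summable_gbinomial_half: "summable (\<lambda>n. \<bar>(a gchoose n) * (1 / 2) ^ n\<bar>)" for a :: real
proof -
  have "summable (\<lambda>n. norm ((a gchoose n) * (1 / 2 :: real) ^ n))"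
  proof (rule abs_summable_in_conv_radius)
    have "conv_radius (\<lambda>n. a gchoose n) \<ge> 1"
      by (cases "a \<in> \<nat>") (simp_all add: conv_radius_gchoose)
    moreover have "ereal (norm (1/2 :: real)) < 1" by simp
    ultimately show "ereal (norm (1/2 :: real)) < conv_radius (\<lambda>n. a gchoose n)"
      by (rule less_le_trans[rotated])
  qed
  thus ?thesis by simp
qed

text \<open>The integrand of the constant term after the singularity at 0 has been removed by subtracting
  \<open>C(0)\<close>.\<close>

definition regular_kernel :: "real \<Rightarrow> real \<Rightarrow> real \<Rightarrow> real \<Rightarrow> real" where
  "regular_kernel c \<nu> \<mu> y = (clifford \<nu> y - rGamma (1 + \<nu>)) / y * (1 + y / c) powr (- \<mu>)"

lemma clifford_difference_quotient_sums:
  fixes y :: real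
  assumes "y \<noteq> 0"
  shows "(\<lambda>k. clifford_coeff \<nu> (Suc k) * y ^ k) sums ((clifford \<nu> y - rGamma (1 + \<nu>)) / y)"
proof -
  have "(\<lambda>k. clifford_coeff \<nu> (Suc k) * y ^ Suc k) sums (clifford \<nu> y - rGamma (1 + \<nu>))"
    using clifford_sums[of \<nu> y] by (subst sums_Suc_iff) (simp add: clifford_coeff_0)
  from sums_divide[OF this, of y] show ?thesis using assms by simp
qed

text \<open>On a bounded interval the power series of the Bessel--Clifford function is integrated term by
  term.\<close>

lemma regular_kernel_near:
  assumes c: "c > 0" and mu: "\<mu> \<ge> 0" and X: "X > 0"
  shows "set_integrable lborel {0<..X} (regular_kernel c \<nu> \<mu>)"
    "(\<lambda>k. clifford_coeff \<nu> (Suc k) * integral {0..X} (\<lambda>y. y ^ k * (1 + y / c) powr (- \<mu>)))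
       sums (LINT y:{0<..X}|lborel. regular_kernel c \<nu> \<mu> y)"
proof -
  let ?m = "\<lambda>k y. y ^ k * (1 + y / c) powr (- \<mu>)"
  let ?f = "\<lambda>k y. clifford_coeff \<nu> (Suc k) * ?m k y"
  have cont: "continuous_on {0..X} (?m k)" for k
    using c by (intro continuous_intros) (auto simp: add_nonneg_eq_0_iff)
  have mint: "set_integrable lborel {0<..X} (?m k)" for k
    by (rule set_integrable_subset[OF borel_integrable_atLeastAtMost'[OF cont]]) auto
  have mval: "(LINT y:{0<..X}|lborel. ?m k y) = integral {0..X} (?m k)" for k
  proof -
    have "(LINT y:{0<..X}|lborel. ?m k y) = integral {0<..X} (?m k)"
      by (rule set_borel_integral_eq_integral[OF mint])
    also have "\<dots> = integral {0..X} (?m k)"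
      by (intro integral_subset_negligible) (auto intro: negligible_subset[of "{0}"])
    finally show ?thesis .
  qed
  have le1: "?m k y \<le> X ^ k" if "y \<in> {0<..X}" for k y
  proof -
    have "(1 + y / c) powr (- \<mu>) \<le> 1 powr (- \<mu>)"
      using that c mu by (intro powr_mono2') auto
    hence "?m k y \<le> X ^ k * 1"
      using that by (intro mult_mono power_mono) auto
    thus ?thesis by simp
  qed
  have le: "(LINT y:{0<..X}|lborel. \<bar>?f k y\<bar>) \<le> norm (clifford_coeff \<nu> (Suc k) * X ^ Suc k)" for k
  proof -
    have ci: "set_integrable lborel {0<..X} (\<lambda>y::real. X ^ k)"
      by (rule set_integrable_subset[OF borel_integrable_atLeastAtMost'[of 0 X]]) auto
    have "(LINT y:{0<..X}|lborel. \<bar>?f k y\<bar>) \<le> (LINT y:{0<..X}|lborel. \<bar>clifford_coeff \<nu> (Suc k)\<bar> * X ^ k)"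
    proof (rule set_integral_mono)
      show "set_integrable lborel {0<..X} (\<lambda>y. \<bar>?f k y\<bar>)"
        by (intro set_integrable_abs set_integrable_mult_right mint)
      show "set_integrable lborel {0<..X} (\<lambda>y. \<bar>clifford_coeff \<nu> (Suc k)\<bar> * X ^ k)"
        by (intro set_integrable_mult_right ci)
      show "\<bar>?f k y\<bar> \<le> \<bar>clifford_coeff \<nu> (Suc k)\<bar> * X ^ k" if "y \<in> {0<..X}" for y
        using le1[OF that, of k] that by (simp add: abs_mult mult_left_mono)
    qed
    also have "\<dots> = norm (clifford_coeff \<nu> (Suc k) * X ^ Suc k)"
      using X by (simp add: set_lebesgue_integral_def abs_mult)
    finally show ?thesis .
  qed
  have sB: "summable (\<lambda>k. norm (clifford_coeff \<nu> (Suc k) * X ^ Suc k))"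
    using summable_norm_clifford[of \<nu> X] by (subst summable_Suc_iff) simp
  have sum: "(\<lambda>k. ?f k y) sums regular_kernel c \<nu> \<mu> y" if "y \<in> {0<..X}" for y
  proof -
    have "(\<lambda>k. (clifford_coeff \<nu> (Suc k) * y ^ k) * (1 + y / c) powr (- \<mu>)) sums
        ((clifford \<nu> y - rGamma (1 + \<nu>)) / y * (1 + y / c) powr (- \<mu>))"
      by (intro sums_mult2 clifford_difference_quotient_sums) (use that in auto)
    thus ?thesis by (simp add: regular_kernel_def mult.assoc)
  qed
  have abs: "summable (\<lambda>k. \<bar>?f k y\<bar>)" if "y \<in> {0<..X}" for y
  proof (rule summable_comparison_test'[of "\<lambda>k. norm (clifford_coeff \<nu> (Suc k) * X ^ Suc k) / X" 0])
    show "summable (\<lambda>k. norm (clifford_coeff \<nu> (Suc k) * X ^ Suc k) / X)"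
      by (rule summable_divide[OF sB])
    fix k
    have "\<bar>?f k y\<bar> \<le> \<bar>clifford_coeff \<nu> (Suc k)\<bar> * X ^ k"
      using le1[OF that, of k] that by (simp add: abs_mult mult_left_mono)
    thus "norm \<bar>?f k y\<bar> \<le> norm (clifford_coeff \<nu> (Suc k) * X ^ Suc k) / X"
      using X by (simp add: abs_mult)
  qed
  note T = set_integral_sums[where f = ?f, OF set_integrable_mult_right[OF mint] le sB abs sum]
  show "set_integrable lborel {0<..X} (regular_kernel c \<nu> \<mu>)" by (rule T(1))
  show "(\<lambda>k. clifford_coeff \<nu> (Suc k) * integral {0..X} (?m k))
       sums (LINT y:{0<..X}|lborel. regular_kernel c \<nu> \<mu> y)"
    using T(2) unfolding set_integral_mult_right mval .
qed

text \<open>Beyond \<open>2c\<close> the power is expanded in \<open>c/y \<le> 1/2\<close>; each term is a Mellin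
  tail, corrected for the subtracted constant.\<close>

lemma regular_kernel_far:
  assumes c: "c > 0" and mu: "\<mu> > 0" and cond: "2 * \<mu> + \<nu> > - 1 / 2"
  defines "V \<equiv> \<lambda>s. mellin_tail \<nu> s (2 * c) - rGamma (1 + \<nu>) * (2 * c) powr (- s) / s"
  shows "set_integrable lborel {2 * c..} (regular_kernel c \<nu> \<mu>)"
    "(\<lambda>n. (- \<mu> gchoose n) * c powr (\<mu> + real n) * V (\<mu> + real n))
       sums (LINT y:{2 * c..}|lborel. regular_kernel c \<nu> \<mu> y)"
proof -
  have X: "2 * c > 0" using c by simp
  let ?a = "rGamma (1 + \<nu>)"
  let ?D = "\<lambda>s y. (clifford \<nu> y - ?a) * y powr (- s - 1)"
  let ?f = "\<lambda>n y. ((- \<mu> gchoose n) * c powr (\<mu> + real n)) * ?D (\<mu> + real n) y"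
  have D: "set_integrable lborel {2 * c..} (?D s)" "(LINT y:{2 * c..}|lborel. ?D s y) = V s"
    if s: "s \<ge> \<mu>" for s
  proof -
    have i1: "set_integrable lborel {2 * c..} (\<lambda>y. clifford \<nu> y * y powr (- s - 1))"
      by (rule set_integrable_clifford_tail[OF X]) (use s cond in linarith)
    have p: "((\<lambda>y. y powr (- s - 1)) has_integral - ((2 * c) powr (- s - 1 + 1)) / (- s - 1 + 1)) {2 * c..}"
      by (rule has_integral_powr_to_inf) (use X s mu in auto)
    note P = lborel_of_nonneg_has_integral[OF _ _ p]
    have i2: "set_integrable lborel {2 * c..} (\<lambda>y. ?a * y powr (- s - 1))"
      by (intro set_integrable_mult_right P(1)) auto
    have eq: "?D s = (\<lambda>y. clifford \<nu> y * y powr (- s - 1) - ?a * y powr (- s - 1))"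
      by (simp add: algebra_simps)
    show "set_integrable lborel {2 * c..} (?D s)" unfolding eq by (rule set_integral_diff(1)[OF i1 i2])
    have "(LINT y:{2 * c..}|lborel. y powr (- s - 1)) = (2 * c) powr (- s) / s"
      by (subst P(2)) auto
    thus "(LINT y:{2 * c..}|lborel. ?D s y) = V s"
      unfolding eq set_integral_diff(2)[OF i1 i2] set_integral_mult_right V_def mellin_tail_def by simp
  qed
  define Q where "Q = (LINT y:{2 * c..}|lborel. \<bar>?D \<mu> y\<bar>)"
  have dom: "\<bar>?f n y\<bar> \<le> \<bar>(- \<mu> gchoose n) * (1 / 2) ^ n\<bar> * c powr \<mu> * \<bar>?D \<mu> y\<bar>" if "y \<in> {2 * c..}" for n y
  proof -
    have y: "y > 0" "y \<ge> 2 * c" using that X by auto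
    have "c powr (\<mu> + real n) * y powr (- (\<mu> + real n) - 1) = (c / y) ^ n * (c powr \<mu> * y powr (- \<mu> - 1))"
      using y c by (simp add: powr_add powr_diff powr_minus powr_realpow field_simps)
    also have "\<dots> \<le> (1 / 2) ^ n * (c powr \<mu> * y powr (- \<mu> - 1))"
      using y c by (intro mult_right_mono power_mono) (auto simp: field_simps)
    finally have le: "c powr (\<mu> + real n) * y powr (- (\<mu> + real n) - 1) \<le> (1 / 2) ^ n * (c powr \<mu> * y powr (- \<mu> - 1))" .
    have "\<bar>?f n y\<bar> = \<bar>- \<mu> gchoose n\<bar> * \<bar>clifford \<nu> y - ?a\<bar> * (c powr (\<mu> + real n) * y powr (- (\<mu> + real n) - 1))"
      by (simp add: abs_mult)
    also have "\<dots> \<le> \<bar>- \<mu> gchoose n\<bar> * \<bar>clifford \<nu> y - ?a\<bar> * ((1 / 2) ^ n * (c powr \<mu> * y powr (- \<mu> - 1)))"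
      by (intro mult_left_mono le) auto
    also have "\<dots> = \<bar>(- \<mu> gchoose n) * (1 / 2) ^ n\<bar> * c powr \<mu> * \<bar>?D \<mu> y\<bar>"
      by (simp add: abs_mult)
    finally show ?thesis .
  qed
  have fint: "set_integrable lborel {2 * c..} (?f n)" for n
    by (intro set_integrable_mult_right D(1)) simp
  have le: "(LINT y:{2 * c..}|lborel. \<bar>?f n y\<bar>) \<le> \<bar>(- \<mu> gchoose n) * (1 / 2) ^ n\<bar> * (c powr \<mu> * Q)" for n
  proof -
    have "(LINT y:{2 * c..}|lborel. \<bar>?f n y\<bar>)
        \<le> (LINT y:{2 * c..}|lborel. \<bar>(- \<mu> gchoose n) * (1 / 2) ^ n\<bar> * c powr \<mu> * \<bar>?D \<mu> y\<bar>)"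
      by (intro set_integral_mono set_integrable_abs fint set_integrable_mult_right D(1) dom) auto
    also have "\<dots> = \<bar>(- \<mu> gchoose n) * (1 / 2) ^ n\<bar> * c powr \<mu> * Q"
      unfolding set_integral_mult_right Q_def ..
    finally show ?thesis by (simp add: mult.assoc)
  qed
  have sB: "summable (\<lambda>n. \<bar>(- \<mu> gchoose n) * (1 / 2) ^ n\<bar> * (c powr \<mu> * Q))"
    by (intro summable_mult2 summable_gbinomial_half)
  have abs: "summable (\<lambda>n. \<bar>?f n y\<bar>)" if "y \<in> {2 * c..}" for y
    by (rule summable_comparison_test'[of "\<lambda>n. \<bar>(- \<mu> gchoose n) * (1 / 2) ^ n\<bar> * (c powr \<mu> * \<bar>?D \<mu> y\<bar>)" 0],
        intro summable_mult2 summable_gbinomial_half) (use dom[OF that] in \<open>simp add: mult.assoc\<close>)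
  have sum: "(\<lambda>n. ?f n y) sums regular_kernel c \<nu> \<mu> y" if "y \<in> {2 * c..}" for y
  proof -
    have y: "y > 0" "y \<ge> 2 * c" using that X by auto
    have "\<bar>c / y\<bar> < 1" using y c by (simp add: field_simps)
    from gen_binomial_real[OF this, of "- \<mu>"]
    have "(\<lambda>n. (- \<mu> gchoose n) * (c / y) ^ n) sums (1 + c / y) powr (- \<mu>)" .
    hence S: "(\<lambda>n. ((- \<mu> gchoose n) * (c / y) ^ n) * ((c powr \<mu> * y powr (- \<mu> - 1)) * (clifford \<nu> y - ?a))) sums
       ((1 + c / y) powr (- \<mu>) * ((c powr \<mu> * y powr (- \<mu> - 1)) * (clifford \<nu> y - ?a)))"
      by (rule sums_mult2)
    have e1: "((- \<mu> gchoose n) * (c / y) ^ n) * ((c powr \<mu> * y powr (- \<mu> - 1)) * (clifford \<nu> y - ?a)) = ?f n y" for n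
      using y c by (simp add: powr_add powr_diff powr_minus powr_realpow field_simps)
    have e2: "(1 + c / y) powr (- \<mu>) * (c powr \<mu> * y powr (- \<mu> - 1)) = (1 + y / c) powr (- \<mu>) / y"
    proof -
      have "1 + c / y = (1 + y / c) * (c / y)" using y c by (simp add: field_simps)
      hence "(1 + c / y) powr (- \<mu>) = (1 + y / c) powr (- \<mu>) * (c / y) powr (- \<mu>)"
        using powr_mult[of "1 + y / c" "c / y" "- \<mu>"] y c by simp
      moreover have "(c / y) powr (- \<mu>) * (c powr \<mu> * y powr (- \<mu> - 1)) = 1 / y"
        using y c by (simp add: powr_divide powr_diff powr_minus field_simps)
      ultimately show ?thesis by (simp add: mult.assoc)
    qed
    have e3: "(1 + c / y) powr (- \<mu>) * ((c powr \<mu> * y powr (- \<mu> - 1)) * (clifford \<nu> y - ?a)) = regular_kernel c \<nu> \<mu> y"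
      unfolding mult.assoc[symmetric] e2[unfolded mult.assoc[symmetric]] by (simp add: regular_kernel_def)
    show ?thesis using S unfolding e1 e3 .
  qed
  note T = set_integral_sums[where f = ?f, OF fint le sB abs sum]
  show "set_integrable lborel {2 * c..} (regular_kernel c \<nu> \<mu>)" by (rule T(1))
  show "(\<lambda>n. (- \<mu> gchoose n) * c powr (\<mu> + real n) * V (\<mu> + real n))
       sums (LINT y:{2 * c..}|lborel. regular_kernel c \<nu> \<mu> y)"
  proof -
    have "(LINT y:{2 * c..}|lborel. ?D (\<mu> + real n) y) = V (\<mu> + real n)" for n
      by (rule D(2)) simp
    thus ?thesis using T(2) unfolding set_integral_mult_right by (simp only:)
  qed
qed

text \<open>The denominators \<open>k + 1 - (\<mu> + n)\<close> of the double series stay away from 0, uniformly in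
  \<open>k\<close> and \<open>n\<close>.\<close>

lemma distance_from_integers:
  fixes \<mu> :: real
  assumes "\<mu> \<notin> \<int>"
  obtains \<delta> where "\<delta> > 0" "\<And>i::int. \<bar>of_int i - \<mu>\<bar> \<ge> \<delta>"
proof (rule that[of "min (\<mu> - of_int \<lfloor>\<mu>\<rfloor>) (of_int \<lfloor>\<mu>\<rfloor> + 1 - \<mu>)"])
  have "\<mu> \<noteq> of_int \<lfloor>\<mu>\<rfloor>" using assms by (metis Ints_of_int)
  thus "min (\<mu> - of_int \<lfloor>\<mu>\<rfloor>) (of_int \<lfloor>\<mu>\<rfloor> + 1 - \<mu>) > 0" by linarith
  fix i :: int
  consider "i \<le> \<lfloor>\<mu>\<rfloor>" | "i \<ge> \<lfloor>\<mu>\<rfloor> + 1" by linarith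
  thus "\<bar>of_int i - \<mu>\<bar> \<ge> min (\<mu> - of_int \<lfloor>\<mu>\<rfloor>) (of_int \<lfloor>\<mu>\<rfloor> + 1 - \<mu>)"
  proof cases
    case 1
    hence "real_of_int i \<le> of_int \<lfloor>\<mu>\<rfloor>" by simp
    thus ?thesis by linarith
  next
    case 2
    hence "real_of_int i \<ge> of_int \<lfloor>\<mu>\<rfloor> + 1" by linarith
    thus ?thesis by linarith
  qed
qed

text \<open>The terms of the binomial expansion of \<open>u\<^sup>k (1+u) powr (-\<mu>)\<close> at infinity, each
  replaced by the value at 2 of its power primitive. Where the integral over \<open>[2, \<infinity>)\<close> converges
  the sum is minus that integral; otherwise it is a regularization of it.\<close>

definition binomial_tail_term :: "real \<Rightarrow> nat \<Rightarrow> nat \<Rightarrow> real" where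
  "binomial_tail_term \<mu> k n =
     (- \<mu> gchoose n) * 2 powr (real k + 1 - (\<mu> + real n)) / (real k + 1 - (\<mu> + real n))"

lemma binomial_tail_term_bound:
  assumes "\<And>i::int. \<bar>of_int i - \<mu>\<bar> \<ge> \<delta>" "\<delta> > 0"
  shows "\<bar>binomial_tail_term \<mu> k n\<bar> \<le> \<bar>(- \<mu> gchoose n) * (1 / 2) ^ n\<bar> * (2 powr (real k + 1 - \<mu>) / \<delta>)"
proof -
  have d: "\<bar>real k + 1 - (\<mu> + real n)\<bar> \<ge> \<delta>"
    using assms(1)[of "int k + 1 - int n"] by (simp add: algebra_simps)
  have "2 powr (real k + 1 - (\<mu> + real n)) = 2 powr ((real k + 1 - \<mu>) - real n)"
    by (simp add: algebra_simps)
  also have "\<dots> = 2 powr (real k + 1 - \<mu>) * (1 / 2) ^ n"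
    by (subst powr_diff) (simp add: powr_realpow power_one_over)
  finally have "\<bar>binomial_tail_term \<mu> k n\<bar> = \<bar>(- \<mu> gchoose n) * (1 / 2) ^ n\<bar> * (2 powr (real k + 1 - \<mu>) / \<bar>real k + 1 - (\<mu> + real n)\<bar>)"
    by (simp add: binomial_tail_term_def abs_mult)
  also have "\<dots> \<le> \<bar>(- \<mu> gchoose n) * (1 / 2) ^ n\<bar> * (2 powr (real k + 1 - \<mu>) / \<delta>)"
    using d assms(2) by (intro mult_left_mono frac_le) auto
  finally show ?thesis .
qed

lemma summable_binomial_tail_term:
  assumes "\<mu> \<notin> \<int>"
  shows "summable (binomial_tail_term \<mu> k)"
proof -
  obtain \<delta> where d: "\<delta> > 0" "\<And>i::int. \<bar>of_int i - \<mu>\<bar> \<ge> \<delta>"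
    using distance_from_integers[OF assms] by metis
  show ?thesis
    by (rule summable_comparison_test'[of "\<lambda>n. \<bar>(- \<mu> gchoose n) * (1 / 2) ^ n\<bar> * (2 powr (real k + 1 - \<mu>) / \<delta>)" 0])
       (use binomial_tail_term_bound[OF d(2,1)] in \<open>auto intro!: summable_mult2 summable_gbinomial_half\<close>)
qed

lemma gbinomial_half_sums:
  "(\<lambda>n. ((1 - \<mu>) gchoose n) * 2 powr (real k + 1 - (\<mu> + real n))) sums (2 ^ k * 3 powr (1 - \<mu>))"
proof -
  have "(\<lambda>n. ((1 - \<mu>) gchoose n) * (1 / 2) ^ n) sums (1 + 1 / 2) powr (1 - \<mu>)"
    by (rule gen_binomial_real) simp
  hence "(\<lambda>n. 2 powr (real k + 1 - \<mu>) * (((1 - \<mu>) gchoose n) * (1 / 2) ^ n))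
      sums (2 powr (real k + 1 - \<mu>) * (3 / 2) powr (1 - \<mu>))"
    by (intro sums_mult) simp
  moreover have "2 powr (real k + 1 - \<mu>) * (((1 - \<mu>) gchoose n) * (1 / 2) ^ n)
      = ((1 - \<mu>) gchoose n) * 2 powr (real k + 1 - (\<mu> + real n))" for n
  proof -
    have "2 powr (real k + 1 - (\<mu> + real n)) = 2 powr ((real k + 1 - \<mu>) - real n)"
      by (simp add: algebra_simps)
    also have "\<dots> = 2 powr (real k + 1 - \<mu>) * (1 / 2) ^ n"
      by (subst powr_diff) (simp add: powr_realpow power_one_over)
    finally show ?thesis by simp
  qed
  moreover have "2 powr (real k + 1 - \<mu>) * (3 / 2) powr (1 - \<mu>) = 2 ^ k * 3 powr (1 - \<mu>)"
  proof -
    have "2 powr (real k + 1 - \<mu>) = 2 powr real k * 2 powr (1 - \<mu>)"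
      by (rule powr_mult_powr[symmetric]) simp
    moreover have "2 powr (1 - \<mu>) * (3 / 2) powr (1 - \<mu>) = 3 powr (1 - \<mu>)"
      using powr_mult[of 2 "3 / 2" "1 - \<mu>"] by simp
    ultimately show ?thesis by (simp add: powr_realpow mult.assoc)
  qed
  ultimately show ?thesis by simp
qed

text \<open>Pascal's rule in the form needed to move a factor \<open>1 + u\<close> between the expansions of
  \<open>(1+u) powr (-\<mu>)\<close> and \<open>(1+u) powr (1-\<mu>)\<close>.\<close>

lemma gbinomial_weighted_pascal:
  fixes K \<mu> :: real
  shows "K * (- \<mu> gchoose n) + (K + 1 - \<mu>) * (- \<mu> gchoose Suc n)
          = (K + 1 - (\<mu> + real (Suc n))) * ((1 - \<mu>) gchoose Suc n)"
    "(1 - \<mu>) * (- \<mu> gchoose n) = (1 - (\<mu> + real n)) * ((1 - \<mu>) gchoose n)"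
proof -
  have absorb: "(1 - \<mu> - real m) * ((1 - \<mu>) gchoose m) = (1 - \<mu>) * (- \<mu> gchoose m)" for m
    using gbinomial_absorb_comp[of "1 - \<mu>" m] by simp
  show "(1 - \<mu>) * (- \<mu> gchoose n) = (1 - (\<mu> + real n)) * ((1 - \<mu>) gchoose n)"
    using absorb[of n] by (simp add: diff_diff_eq)
  have "((1 - \<mu>) gchoose Suc n) = (- \<mu> gchoose n) + (- \<mu> gchoose Suc n)"
    using gbinomial_Suc_Suc[of "- \<mu>" n] by (simp add: add.commute)
  hence "K * (- \<mu> gchoose n) + (K + 1 - \<mu>) * (- \<mu> gchoose Suc n)
      = K * ((1 - \<mu>) gchoose Suc n) + (1 - \<mu>) * (- \<mu> gchoose Suc n)"
    by (simp add: algebra_simps)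
  also have "\<dots> = (K + 1 - (\<mu> + real (Suc n))) * ((1 - \<mu>) gchoose Suc n)"
    unfolding absorb[symmetric] by (simp add: algebra_simps)
  finally show "K * (- \<mu> gchoose n) + (K + 1 - \<mu>) * (- \<mu> gchoose Suc n)
          = (K + 1 - (\<mu> + real (Suc n))) * ((1 - \<mu>) gchoose Suc n)" .
qed

text \<open>These are the formal consequences of differentiating \<open>u powr (k+1) (1+u) powr (1-\<mu>)\<close>,
  with the boundary value at 2. They hold for the regularized tails too, since they are identities between
  coefficients.\<close>

lemma binomial_tail_recurrence:
  assumes "\<mu> \<notin> \<int>"
  shows "(1 - \<mu>) * suminf (binomial_tail_term \<mu> 0) = 3 powr (1 - \<mu>)"
    "(real k + 1) * suminf (binomial_tail_term \<mu> k) + (real k + 2 - \<mu>) * suminf (binomial_tail_term \<mu> (Suc k))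
       = 2 ^ Suc k * 3 powr (1 - \<mu>)"
proof -
  have nz: "real k + 1 - (\<mu> + real n) \<noteq> 0" for k n
  proof
    assume "real k + 1 - (\<mu> + real n) = 0"
    hence "\<mu> = of_int (int k + 1 - int n)" by simp
    thus False using assms Ints_of_int by metis
  qed
  have "(\<lambda>n. (1 - \<mu>) * binomial_tail_term \<mu> 0 n) sums ((1 - \<mu>) * suminf (binomial_tail_term \<mu> 0))"
    by (intro sums_mult summable_sums summable_binomial_tail_term assms)
  moreover have "(1 - \<mu>) * binomial_tail_term \<mu> 0 n = ((1 - \<mu>) gchoose n) * 2 powr (real 0 + 1 - (\<mu> + real n))" for n
  proof -
    have "(1 - \<mu>) * binomial_tail_term \<mu> 0 n
        = ((1 - \<mu>) * (- \<mu> gchoose n)) * 2 powr (real 0 + 1 - (\<mu> + real n)) / (1 - (\<mu> + real n))"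
      by (simp add: binomial_tail_term_def)
    thus ?thesis unfolding gbinomial_weighted_pascal(2) using nz[of 0 n] by simp
  qed
  ultimately show "(1 - \<mu>) * suminf (binomial_tail_term \<mu> 0) = 3 powr (1 - \<mu>)"
    using gbinomial_half_sums[of \<mu> 0] sums_unique2 by fastforce
  let ?g = "\<lambda>n. case n of 0 \<Rightarrow> 0 | Suc m \<Rightarrow> (real k + 1) * binomial_tail_term \<mu> k m"
  have "(\<lambda>n. ?g (Suc n)) sums ((real k + 1) * suminf (binomial_tail_term \<mu> k))"
    by (simp, intro sums_mult summable_sums summable_binomial_tail_term assms)
  hence "?g sums ((real k + 1) * suminf (binomial_tail_term \<mu> k))"
    by (subst (asm) sums_Suc_iff) simp
  moreover have "(\<lambda>n. (real k + 2 - \<mu>) * binomial_tail_term \<mu> (Suc k) n)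
      sums ((real k + 2 - \<mu>) * suminf (binomial_tail_term \<mu> (Suc k)))"
    by (intro sums_mult summable_sums summable_binomial_tail_term assms)
  ultimately have "(\<lambda>n. ?g n + (real k + 2 - \<mu>) * binomial_tail_term \<mu> (Suc k) n) sums
     ((real k + 1) * suminf (binomial_tail_term \<mu> k) + (real k + 2 - \<mu>) * suminf (binomial_tail_term \<mu> (Suc k)))"
    by (rule sums_add)
  moreover have "?g n + (real k + 2 - \<mu>) * binomial_tail_term \<mu> (Suc k) n
      = ((1 - \<mu>) gchoose n) * 2 powr (real (Suc k) + 1 - (\<mu> + real n))" for n
  proof (cases n)
    case 0
    have "real k + 2 - \<mu> \<noteq> 0" using nz[of "Suc k" 0] by simp
    moreover have "real (Suc k) + 1 - (\<mu> + real n) = real k + 2 - \<mu>" using 0 by simp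
    ultimately show ?thesis unfolding binomial_tail_term_def by (simp add: 0 add.commute[of 2])
  next
    case (Suc m)
    have e: "real k + 1 - (\<mu> + real m) = real (Suc k) + 1 - (\<mu> + real (Suc m))" by simp
    let ?d = "real (Suc k) + 1 - (\<mu> + real (Suc m))"
    have "?g n + (real k + 2 - \<mu>) * binomial_tail_term \<mu> (Suc k) n
       = ((real (Suc k)) * (- \<mu> gchoose m) + (real (Suc k) + 1 - \<mu>) * (- \<mu> gchoose Suc m)) * 2 powr ?d / ?d"
    proof -
      have "K * (p * P / d) + e * (q * P / d) = (K * p + e * q) * P / d" for K p P d e q :: real
        by (simp add: add_divide_distrib distrib_right)
      moreover have "real k + 1 = real (Suc k)" "real k + 2 - \<mu> = real (Suc k) + 1 - \<mu>" by simp_all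
      ultimately show ?thesis unfolding Suc binomial_tail_term_def nat.case e by (simp only:)
    qed
    also have "\<dots> = ((1 - \<mu>) gchoose Suc m) * 2 powr ?d"
      unfolding gbinomial_weighted_pascal(1) using nz[of "Suc k" "Suc m"] by simp
    finally show ?thesis by (simp add: Suc)
  qed
  ultimately show "(real k + 1) * suminf (binomial_tail_term \<mu> k) + (real k + 2 - \<mu>) * suminf (binomial_tail_term \<mu> (Suc k))
       = 2 ^ Suc k * 3 powr (1 - \<mu>)"
    using gbinomial_half_sums[of \<mu> "Suc k"] sums_unique2 by fastforce
qed

text \<open>The same derivative, now integrated over the bounded interval. Apart from the boundary value at 0 for the
  lowest moment, the recurrence agrees with that of the tails.\<close>

lemma moment_recurrence:
  fixes c \<mu> :: real
  assumes c: "c > 0"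
  defines "I \<equiv> \<lambda>k. integral {0..2 * c} (\<lambda>y. y ^ k * (1 + y / c) powr (- \<mu>))"
  shows "(1 - \<mu>) / c * I 0 = 3 powr (1 - \<mu>) - 1"
    "(real k + 1) * I k + (real k + 2 - \<mu>) / c * I (Suc k) = (2 * c) ^ Suc k * 3 powr (1 - \<mu>)"
proof -
  let ?p = "\<lambda>y. (1 + y / c) powr (- \<mu>)"
  let ?q = "\<lambda>y. (1 + y / c) powr (1 - \<mu>)"
  have pos: "1 + y / c > 0" if "y \<in> {0..2 * c}" for y
    using that c by (simp add: add_pos_nonneg)
  have cont: "continuous_on {0..2 * c} (\<lambda>y. y ^ k * ?p y)" for k
  proof (intro continuous_intros ballI)
    show "c \<noteq> 0" using c by simp
    show "1 + y / c \<noteq> 0" if "y \<in> {0..2 * c}" for y using pos[OF that] by simp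
  qed
  have int: "((\<lambda>y. y ^ k * ?p y) has_integral I k) {0..2 * c}" for k
    unfolding I_def by (intro integrable_integral integrable_continuous_real cont)
  have qd: "(?q has_real_derivative ((1 - \<mu>) / c * ?p y)) (at y)" if "y \<in> {0..2 * c}" for y
  proof -
    have "((\<lambda>y. 1 + y / c) has_real_derivative 1 / c) (at y)"
      using c by (auto intro!: derivative_eq_intros)
    from DERIV_chain2[OF has_real_derivative_powr[OF pos[OF that], of "1 - \<mu>"] this]
    show ?thesis by simp
  qed
  have "((\<lambda>y. (1 - \<mu>) / c * (y ^ 0 * ?p y)) has_integral (?q (2 * c) - ?q 0)) {0..2 * c}"
  proof (rule fundamental_theorem_of_calculus)
    fix y assume "y \<in> {0..2 * c}"
    from qd[OF this] show "(?q has_vector_derivative (1 - \<mu>) / c * (y ^ 0 * ?p y)) (at y within {0..2 * c})"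
      by (simp add: has_real_derivative_iff_has_vector_derivative has_vector_derivative_at_within)
  qed (use c in simp)
  moreover have "((\<lambda>y. (1 - \<mu>) / c * (y ^ 0 * ?p y)) has_integral (1 - \<mu>) / c * I 0) {0..2 * c}"
    by (intro has_integral_mult_right int)
  ultimately have "(1 - \<mu>) / c * I 0 = ?q (2 * c) - ?q 0"
    by (rule has_integral_unique[rotated])
  thus "(1 - \<mu>) / c * I 0 = 3 powr (1 - \<mu>) - 1" using c by simp
  have "((\<lambda>y. (real k + 1) * (y ^ k * ?p y) + (real k + 2 - \<mu>) / c * (y ^ Suc k * ?p y))
      has_integral ((2 * c) ^ Suc k * ?q (2 * c) - 0 ^ Suc k * ?q 0)) {0..2 * c}"
  proof (rule fundamental_theorem_of_calculus)
    fix y assume y: "y \<in> {0..2 * c}"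
    have "((\<lambda>y. y ^ Suc k * ?q y) has_real_derivative
        (real (Suc k) * y ^ k * ?q y + (1 - \<mu>) / c * ?p y * y ^ Suc k)) (at y)"
      using DERIV_mult[OF DERIV_pow[of "Suc k" y UNIV] qd[OF y]] by simp
    moreover have "?q y = (1 + y / c) * ?p y"
      using powr_mult_base[of "1 + y / c" "- \<mu>"] pos[OF y] by simp
    moreover have "real (Suc k) * y ^ k * ((1 + y / c) * P) + (1 - \<mu>) / c * P * y ^ Suc k
       = (real k + 1) * (y ^ k * P) + (real k + 2 - \<mu>) / c * (y ^ Suc k * P)" for P
      using c by (simp add: field_simps)
    ultimately have "((\<lambda>y. y ^ Suc k * ?q y) has_real_derivative
        ((real k + 1) * (y ^ k * ?p y) + (real k + 2 - \<mu>) / c * (y ^ Suc k * ?p y))) (at y)"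
      by (simp only:)
    thus "((\<lambda>y. y ^ Suc k * ?q y) has_vector_derivative
        ((real k + 1) * (y ^ k * ?p y) + (real k + 2 - \<mu>) / c * (y ^ Suc k * ?p y))) (at y within {0..2 * c})"
      by (simp add: has_real_derivative_iff_has_vector_derivative has_vector_derivative_at_within)
  qed (use c in simp)
  moreover have "((\<lambda>y. (real k + 1) * (y ^ k * ?p y) + (real k + 2 - \<mu>) / c * (y ^ Suc k * ?p y))
      has_integral ((real k + 1) * I k + (real k + 2 - \<mu>) / c * I (Suc k))) {0..2 * c}"
    by (intro has_integral_add has_integral_mult_right int)
  ultimately have "(real k + 1) * I k + (real k + 2 - \<mu>) / c * I (Suc k)
      = (2 * c) ^ Suc k * ?q (2 * c) - 0 ^ Suc k * ?q 0"
    by (rule has_integral_unique[rotated])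
  thus "(real k + 1) * I k + (real k + 2 - \<mu>) / c * I (Suc k) = (2 * c) ^ Suc k * 3 powr (1 - \<mu>)"
    using c by simp
qed

text \<open>The moment over \<open>[0, 2c]\<close> together with its regularized tail does not depend on the cut: the
  boundary values in both recurrences cancel. The right-hand side is \<open>c\<^bsup>k+1\<^esup>\<close> times the
  Beta function \<open>B(k+1, \<mu>-k-1)\<close>, continued to all non-integral \<open>\<mu>\<close>.\<close>

lemma regularized_moment:
  fixes c \<mu> :: real
  assumes c: "c > 0" and mu: "\<mu> \<notin> \<int>"
  shows "integral {0..2 * c} (\<lambda>y. y ^ k * (1 + y / c) powr (- \<mu>)) - c ^ Suc k * suminf (binomial_tail_term \<mu> k)
       = c ^ Suc k * ((-1) ^ Suc k * fact k / pochhammer (1 - \<mu>) (Suc k))"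
proof (induction k)
  have nz: "1 - \<mu> + real k \<noteq> 0" for k
  proof
    assume "1 - \<mu> + real k = 0"
    hence "\<mu> = of_int (1 + int k)" by simp
    thus False using mu Ints_of_int by metis
  qed
  {
    case 0
    have "(1 - \<mu>) * (integral {0..2 * c} (\<lambda>y. y ^ 0 * (1 + y / c) powr (- \<mu>)) / c - suminf (binomial_tail_term \<mu> 0)) = -1"
      using moment_recurrence(1)[OF c, of \<mu>] binomial_tail_recurrence(1)[OF mu] by (simp add: algebra_simps)
    hence "integral {0..2 * c} (\<lambda>y. y ^ 0 * (1 + y / c) powr (- \<mu>)) / c - suminf (binomial_tail_term \<mu> 0) = -1 / (1 - \<mu>)"
      using nz[of 0] by (simp add: field_simps)
    thus ?case using c nz[of 0] by (simp add: field_simps)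
  next
    case (Suc k)
    let ?I = "\<lambda>k. integral {0..2 * c} (\<lambda>y. y ^ k * (1 + y / c) powr (- \<mu>))"
    let ?w = "\<lambda>k. suminf (binomial_tail_term \<mu> k)"
    have r1: "(real k + 2 - \<mu>) * ?I (Suc k) = c * ((2 * c) ^ Suc k * 3 powr (1 - \<mu>) - (real k + 1) * ?I k)"
      using moment_recurrence(2)[OF c, of k \<mu>] c by (simp add: field_simps)
    have r2: "(real k + 2 - \<mu>) * ?w (Suc k) = 2 ^ Suc k * 3 powr (1 - \<mu>) - (real k + 1) * ?w k"
      using binomial_tail_recurrence(2)[OF mu, of k] by (simp add: algebra_simps)
    have "(real k + 2 - \<mu>) * (?I (Suc k) - c ^ Suc (Suc k) * ?w (Suc k))
        = (real k + 2 - \<mu>) * ?I (Suc k) - c ^ Suc (Suc k) * ((real k + 2 - \<mu>) * ?w (Suc k))"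
      by (simp add: algebra_simps)
    also have "\<dots> = - c * (real k + 1) * (?I k - c ^ Suc k * ?w k)"
      unfolding r1 r2 by (simp add: power_mult_distrib algebra_simps)
    also have "\<dots> = - c * (real k + 1) * (c ^ Suc k * ((-1) ^ Suc k * fact k / pochhammer (1 - \<mu>) (Suc k)))"
      unfolding Suc.IH ..
    also have "\<dots> = (real k + 2 - \<mu>) * (c ^ Suc (Suc k) * ((-1) ^ Suc (Suc k) * fact (Suc k) / pochhammer (1 - \<mu>) (Suc (Suc k))))"
    proof -
      have "pochhammer (1 - \<mu>) (Suc (Suc k)) = pochhammer (1 - \<mu>) (Suc k) * (real k + 2 - \<mu>)"
        by (subst pochhammer_Suc) (simp add: algebra_simps)
      moreover have "real k + 2 - \<mu> \<noteq> 0" using nz[of "Suc k"] by (simp add: algebra_simps)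
      moreover have "- c * (real k + 1) * (C * ((-1) ^ Suc k * f / P))
          = d * (c * C * ((-1) ^ Suc (Suc k) * ((real k + 1) * f) / (P * d)))" if "d \<noteq> 0" for C f P d :: real
        using that by (cases "P = 0") (simp_all add: field_simps)
      ultimately show ?thesis by (simp only: fact_Suc power_Suc[of c "Suc k"] of_nat_Suc add.commute[of 1])
    qed
    finally show ?case using nz[of "Suc k"] by (subst (asm) mult_left_cancel) (simp_all add: algebra_simps)
  }
qed

text \<open>The expansions below and above the cut at \<open>2c\<close> leave boundary terms. Above it they are, for
  each \<open>n\<close>, the series in \<open>k\<close> from the Mellin tail; below it they are, for each
  \<open>k\<close>, the series in \<open>n\<close> that completes the moment. Both are sums of the same double series
  \<open>F n k\<close>, so they cancel in the total. What remains are the residues at \<open>s = \<mu> + n\<close> and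
  at \<open>s = k + 1\<close> of the Mellin--Barnes integrand.\<close>

theorem integral_regular_kernel:
  assumes c: "c > 0" and mu: "\<mu> > 0" "\<mu> \<notin> \<int>" and cond: "2 * \<mu> + \<nu> > - 1 / 2"
  obtains P Q where
    "(\<lambda>n. (- \<mu> gchoose n) * c powr (\<mu> + real n) * (Gamma (- (\<mu> + real n)) * rGamma (\<nu> + 1 + (\<mu> + real n)))) sums P"
    "(\<lambda>k. clifford_coeff \<nu> (Suc k) * (c ^ Suc k * ((-1) ^ Suc k * fact k / pochhammer (1 - \<mu>) (Suc k)))) sums Q"
    "set_integrable lborel {0<..} (regular_kernel c \<nu> \<mu>)"
    "(LINT y:{0<..}|lborel. regular_kernel c \<nu> \<mu> y) = P + Q"
proof -
  have X: "2 * c > 0" using c by simp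
  obtain \<delta> where d: "\<delta> > 0" "\<And>i::int. \<bar>of_int i - \<mu>\<bar> \<ge> \<delta>"
    using distance_from_integers[OF mu(2)] by metis
  let ?I = "\<lambda>k. integral {0..2 * c} (\<lambda>y. y ^ k * (1 + y / c) powr (- \<mu>))"
  let ?V = "\<lambda>s. mellin_tail \<nu> s (2 * c) - rGamma (1 + \<nu>) * (2 * c) powr (- s) / s"
  let ?g = "\<lambda>n. (- \<mu> gchoose n) * c powr (\<mu> + real n)"
  let ?M = "\<lambda>s. Gamma (- s) * rGamma (\<nu> + 1 + s)"
  let ?cc = "\<lambda>k. clifford_coeff \<nu> (Suc k) * c ^ Suc k"
  note near = regular_kernel_near[OF c less_imp_le[OF mu(1)] X, of \<nu>]
  note far = regular_kernel_far[OF c mu(1) cond]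
  \<comment> \<open>The double series of boundary terms; \<open>2c\<close> is the cut.\<close>
  define F where "F n k = ?cc k * binomial_tail_term \<mu> k n" for n k
  have ni: "\<mu> + real n \<noteq> real m" for n m
  proof
    assume "\<mu> + real n = real m"
    hence "\<mu> = of_int (int m - int n)" by simp
    thus False using mu(2) Ints_of_int by metis
  qed
  have rows: "F n sums (?g n * (?M (\<mu> + real n) - ?V (\<mu> + real n)))" for n
  proof -
    let ?s = "\<mu> + real n"
    let ?h = "\<lambda>k. clifford_coeff \<nu> k * (2 * c) powr (real k - ?s) / (real k - ?s)"
    have "?h sums (?M ?s - mellin_tail \<nu> ?s (2 * c))"
      using mellin_tail_expansion[OF X, of ?s \<nu>] cond ni unfolding mellin_tail_expansion_def by simp
    moreover have "?h 0 = - (rGamma (1 + \<nu>) * (2 * c) powr (- ?s) / ?s)"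
      by (simp add: clifford_coeff_0 divide_minus_right[symmetric] del: divide_minus_right)
    ultimately have "(\<lambda>k. ?h (Suc k)) sums (?M ?s - ?V ?s)"
      by (subst sums_Suc_iff) simp
    hence "(\<lambda>k. ?g n * ?h (Suc k)) sums (?g n * (?M ?s - ?V ?s))" by (rule sums_mult)
    moreover have "?g n * ?h (Suc k) = F n k" for k
    proof -
      have "c powr ?s * (2 * c) powr (real (Suc k) - ?s) = c ^ Suc k * 2 powr (real k + 1 - ?s)"
        using c by (simp add: powr_mult powr_diff powr_realpow powr_add field_simps)
      hence "(- \<mu> gchoose n) * clifford_coeff \<nu> (Suc k) * (c powr ?s * (2 * c) powr (real (Suc k) - ?s)) / (real (Suc k) - ?s)
         = F n k"
        by (simp add: F_def binomial_tail_term_def add.commute[of 1])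
      thus ?thesis by (simp add: mult_ac)
    qed
    ultimately show ?thesis by simp
  qed
  have cols: "(\<lambda>n. F n k) sums (?cc k * suminf (binomial_tail_term \<mu> k))" for k
    unfolding F_def by (intro sums_mult summable_sums summable_binomial_tail_term mu)
  let ?A = "\<lambda>n. \<bar>(- \<mu> gchoose n) * (1 / 2) ^ n\<bar>"
  let ?B = "\<lambda>k. norm (clifford_coeff \<nu> (Suc k) * (2 * c) ^ Suc k) * (2 powr (- \<mu>) / \<delta>)"
  have le: "\<bar>F n k\<bar> \<le> ?A n * ?B k" for n k
  proof -
    have "\<bar>F n k\<bar> \<le> \<bar>?cc k\<bar> * (?A n * (2 powr (real k + 1 - \<mu>) / \<delta>))"
      unfolding F_def abs_mult[of "?cc k"] by (intro mult_left_mono binomial_tail_term_bound d) auto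
    also have "2 powr (real k + 1 - \<mu>) = 2 ^ Suc k * 2 powr (- \<mu>)"
      by (simp add: powr_diff powr_add powr_realpow powr_minus divide_inverse)
    also have "\<bar>?cc k\<bar> * (?A n * (2 ^ Suc k * 2 powr (- \<mu>) / \<delta>)) = ?A n * ?B k"
      using c by (simp add: abs_mult power_mult_distrib)
    finally show ?thesis .
  qed
  have sB: "summable ?B"
  proof (rule summable_mult2)
    show "summable (\<lambda>k. norm (clifford_coeff \<nu> (Suc k) * (2 * c) ^ Suc k))"
      using summable_norm_clifford[of \<nu> "2 * c"] by (subst summable_Suc_iff) simp
  qed
  have B0: "?B k \<ge> 0" for k using d(1) by simp
  have "\<exists>S. (\<lambda>n. ?g n * (?M (\<mu> + real n) - ?V (\<mu> + real n))) sums S \<and>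
      (\<lambda>k. ?cc k * suminf (binomial_tail_term \<mu> k)) sums S"
    by (rule sums_swap[OF le summable_gbinomial_half sB abs_ge_zero B0 rows cols])
  then obtain S where S: "(\<lambda>n. ?g n * (?M (\<mu> + real n) - ?V (\<mu> + real n))) sums S"
      "(\<lambda>k. ?cc k * suminf (binomial_tail_term \<mu> k)) sums S"
    by blast
  let ?near = "LINT y:{0<..2 * c}|lborel. regular_kernel c \<nu> \<mu> y"
  let ?far = "LINT y:{2 * c..}|lborel. regular_kernel c \<nu> \<mu> y"
  have sumP: "(\<lambda>n. ?g n * ?M (\<mu> + real n)) sums (?far + S)"
    using sums_add[OF far(2) S(1)] by (simp add: algebra_simps)
  have "(\<lambda>k. clifford_coeff \<nu> (Suc k) * ?I k - ?cc k * suminf (binomial_tail_term \<mu> k)) sums (?near - S)"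
    by (rule sums_diff[OF near(2) S(2)])
  moreover have "clifford_coeff \<nu> (Suc k) * ?I k - ?cc k * suminf (binomial_tail_term \<mu> k)
     = clifford_coeff \<nu> (Suc k) * (c ^ Suc k * ((-1) ^ Suc k * fact k / pochhammer (1 - \<mu>) (Suc k)))" for k
    unfolding regularized_moment[OF c mu(2), symmetric] by (simp add: algebra_simps)
  ultimately have sumQ: "(\<lambda>k. clifford_coeff \<nu> (Suc k) * (c ^ Suc k * ((-1) ^ Suc k * fact k / pochhammer (1 - \<mu>) (Suc k)))) sums (?near - S)"
    by (simp only:)
  have far': "set_integrable lborel {2 * c<..} (regular_kernel c \<nu> \<mu>)"
    by (rule set_integrable_subset[OF far(1)]) auto
  have un: "{0<..} = {0<..2 * c} \<union> {2 * c<..}" using c by auto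
  have int: "set_integrable lborel {0<..} (regular_kernel c \<nu> \<mu>)"
    unfolding un by (rule set_integrable_Un[OF near(1) far']) auto
  have "(LINT y:{0<..}|lborel. regular_kernel c \<nu> \<mu> y) = ?near + (LINT y:{2 * c<..}|lborel. regular_kernel c \<nu> \<mu> y)"
    unfolding un by (intro set_integral_Un near(1) far') auto
  also have "(LINT y:{2 * c<..}|lborel. regular_kernel c \<nu> \<mu> y) = ?far"
  proof -
    have [measurable]: "regular_kernel c \<nu> \<mu> \<in> borel_measurable borel"
      unfolding regular_kernel_def[abs_def] by measurable
    show ?thesis
      unfolding set_lebesgue_integral_def
      by (intro integral_cong_AE) (auto intro: AE_mp[OF AE_lborel_singleton[of "2 * c"]] simp: indicator_def)
  qed
  also have "?near + ?far = (?far + S) + (?near - S)" by simp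
  finally show ?thesis by (rule that[OF sumP sumQ int])
qed

section \<open>Closed form in terms of two residue series\<close>

lemma rGamma_reflection_real: "rGamma x * rGamma (1 - x) = sin (pi * x) / pi" for x :: real
proof -
  have "complex_of_real (rGamma x * rGamma (1 - x)) = of_real (sin (pi * x) / pi)"
    using rGamma_reflection_complex[of "of_real x"]
    by (simp flip: rGamma_complex_of_real sin_of_real)
  thus ?thesis by (simp only: of_real_eq_iff)
qed

text \<open>A residue at a positive integer, up to the common factor of both series. These terms make up the
  \<open>2F3\<close> series.\<close>

definition pole_residue :: "real \<Rightarrow> real \<Rightarrow> real \<Rightarrow> nat \<Rightarrow> real" where
  "pole_residue c \<nu> \<mu> n = c ^ Suc n * rGamma (2 - \<mu> + real n) * rGamma (2 + \<nu> + real n) / (real n + 1)"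

text \<open>A residue at \<open>\<mu> + n\<close>, up to the same factor. These terms make up the \<open>1F2\<close>
  series.\<close>

definition power_residue :: "real \<Rightarrow> real \<Rightarrow> real \<Rightarrow> nat \<Rightarrow> real" where
  "power_residue c \<nu> \<mu> n = c powr (\<mu> + real n) * rGamma (1 + \<mu> + \<nu> + real n) / ((\<mu> + real n) * fact n)"

text \<open>The reflection formula extracts \<open>\<pi> / sin(\<pi>\<mu>)\<close> from both series. In this form each
  series stays finite at integers, and only the prefactor is singular.\<close>

theorem integral_regular_kernel_closed_form:
  assumes c: "c > 0" and mu: "\<mu> > 0" "\<mu> \<notin> \<int>" and cond: "2 * \<mu> + \<nu> > - 1 / 2"
  obtains S1 S2 where "pole_residue c \<nu> \<mu> sums S1" "power_residue c \<nu> \<mu> sums S2"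
    "(LINT y:{0<..}|lborel. regular_kernel c \<nu> \<mu> y) = pi * rGamma \<mu> / sin (pi * \<mu>) * (S1 - S2)"
proof -
  define \<kappa> where "\<kappa> = pi * rGamma \<mu> / sin (pi * \<mu>)"
  have sin0: "sin (pi * \<mu>) \<noteq> 0"
    using mu(2) by (auto simp: sin_zero_iff_int2)
  have G0: "rGamma \<mu> \<noteq> 0" using mu(1) by (auto simp: rGamma_eq_zero_iff elim!: nonpos_Ints_cases)
  have k0: "\<kappa> \<noteq> 0" using sin0 G0 by (simp add: \<kappa>_def)
  have refl1: "1 / rGamma (1 - \<mu>) = \<kappa>"
  proof -
    have "rGamma (1 - \<mu>) = sin (pi * \<mu>) / (pi * rGamma \<mu>)"
      using rGamma_reflection_real[of \<mu>] G0 by (simp add: field_simps)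
    thus ?thesis by (simp add: \<kappa>_def)
  qed
  obtain P Q where P: "(\<lambda>n. (- \<mu> gchoose n) * c powr (\<mu> + real n) * (Gamma (- (\<mu> + real n)) * rGamma (\<nu> + 1 + (\<mu> + real n)))) sums P"
    and Q: "(\<lambda>k. clifford_coeff \<nu> (Suc k) * (c ^ Suc k * ((-1) ^ Suc k * fact k / pochhammer (1 - \<mu>) (Suc k)))) sums Q"
    and "set_integrable lborel {0<..} (regular_kernel c \<nu> \<mu>)"
    and I: "(LINT y:{0<..}|lborel. regular_kernel c \<nu> \<mu> y) = P + Q"
    by (rule integral_regular_kernel[OF c mu cond])
  have p: "(- \<mu> gchoose n) * c powr (\<mu> + real n) * (Gamma (- (\<mu> + real n)) * rGamma (\<nu> + 1 + (\<mu> + real n)))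
      = - \<kappa> * power_residue c \<nu> \<mu> n" for n
  proof -
    let ?s = "\<mu> + real n"
    have sn: "sin (pi * ?s) = (-1) ^ n * sin (pi * \<mu>)"
      by (simp add: distrib_left sin_add)
    have "rGamma (- ?s) * rGamma (1 + ?s) = - sin (pi * ?s) / pi"
      using rGamma_reflection_real[of "- ?s"] by (simp del: minus_add_distrib)
    moreover have r1: "rGamma (1 + ?s) \<noteq> 0"
      using mu(1) by (auto simp: rGamma_eq_zero_iff elim!: nonpos_Ints_cases)
    ultimately have "rGamma (- ?s) = - ((-1) ^ n * sin (pi * \<mu>)) / (pi * rGamma (1 + ?s))"
      unfolding sn by (simp add: field_simps)
    hence G: "Gamma (- ?s) = - (pi * rGamma (1 + ?s)) * (-1) ^ n / sin (pi * \<mu>)"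
      unfolding Gamma_def using sin0 by (simp add: field_simps)
    have ps: "pochhammer \<mu> n * rGamma (1 + ?s) = rGamma \<mu> / ?s"
      using pochhammer_rGamma[of \<mu> "Suc n"] mu(1) by (simp add: pochhammer_Suc field_simps add_ac)
    have "(- \<mu> gchoose n) * c powr ?s * (Gamma (- ?s) * rGamma (\<nu> + 1 + ?s))
      = ((-1) ^ n * (-1) ^ n) * (- (pi * (pochhammer \<mu> n * rGamma (1 + ?s)) / sin (pi * \<mu>)) * c powr ?s * rGamma (\<nu> + 1 + ?s) / fact n)"
      unfolding G gbinomial_pochhammer by (simp add: field_simps)
    also have "(-1) ^ n * (-1) ^ n = (1::real)" by (simp add: power_mult_distrib[symmetric])
    finally have "(- \<mu> gchoose n) * c powr ?s * (Gamma (- ?s) * rGamma (\<nu> + 1 + ?s))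
      = - (pi * (rGamma \<mu> / ?s) / sin (pi * \<mu>)) * c powr ?s * rGamma (\<nu> + 1 + ?s) / fact n"
      unfolding ps by simp
    moreover have "\<nu> + 1 + ?s = 1 + \<mu> + \<nu> + real n" by simp
    moreover have "- (pi * (r / s) / S) * C * R / f = - (pi * r / S) * (C * R / (s * f))" for r s S C R f :: real
      by (simp add: mult_ac)
    ultimately show ?thesis unfolding \<kappa>_def power_residue_def by (simp only:)
  qed
  have q: "clifford_coeff \<nu> (Suc k) * (c ^ Suc k * ((-1) ^ Suc k * fact k / pochhammer (1 - \<mu>) (Suc k)))
      = \<kappa> * pole_residue c \<nu> \<mu> k" for k
  proof -
    have "rGamma (1 - \<mu>) = pochhammer (1 - \<mu>) (Suc k) * rGamma (2 - \<mu> + real k)"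
      using pochhammer_rGamma[of "1 - \<mu>" "Suc k"] by (simp add: algebra_simps)
    moreover have "rGamma (1 - \<mu>) \<noteq> 0" using refl1 k0 by auto
    ultimately have "1 / pochhammer (1 - \<mu>) (Suc k) = \<kappa> * rGamma (2 - \<mu> + real k)"
      unfolding refl1[symmetric] by (auto simp: field_simps)
    hence pr: "x / pochhammer (1 - \<mu>) (Suc k) = x * (\<kappa> * rGamma (2 - \<mu> + real k))" for x
      by (metis times_divide_eq_right mult.right_neutral)
    have "clifford_coeff \<nu> (Suc k) * (c ^ Suc k * ((-1) ^ Suc k * fact k * (\<kappa> * rGamma (2 - \<mu> + real k))))
       = ((-1) ^ Suc k * (-1) ^ Suc k) * (rGamma (\<nu> + real (Suc k) + 1) / fact (Suc k) * c ^ Suc k * fact k * (\<kappa> * rGamma (2 - \<mu> + real k)))"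
      unfolding clifford_coeff_def by (simp only: mult_ac times_divide_eq_left times_divide_eq_right)
    also have "(-1) ^ Suc k * (-1) ^ Suc k = (1::real)" by (simp add: power_mult_distrib[symmetric])
    also have "1 * (rGamma (\<nu> + real (Suc k) + 1) / fact (Suc k) * c ^ Suc k * fact k * (\<kappa> * rGamma (2 - \<mu> + real k))) = \<kappa> * pole_residue c \<nu> \<mu> k"
    proof -
      have "R / ((1 + x) * f) * C * f * (K * r) = K * (C * r * R / (x + 1))" if "f \<noteq> 0" for R x f C K r :: real
        using that by (simp add: add.commute mult_ac)
      moreover have "fact (Suc k) = (1 + real k) * (fact k :: real)" by simp
      moreover have "\<nu> + real (Suc k) + 1 = 2 + \<nu> + real k" by simp
      ultimately show ?thesis unfolding pole_residue_def by (simp only: mult_1_left fact_nonzero not_False_eq_True)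
    qed
    finally show ?thesis unfolding pr .
  qed
  have "(\<lambda>n. (- 1 / \<kappa>) * (- \<kappa> * power_residue c \<nu> \<mu> n)) sums ((- 1 / \<kappa>) * P)"
    using P unfolding p by (rule sums_mult)
  hence 2: "power_residue c \<nu> \<mu> sums (- P / \<kappa>)" using k0 by simp
  have "(\<lambda>n. (1 / \<kappa>) * (\<kappa> * pole_residue c \<nu> \<mu> n)) sums ((1 / \<kappa>) * Q)"
    using Q unfolding q by (rule sums_mult)
  hence 1: "pole_residue c \<nu> \<mu> sums (Q / \<kappa>)" using k0 by simp
  have "P + Q = \<kappa> * (Q / \<kappa> - (- P / \<kappa>))" using k0 by (simp add: field_simps)
  thus ?thesis using that[OF 1 2] I by (simp add: \<kappa>_def)
qed

section \<open>The digamma contribution of the subtracted constant\<close>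

lemma set_integral_shifted_powr:
  fixes a c :: real
  assumes a: "a > 0" and c: "c > 0"
  shows "set_integrable lborel {0..} (\<lambda>y. (1 + y / c) powr (- a - 1) / c)"
    "(LINT y:{0..}|lborel. (1 + y / c) powr (- a - 1) / c) = 1 / a"
proof -
  let ?f = "\<lambda>y. (1 + y / c) powr (- a - 1) / c"
  have "(\<integral>\<^sup>+y. ennreal (?f y) * indicator {0..} y \<partial>lborel) = ennreal (0 - (- ((1 + 0 / c) powr (- a) / a)))"
  proof (rule nn_integral_FTC_atLeast)
    fix y :: real assume "0 \<le> y"
    hence pos: "1 + y / c > 0" using c by (simp add: add_pos_nonneg)
    have "((\<lambda>y. 1 + y / c) has_real_derivative 1 / c) (at y)"
      using c by (auto intro!: derivative_eq_intros)
    from DERIV_chain2[OF has_real_derivative_powr[OF pos, of "- a"] this]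
    have "((\<lambda>y. - ((1 + y / c) powr (- a) / a)) has_real_derivative - (- a * (1 + y / c) powr (- a - 1) * (1 / c) / a)) (at y)"
      by (intro DERIV_minus DERIV_cdivide)
    thus "((\<lambda>y. - ((1 + y / c) powr (- a) / a)) has_real_derivative ?f y) (at y)"
      using a by simp
    show "0 \<le> ?f y" using c by simp
  next
    have "filterlim (\<lambda>y. 1 + y / c) at_top at_top" using c by real_asymp
    hence "((\<lambda>y. (1 + y / c) powr (- a)) \<longlongrightarrow> 0) at_top"
      using a by (intro tendsto_neg_powr) auto
    from tendsto_minus[OF tendsto_divide[OF this tendsto_const[of a]]]
    show "((\<lambda>y. - ((1 + y / c) powr (- a) / a)) \<longlongrightarrow> 0) at_top" using a by simp
  qed measurable
  hence "(\<integral>\<^sup>+y. ennreal (indicator {0..} y *\<^sub>R ?f y) \<partial>lborel) = ennreal (1 / a)"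
  proof -
    have "ennreal (?f y) * indicator {0..} y = ennreal (indicator {0..} y *\<^sub>R ?f y)" for y
      by (simp add: indicator_def)
    thus ?thesis using \<open>(\<integral>\<^sup>+y. ennreal (?f y) * indicator {0..} y \<partial>lborel) = _\<close> by simp
  qed
  moreover have "(\<lambda>y. indicator {0..} y *\<^sub>R ?f y) \<in> borel_measurable lborel" by measurable
  ultimately have "integrable lborel (\<lambda>y. indicator {0..} y *\<^sub>R ?f y) \<and>
      (\<integral>y. indicator {0..} y *\<^sub>R ?f y \<partial>lborel) = 1 / a"
    using c a by (subst nn_integral_eq_integrable[symmetric]) (auto simp: indicator_def)
  thus "set_integrable lborel {0..} ?f" "(LINT y:{0..}|lborel. ?f y) = 1 / a"
    by (simp_all add: set_integrable_def set_lebesgue_integral_def)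
qed

text \<open>The excess of the power over the power with \<open>\<mu> = 1\<close>, for which the regularized integral
  of \<open>(1+y/c) powr (-\<mu>) / y\<close> is elementary.\<close>

definition digamma_kernel :: "real \<Rightarrow> real \<Rightarrow> real \<Rightarrow> real" where
  "digamma_kernel c \<mu> y = ((1 + y / c) powr (- \<mu>) - 1 / (1 + y / c)) / y"

text \<open>Expanding \<open>1/y\<close> in a geometric series in \<open>1/(1+y/c)\<close> and integrating gives
  \<open>\<Sum>n. 1/(\<mu>+n) - 1/(n+1)\<close>, the series of the digamma function. All terms have the same sign,
  which justifies the exchange.\<close>

lemma set_integral_digamma_kernel:
  assumes mu: "\<mu> > 0" and c: "c > 0"
  shows "set_integrable lborel {0<..} (digamma_kernel c \<mu>)"
    "(LINT y:{0<..}|lborel. digamma_kernel c \<mu> y) = - (Digamma \<mu> + euler_mascheroni)"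
proof -
  let ?m = "\<lambda>a y. (1 + y / c) powr (- a - 1) / c"
  let ?f = "\<lambda>n y. ?m (\<mu> + real n) y - ?m (real n + 1) y"
  \<comment> \<open>The common sign of all terms.\<close>
  define \<sigma> :: real where "\<sigma> = (if \<mu> \<le> 1 then 1 else -1)"
  have sub: "set_integrable lborel {0<..} (?m a)" "(LINT y:{0<..}|lborel. ?m a y) = 1 / a" if "a > 0" for a
  proof -
    note S = set_integral_shifted_powr[OF that c]
    show "set_integrable lborel {0<..} (?m a)" by (rule set_integrable_subset[OF S(1)]) auto
    have "(LINT y:{0<..}|lborel. ?m a y) = (LINT y:{0..}|lborel. ?m a y)"
      unfolding set_lebesgue_integral_def
      by (intro integral_cong_AE) (auto intro: AE_mp[OF AE_lborel_singleton[of 0]] simp: indicator_def)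
    also have "\<dots> = 1 / a" by (rule S(2))
    finally show "(LINT y:{0<..}|lborel. ?m a y) = 1 / a" .
  qed
  have fint: "set_integrable lborel {0<..} (?f n)" for n
    by (intro set_integral_diff(1) sub) (use mu in auto)
  have fval: "(LINT y:{0<..}|lborel. ?f n y) = 1 / (\<mu> + real n) - 1 / (real n + 1)" for n
  proof -
    have p: "\<mu> + real n > 0" "real n + 1 > 0" using mu by auto
    show ?thesis unfolding set_integral_diff(2)[OF sub(1)[OF p(1)] sub(1)[OF p(2)]] sub(2)[OF p(1)] sub(2)[OF p(2)] ..
  qed
  have fabs: "\<bar>?f n y\<bar> = \<sigma> * ?f n y" if "y \<in> {0<..}" for n y
  proof -
    have y: "1 + y / c \<ge> 1" using that c by simp
    have "0 \<le> \<sigma> * ?f n y"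
    proof (cases "\<mu> \<le> 1")
      case True
      hence "(1 + y / c) powr (- (real n + 1) - 1) \<le> (1 + y / c) powr (- (\<mu> + real n) - 1)"
        using y by (intro powr_mono) auto
      thus ?thesis using True c by (simp add: \<sigma>_def divide_right_mono)
    next
      case False
      hence "(1 + y / c) powr (- (real n + 1) - 1) \<ge> (1 + y / c) powr (- (\<mu> + real n) - 1)"
        using y by (intro powr_mono) auto
      thus ?thesis using False c by (simp add: \<sigma>_def divide_right_mono)
    qed
    hence "\<bar>\<sigma> * ?f n y\<bar> = \<sigma> * ?f n y" by simp
    thus ?thesis by (simp only: abs_mult) (simp add: \<sigma>_def split: if_splits)
  qed
  have le: "(LINT y:{0<..}|lborel. \<bar>?f n y\<bar>) \<le> \<sigma> * (1 / (\<mu> + real n) - 1 / (real n + 1))" for n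
  proof -
    have "(LINT y:{0<..}|lborel. \<bar>?f n y\<bar>) = (LINT y:{0<..}|lborel. \<sigma> * ?f n y)"
      by (rule set_lebesgue_integral_cong) (simp, intro allI impI fabs)
    thus ?thesis unfolding set_integral_mult_right fval by simp
  qed
  have D: "(\<lambda>n. 1 / (\<mu> + real n) - 1 / (real n + 1)) sums (- (Digamma \<mu> + euler_mascheroni))"
  proof -
    have "(\<lambda>n. inverse (real (Suc n)) - inverse (\<mu> + real n)) sums (Digamma \<mu> + euler_mascheroni)"
      using summable_Digamma[of \<mu>] mu by (simp add: Digamma_def sums_iff)
    from sums_minus[OF this] show ?thesis by (simp add: inverse_eq_divide add.commute)
  qed
  have sB: "summable (\<lambda>n. \<sigma> * (1 / (\<mu> + real n) - 1 / (real n + 1)))"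
    by (intro summable_mult sums_summable[OF D])
  have sum: "(\<lambda>n. ?f n y) sums digamma_kernel c \<mu> y" if "y \<in> {0<..}" for y
  proof -
    define q where "q = 1 / (1 + y / c)"
    have y: "y > 0" "1 + y / c > 1" using that c by auto
    hence q: "0 < q" "q < 1" by (auto simp: q_def)
    have pq: "(1 + y / c) powr (- (a + real n) - 1) = (1 + y / c) powr (- a) * (q * q ^ n)" for a n
    proof -
      have "(1 + y / c) powr (- (a + real n) - 1) = (1 + y / c) powr (- a - real (Suc n))" by (simp add: algebra_simps)
      also have "\<dots> = (1 + y / c) powr (- a) / (1 + y / c) powr real (Suc n)" by (rule powr_diff)
      also have "(1 + y / c) powr real (Suc n) = (1 + y / c) ^ Suc n" using y by (intro powr_realpow) auto
      finally show ?thesis by (simp add: q_def power_one_over divide_inverse power_inverse)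
    qed
    have m1: "(1 + y / c) powr (- 1) = 1 / (1 + y / c)" using y by (simp add: powr_minus_divide)
    have "(\<lambda>n. (((1 + y / c) powr (- \<mu>) - (1 + y / c) powr (- 1)) * q / c) * q ^ n) sums
       ((((1 + y / c) powr (- \<mu>) - (1 + y / c) powr (- 1)) * q / c) * (1 / (1 - q)))"
      using q by (intro sums_mult geometric_sums) simp
    moreover have "(((1 + y / c) powr (- \<mu>) - (1 + y / c) powr (- 1)) * q / c) * q ^ n = ?f n y" for n
      using pq[of \<mu> n] pq[of 1 n] by (simp add: algebra_simps diff_divide_distrib)
    moreover have "q / c * (1 / (1 - q)) = 1 / y"
    proof -
      have "q = c / (c + y)" using c y by (simp add: q_def divide_simps)
      moreover have "1 - c / (c + y) = y / (c + y)" using c y by (simp add: divide_simps)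
      ultimately show ?thesis using c y by simp
    qed
    hence "(((1 + y / c) powr (- \<mu>) - (1 + y / c) powr (- 1)) * q / c) * (1 / (1 - q)) = digamma_kernel c \<mu> y"
      unfolding digamma_kernel_def m1 by (metis (no_types, lifting) mult.assoc times_divide_eq_right mult.right_neutral)
    ultimately show ?thesis by simp
  qed
  have abs: "summable (\<lambda>n. \<bar>?f n y\<bar>)" if "y \<in> {0<..}" for y
    unfolding fabs[OF that] by (intro summable_mult sums_summable[OF sum[OF that]])
  note T = set_integral_sums[where f = ?f, OF fint le sB abs sum]
  show "set_integrable lborel {0<..} (digamma_kernel c \<mu>)" by (rule T(1))
  show "(LINT y:{0<..}|lborel. digamma_kernel c \<mu> y) = - (Digamma \<mu> + euler_mascheroni)"
    using sums_unique2[OF T(2)[unfolded fval] D] .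
qed

lemma tendsto_integral_at_top:
  fixes f :: "real \<Rightarrow> real"
  assumes f: "set_integrable lborel {0<..} f"
  shows "((\<lambda>Y. integral {0..Y} f) \<longlongrightarrow> (LINT x:{0<..}|lborel. f x)) at_top" "f integrable_on {0..Y}"
proof -
  have z: "set_integrable lborel {0..0} f"
    by (rule borel_integrable_atLeastAtMost') auto
  have un: "({0..} :: real set) = {0..0} \<union> {0<..}" by auto
  have f0: "set_integrable lborel {0..} f"
    unfolding un by (rule set_integrable_Un[OF z f]) auto
  have sub: "set_integrable lborel {0..Y} f" for Y by (rule set_integrable_subset[OF f0]) auto
  show "f integrable_on {0..Y}" by (rule set_borel_integral_eq_integral(1)[OF sub])
  have "(LINT x:{0..}|lborel. f x) = (LINT x:{0..0}|lborel. f x) + (LINT x:{0<..}|lborel. f x)"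
    unfolding un by (intro set_integral_Un z f) auto
  also have "(LINT x:{0..0}|lborel. f x) = 0"
    using set_borel_integral_eq_integral(2)[OF z] by simp
  finally have "(LINT x:{0..}|lborel. f x) = (LINT x:{0<..}|lborel. f x)" by simp
  moreover have "((\<lambda>Y. LINT x:{0..Y}|lborel. f x) \<longlongrightarrow> (LINT x:{0..}|lborel. f x)) at_top"
    by (rule tendsto_set_lebesgue_integral_at_top) (use f0 in auto)
  ultimately show "((\<lambda>Y. integral {0..Y} f) \<longlongrightarrow> (LINT x:{0<..}|lborel. f x)) at_top"
    by (simp add: set_borel_integral_eq_integral(2)[OF sub])
qed

text \<open>The integrand splits into the regular kernel, a multiple of the digamma kernel, and
  \<open>-C(0)/(c+y)\<close>. The last piece integrates to a logarithm that the added one cancels in the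
  limit.\<close>

lemma regularized_integral_limit:
  assumes c: "c > 0" and mu: "\<mu> > 0" and cond: "2 * \<mu> + \<nu> > - 1 / 2"
  defines "\<eta> \<equiv> \<lambda>y. (clifford \<nu> y * (1 + y / c) powr (- \<mu>) - rGamma (1 + \<nu>)) / y"
  shows "((\<lambda>Y. integral {0..Y} \<eta> + rGamma (1 + \<nu>) * ln (Y / c)) \<longlongrightarrow>
     (LINT y:{0<..}|lborel. regular_kernel c \<nu> \<mu> y) - rGamma (1 + \<nu>) * (Digamma \<mu> + euler_mascheroni)) at_top"
proof -
  let ?a = "rGamma (1 + \<nu>)"
  have X: "2 * c > 0" using c by simp
  have un: "{0<..} = {0<..2 * c} \<union> {2 * c..}" using c by auto
  have R: "set_integrable lborel {0<..} (regular_kernel c \<nu> \<mu>)"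
    unfolding un by (intro set_integrable_Un regular_kernel_near(1) regular_kernel_far(1)) (use c mu cond in auto)
  note D = set_integral_digamma_kernel[OF mu c]
  note LR = tendsto_integral_at_top[OF R] and LD = tendsto_integral_at_top[OF D(1)]
  have int: "integral {0..Y} \<eta> + ?a * ln (Y / c) =
      integral {0..Y} (regular_kernel c \<nu> \<mu>) + ?a * integral {0..Y} (digamma_kernel c \<mu>) + ?a * (ln (Y / c) - ln (1 + Y / c))"
    if Y: "Y > 0" for Y
  proof -
    have "((\<lambda>y. 1 / (c + y)) has_integral (ln (c + Y) - ln (c + 0))) {0..Y}"
    proof (rule fundamental_theorem_of_calculus)
      fix y assume "y \<in> {0..Y}"
      hence "((\<lambda>y. ln (c + y)) has_real_derivative 1 / (c + y)) (at y)"
        using c by (auto intro!: derivative_eq_intros)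
      thus "((\<lambda>y. ln (c + y)) has_vector_derivative 1 / (c + y)) (at y within {0..Y})"
        by (simp add: has_real_derivative_iff_has_vector_derivative has_vector_derivative_at_within)
    qed (use Y in simp)
    moreover have "ln (c + Y) - ln (c + 0) = ln (1 + Y / c)"
    proof -
      have "1 + Y / c = (c + Y) / c" using c by (simp add: field_simps)
      thus ?thesis using c Y by (simp add: ln_div)
    qed
    ultimately have l: "((\<lambda>y. 1 / (c + y)) has_integral ln (1 + Y / c)) {0..Y}" by simp
    have "((\<lambda>y. regular_kernel c \<nu> \<mu> y + ?a * (digamma_kernel c \<mu> y) - ?a * (1 / (c + y))) has_integral
       (integral {0..Y} (regular_kernel c \<nu> \<mu>) + ?a * integral {0..Y} (digamma_kernel c \<mu>) - ?a * ln (1 + Y / c))) {0..Y}"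
      by (intro has_integral_add has_integral_diff has_integral_mult_right integrable_integral LR(2) LD(2) l)
    hence "(\<eta> has_integral
       (integral {0..Y} (regular_kernel c \<nu> \<mu>) + ?a * integral {0..Y} (digamma_kernel c \<mu>) - ?a * ln (1 + Y / c))) {0..Y}"
    proof (rule has_integral_spike[rotated 2])
      show "negligible {0::real}" by simp
      fix y assume "y \<in> {0..Y} - {0}"
      hence y: "y > 0" by auto
      have "1 / (1 + y / c) = 1 - y / (c + y)" using y c by (simp add: divide_simps)
      hence "(1 / (1 + y / c) - 1) / y = - (1 / (c + y))" using y by simp
      moreover have "\<eta> y = (clifford \<nu> y - ?a) / y * (1 + y / c) powr (- \<mu>)
          + ?a * (((1 + y / c) powr (- \<mu>) - 1 / (1 + y / c)) / y) + ?a * ((1 / (1 + y / c) - 1) / y)"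
        unfolding \<eta>_def using y by (simp add: field_simps)
      ultimately show "\<eta> y = regular_kernel c \<nu> \<mu> y + ?a * digamma_kernel c \<mu> y - ?a * (1 / (c + y))"
        by (simp add: regular_kernel_def digamma_kernel_def)
    qed
    thus ?thesis by (simp add: integral_unique algebra_simps)
  qed
  have l0: "((\<lambda>Y. ln (Y / c) - ln (1 + Y / c)) \<longlongrightarrow> 0) at_top"
    using c by real_asymp
  have "((\<lambda>Y. integral {0..Y} (regular_kernel c \<nu> \<mu>) + ?a * integral {0..Y} (digamma_kernel c \<mu>) + ?a * (ln (Y / c) - ln (1 + Y / c)))
     \<longlongrightarrow> (LINT y:{0<..}|lborel. regular_kernel c \<nu> \<mu> y) + ?a * (- (Digamma \<mu> + euler_mascheroni)) + ?a * 0) at_top"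
    unfolding D(2)[symmetric] by (intro tendsto_intros LR(1) LD(1) l0)
  moreover have "\<forall>\<^sub>F Y in at_top. integral {0..Y} (regular_kernel c \<nu> \<mu>) + ?a * integral {0..Y} (digamma_kernel c \<mu>) + ?a * (ln (Y / c) - ln (1 + Y / c))
       = integral {0..Y} \<eta> + ?a * ln (Y / c)"
    using eventually_gt_at_top[of 0] by eventually_elim (simp add: int)
  ultimately have "((\<lambda>Y. integral {0..Y} \<eta> + ?a * ln (Y / c)) \<longlongrightarrow>
     (LINT y:{0<..}|lborel. regular_kernel c \<nu> \<mu> y) + ?a * (- (Digamma \<mu> + euler_mascheroni)) + ?a * 0) at_top"
    by (rule Lim_transform_eventually)
  moreover have "L + A * (- B) + A * 0 = L - A * B" for L A B :: real by simp
  ultimately show ?thesis by (simp only:)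
qed

section \<open>The confluent exponent\<close>

text \<open>Non-integral exponents \<open>1 + 1/(i+3)\<close> decrease to 1, and the kernel at exponent 1 dominates
  all of them.\<close>

lemma tendsto_integral_regular_kernel_1:
  assumes c: "c > 0" and cond: "2 + \<nu> > - 1 / 2"
  shows "(\<lambda>i. LINT y:{0<..}|lborel. regular_kernel c \<nu> (1 + 1 / (real i + 3)) y)
           \<longlonglongrightarrow> (LINT y:{0<..}|lborel. regular_kernel c \<nu> 1 y)"
proof -
  have [measurable]: "regular_kernel c \<nu> \<mu> \<in> borel_measurable borel" for \<mu>
    unfolding regular_kernel_def[abs_def] by measurable
  have un: "{0<..} = {0<..2 * c} \<union> {2 * c..}" using c by auto
  have R: "set_integrable lborel {0<..} (regular_kernel c \<nu> 1)"
    unfolding un by (intro set_integrable_Un regular_kernel_near(1) regular_kernel_far(1)) (use c cond in auto)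
  show ?thesis unfolding set_lebesgue_integral_def
  proof (rule integral_dominated_convergence)
    show "integrable lborel (\<lambda>y. norm (indicator {0<..} y *\<^sub>R regular_kernel c \<nu> 1 y))"
      using R unfolding set_integrable_def by (rule integrable_norm)
    show "AE y in lborel. (\<lambda>i. indicator {0<..} y *\<^sub>R regular_kernel c \<nu> (1 + 1 / (real i + 3)) y)
        \<longlonglongrightarrow> indicator {0<..} y *\<^sub>R regular_kernel c \<nu> 1 y"
    proof (intro AE_I2)
      fix y :: real
      have t: "(\<lambda>i. 1 + 1 / (real i + 3)) \<longlonglongrightarrow> 1" by real_asymp
      have lim: "(\<lambda>i. (1 + y / c) powr (- (1 + 1 / (real i + 3)))) \<longlonglongrightarrow> (1 + y / c) powr (- 1)" if "y > 0"
      proof (rule tendsto_powr[OF tendsto_const tendsto_minus[OF t]])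
        have "0 < y / c" using that c by simp
        thus "1 + y / c \<noteq> 0" by linarith
      qed
      show "(\<lambda>i. indicator {0<..} y *\<^sub>R regular_kernel c \<nu> (1 + 1 / (real i + 3)) y)
        \<longlonglongrightarrow> indicator {0<..} y *\<^sub>R regular_kernel c \<nu> 1 y"
      proof (cases "y > 0")
        case True
        show ?thesis unfolding regular_kernel_def
          by (intro tendsto_scaleR tendsto_mult tendsto_const lim[OF True])
      qed simp
    qed
    fix i :: nat
    show "AE y in lborel. norm (indicator {0<..} y *\<^sub>R regular_kernel c \<nu> (1 + 1 / (real i + 3)) y)
        \<le> norm (indicator {0<..} y *\<^sub>R regular_kernel c \<nu> 1 y)"
    proof (intro AE_I2)
      fix y :: real
      show "norm (indicator {0<..} y *\<^sub>R regular_kernel c \<nu> (1 + 1 / (real i + 3)) y)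
        \<le> norm (indicator {0<..} y *\<^sub>R regular_kernel c \<nu> 1 y)"
      proof (cases "y > 0")
        case True
        hence "(1 + y / c) powr (- (1 + 1 / (real i + 3))) \<le> (1 + y / c) powr (- 1)"
          using c by (intro powr_mono) auto
        hence "norm ((1 + y / c) powr (- (1 + 1 / (real i + 3)))) \<le> norm ((1 + y / c) powr (- 1))"
          by (simp only: real_norm_def abs_of_nonneg[OF powr_ge_zero])
        thus ?thesis unfolding regular_kernel_def norm_scaleR norm_mult
          by (intro mult_left_mono) auto
      qed simp
    qed
  qed measurable
qed

text \<open>Each of the factors that the functional equation produces is at least \<open>(j+1)/2\<close> in absolute
  value.\<close>

lemma norm_rGamma_shift_decay:
  fixes w :: complex
  assumes "Re w \<ge> 1 / 2"
  shows "norm (rGamma (w + of_nat n)) \<le> norm (rGamma w) * 2 ^ n / fact n"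
proof (induction n)
  case (Suc n)
  have "rGamma (w + of_nat n) = (w + of_nat n) * rGamma (w + of_nat (Suc n))"
    using rGamma_plus1[of "w + of_nat n"] by (simp add: add_ac)
  hence eq: "norm (rGamma (w + of_nat n)) = norm (w + of_nat n) * norm (rGamma (w + of_nat (Suc n)))"
    by (simp add: norm_mult)
  have "real (Suc n) / 2 \<le> Re (w + of_nat n)" using assms by simp
  also have "\<dots> \<le> norm (w + of_nat n)" by (rule complex_Re_le_cmod)
  finally have "real (Suc n) / 2 * norm (rGamma (w + of_nat (Suc n))) \<le> norm (rGamma (w + of_nat n))"
    unfolding eq by (intro mult_right_mono) auto
  also have "\<dots> \<le> norm (rGamma w) * 2 ^ n / fact n" by (rule Suc.IH)
  finally have "real (Suc n) / 2 * norm (rGamma (w + of_nat (Suc n))) * (2 / real (Suc n))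
      \<le> norm (rGamma w) * 2 ^ n / fact n * (2 / real (Suc n))"
    by (intro mult_right_mono) auto
  moreover have "norm (rGamma w) * 2 ^ n / fact n * (2 / real (Suc n)) = norm (rGamma w) * 2 ^ Suc n / fact (Suc n)"
    by (simp add: field_simps)
  ultimately show ?case by (simp del: of_nat_Suc fact_Suc power_Suc)
qed simp

lemma norm_rGamma_shift_mono:
  fixes w :: complex
  assumes "Re w \<ge> 1"
  shows "norm (rGamma (w + of_nat n)) \<le> norm (rGamma w)"
proof (induction n)
  case (Suc n)
  have "rGamma (w + of_nat n) = (w + of_nat n) * rGamma (w + of_nat (Suc n))"
    using rGamma_plus1[of "w + of_nat n"] by (simp add: add_ac)
  hence eq: "norm (rGamma (w + of_nat n)) = norm (w + of_nat n) * norm (rGamma (w + of_nat (Suc n)))"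
    by (simp add: norm_mult)
  have "1 \<le> Re (w + of_nat n)" using assms by simp
  also have "\<dots> \<le> norm (w + of_nat n)" by (rule complex_Re_le_cmod)
  finally have "1 * norm (rGamma (w + of_nat (Suc n))) \<le> norm (rGamma (w + of_nat n))"
    unfolding eq by (intro mult_right_mono) auto
  thus ?case using Suc.IH by simp
qed simp

text \<open>The difference of the two residues as a function of a complex exponent, so that termwise convergence of
  derivatives follows from Weierstrass's theorem.\<close>

definition residue_difference :: "real \<Rightarrow> real \<Rightarrow> nat \<Rightarrow> complex \<Rightarrow> complex" where
  "residue_difference c \<nu> n z =
     of_real (c ^ Suc n * rGamma (2 + \<nu> + real n) / (real n + 1)) * rGamma (2 - z + of_nat n)
     - of_real (c ^ n / fact n) * (of_real c powr z * rGamma (1 + z + of_real \<nu> + of_nat n) / (z + of_nat n))"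

lemma residue_difference_of_real:
  assumes "c > 0" "\<mu> > 0"
  shows "residue_difference c \<nu> n (of_real \<mu>) = of_real (pole_residue c \<nu> \<mu> n - power_residue c \<nu> \<mu> n)"
proof -
  have "rGamma (2 - complex_of_real \<mu> + of_nat n) = of_real (rGamma (2 - \<mu> + real n))"
    by (simp flip: rGamma_complex_of_real)
  moreover have "rGamma (1 + complex_of_real \<mu> + of_real \<nu> + of_nat n) = of_real (rGamma (1 + \<mu> + \<nu> + real n))"
    by (simp flip: rGamma_complex_of_real)
  moreover have "complex_of_real c powr of_real \<mu> = of_real (c powr \<mu>)"
    using assms by (simp add: powr_of_real)
  moreover have "c powr (\<mu> + real n) = c ^ n * c powr \<mu>"
    using assms by (simp add: powr_add powr_realpow)
  ultimately show ?thesis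
    by (simp add: residue_difference_def pole_residue_def power_residue_def mult_ac)
qed

text \<open>Logarithmic differentiation of the reciprocal Gamma functions yields digamma values, and that of the power
  the term \<open>ln c\<close>. The hypothesis on \<open>\<nu>\<close> keeps the arguments away from the
  poles.\<close>

lemma residue_difference_derivative_1:
  assumes c: "c > 0" and nu: "\<And>m::nat. m \<ge> 1 \<Longrightarrow> \<nu> \<noteq> - real m"
  shows "(residue_difference c \<nu> n has_field_derivative
     of_real (c ^ Suc n * rGamma (2 + \<nu> + real n) / fact (Suc n) *
        (Digamma (2 + real n) + Digamma (2 + \<nu> + real n) - ln c))) (at 1)"
proof -
  let ?R = "rGamma (2 + \<nu> + real n)"
  have w1: "2 - 1 + of_nat n \<notin> (\<int>\<^sub>\<le>\<^sub>0 :: complex set)"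
    by (auto elim!: nonpos_Ints_cases' simp: complex_eq_iff)
  have w2: "1 + 1 + of_real \<nu> + of_nat n \<notin> (\<int>\<^sub>\<le>\<^sub>0 :: complex set)"
  proof
    assume "1 + 1 + of_real \<nu> + of_nat n \<in> (\<int>\<^sub>\<le>\<^sub>0 :: complex set)"
    then obtain k where "1 + 1 + complex_of_real \<nu> + of_nat n = - of_nat k" by (auto elim!: nonpos_Ints_cases')
    hence "Re (1 + 1 + complex_of_real \<nu> + of_nat n) = Re (- of_nat k)" by simp
    hence "\<nu> = - real (k + n + 2)" by simp
    thus False using nu[of "k + n + 2"] by simp
  qed
  have d1: "((\<lambda>z. rGamma (2 - z + of_nat n)) has_field_derivative
     - (- rGamma (2 - 1 + of_nat n) * Digamma (2 - 1 + of_nat n))) (at (1::complex))"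
  proof -
    have "((\<lambda>z. rGamma (2 - z + of_nat n)) has_field_derivative
       (- rGamma (2 - 1 + of_nat n) * Digamma (2 - 1 + of_nat n)) * (- 1)) (at (1::complex))"
      by (rule DERIV_chain2[where f = rGamma and g = "\<lambda>z. 2 - z + of_nat n",
            OF has_field_derivative_rGamma_no_nonpos_int[OF w1]]) (auto intro!: derivative_eq_intros)
    thus ?thesis by simp
  qed
  have d2: "((\<lambda>z. rGamma (1 + z + of_real \<nu> + of_nat n)) has_field_derivative
     - rGamma (1 + 1 + of_real \<nu> + of_nat n) * Digamma (1 + 1 + of_real \<nu> + of_nat n)) (at (1::complex))"
  proof -
    have "((\<lambda>z. rGamma (1 + z + of_real \<nu> + of_nat n)) has_field_derivative
       (- rGamma (1 + 1 + of_real \<nu> + of_nat n) * Digamma (1 + 1 + of_real \<nu> + of_nat n)) * 1) (at (1::complex))"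
      by (rule DERIV_chain2[where f = rGamma and g = "\<lambda>z. 1 + z + of_real \<nu> + of_nat n",
            OF has_field_derivative_rGamma_no_nonpos_int[OF w2]]) (auto intro!: derivative_eq_intros)
    thus ?thesis by simp
  qed
  have d3: "((\<lambda>z. of_real c powr z) has_field_derivative Ln (of_real c) * of_real c powr 1) (at (1::complex))"
    using has_field_derivative_powr_right[of "of_real c" 1] c by simp
  have d4: "((\<lambda>z. z + of_nat n) has_field_derivative 1) (at (1::complex))"
    by (auto intro!: derivative_eq_intros)
  have n1: "(1::complex) + of_nat n \<noteq> 0" by (metis of_nat_Suc of_nat_neq_0)
  have v1: "rGamma (2 - 1 + of_nat n :: complex) = of_real (1 / fact n)"
    using Gamma_fact[of n, where ?'a = complex] by (simp add: rGamma_inverse_Gamma add.commute inverse_eq_divide)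
  have v2: "rGamma (1 + 1 + complex_of_real \<nu> + of_nat n) = of_real ?R"
    by (simp flip: rGamma_complex_of_real)
  have v3: "Digamma (2 - 1 + of_nat n :: complex) = of_real (Digamma (1 + real n))"
    using Polygamma_of_real[of "1 + real n" 0, where ?'a = complex] by simp
  have v4: "Digamma (1 + 1 + complex_of_real \<nu> + of_nat n) = of_real (Digamma (2 + \<nu> + real n))"
  proof -
    have "2 + \<nu> + real n \<noteq> 0" using nu[of "2 + n"] by auto
    from Polygamma_of_real[OF this, of 0, where ?'a = complex] show ?thesis by simp
  qed
  have v5: "Ln (complex_of_real c) = of_real (ln c)" using c by (rule Ln_of_real)
  have psi: "Digamma (2 + real n) = Digamma (1 + real n) + 1 / (1 + real n)"
    using Digamma_plus1[of "1 + real n"] by (simp add: add_ac)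
  let ?k1 = "complex_of_real (c ^ Suc n * rGamma (2 + \<nu> + real n) / (real n + 1))"
  let ?k2 = "complex_of_real (c ^ n / fact n)"
  have "(residue_difference c \<nu> n has_field_derivative
      (?k1 * - (- rGamma (2 - 1 + of_nat n) * Digamma (2 - 1 + of_nat n))
       - ?k2 * (((Ln (of_real c) * of_real c powr 1 * rGamma (1 + 1 + of_real \<nu> + of_nat n)
                 + - rGamma (1 + 1 + of_real \<nu> + of_nat n) * Digamma (1 + 1 + of_real \<nu> + of_nat n) * of_real c powr 1) * (1 + of_nat n)
           - (of_real c powr 1 * rGamma (1 + 1 + of_real \<nu> + of_nat n)) * 1) / ((1 + of_nat n) * (1 + of_nat n))))) (at 1)"
    unfolding residue_difference_def[abs_def]
    by (rule DERIV_diff[OF DERIV_cmult[OF d1] DERIV_cmult[OF DERIV_divide[OF DERIV_mult[OF d3 d2] d4 n1]]])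
  also have "?k1 * - (- rGamma (2 - 1 + of_nat n) * Digamma (2 - 1 + of_nat n))
       - ?k2 * (((Ln (of_real c) * of_real c powr 1 * rGamma (1 + 1 + of_real \<nu> + of_nat n)
                 + - rGamma (1 + 1 + of_real \<nu> + of_nat n) * Digamma (1 + 1 + of_real \<nu> + of_nat n) * of_real c powr 1) * (1 + of_nat n)
           - (of_real c powr 1 * rGamma (1 + 1 + of_real \<nu> + of_nat n)) * 1) / ((1 + of_nat n) * (1 + of_nat n)))
     = of_real (c ^ Suc n * ?R / (real n + 1) * (1 / fact n * Digamma (1 + real n))
        - c ^ n / fact n * (((ln c * c * ?R + - ?R * Digamma (2 + \<nu> + real n) * c) * (1 + real n) - c * ?R)
            / ((1 + real n) * (1 + real n))))"
    unfolding v1 v2 v3 v4 v5 using c by simp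
  also have "c ^ Suc n * ?R / (real n + 1) * (1 / fact n * Digamma (1 + real n))
        - c ^ n / fact n * (((ln c * c * ?R + - ?R * Digamma (2 + \<nu> + real n) * c) * (1 + real n) - c * ?R)
            / ((1 + real n) * (1 + real n)))
     = c ^ Suc n * ?R / fact (Suc n) * (Digamma (2 + real n) + Digamma (2 + \<nu> + real n) - ln c)"
  proof -
    have "C * c * R / N * (1 / f * D) - C / f * (((l * c * R + - R * E * c) * N - c * R) / (N * N))
        = C * c * R / (N * f) * (D + 1 / N + E - l)" if "N \<noteq> 0" "f \<noteq> 0" for C R N f D l E :: real
      using that by (simp add: field_simps)
    from this[of "1 + real n" "fact n" "c ^ n" ?R "Digamma (1 + real n)" "ln c" "Digamma (2 + \<nu> + real n)"]
    show ?thesis unfolding psi by (simp add: add.commute mult_ac)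
  qed
  finally show ?thesis .
qed

text \<open>At exponent 1 the two residue series agree term by term, so the closed form has the shape 0/0. The
  prefactor behaves like \<open>-1/(\<mu>-1)\<close>; hence the value is minus the derivative of the series of
  differences.\<close>

theorem integral_regular_kernel_1:
  assumes c: "c > 0" and nu: "\<And>m::nat. m \<ge> 1 \<Longrightarrow> \<nu> \<noteq> - real m" and cond: "2 + \<nu> > - 1 / 2"
  shows "(\<lambda>n. - (c ^ Suc n * rGamma (2 + \<nu> + real n) / fact (Suc n) *
              (Digamma (2 + real n) + Digamma (2 + \<nu> + real n) - ln c)))
     sums (LINT y:{0<..}|lborel. regular_kernel c \<nu> 1 y)"
proof -
  let ?S = "ball (1::complex) (1 / 2)" and ?f = "residue_difference c \<nu>"
  have Re_S: "1 / 2 < Re z \<and> Re z < 3 / 2" if "z \<in> ?S" for z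
  proof -
    have "\<bar>Re (1 - z)\<bar> \<le> norm (1 - z)" by (rule abs_Re_le_cmod)
    thus ?thesis using that by (auto simp: dist_norm)
  qed
  have hol: "?f n holomorphic_on ?S" for n
    unfolding residue_difference_def[abs_def]
  proof (intro holomorphic_intros)
    fix z assume "z \<in> ?S"
    thus "z + of_nat n \<noteq> 0" using Re_S[of z] by (auto simp: complex_eq_iff)
  qed
  \<comment> \<open>From this index on the reciprocal Gamma function decreases under shifts, uniformly on the disc.\<close>
  define N where "N = nat \<lceil>\<bar>\<nu>\<bar>\<rceil>"
  have bdd: "\<exists>B\<ge>0. \<forall>z\<in>?S. norm (g z) \<le> B" if g: "continuous_on (cball 1 (1 / 2)) g" for g :: "complex \<Rightarrow> complex"
  proof -
    have "bounded (g ` cball 1 (1 / 2))"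
      by (intro compact_imp_bounded compact_continuous_image g compact_cball)
    then obtain B where "\<forall>z\<in>cball 1 (1 / 2). norm (g z) \<le> B" by (auto simp: bounded_iff)
    thus ?thesis by (intro exI[of _ "max B 0"]) (auto simp: le_max_iff_disj)
  qed
  have cont1: "continuous_on (cball 1 (1 / 2)) (\<lambda>z::complex. rGamma (2 - z))"
    by (intro holomorphic_on_imp_continuous_on holomorphic_intros)
  obtain B1 where B1: "B1 \<ge> 0" "\<And>z. z \<in> ?S \<Longrightarrow> norm (rGamma (2 - z)) \<le> B1"
    using bdd[OF cont1] by blast
  have cont2: "continuous_on (cball 1 (1 / 2)) (\<lambda>z::complex. rGamma (1 + z + of_real \<nu> + of_nat N))"
    by (intro holomorphic_on_imp_continuous_on holomorphic_intros)
  obtain B2 where B2: "B2 \<ge> 0" "\<And>z. z \<in> ?S \<Longrightarrow> norm (rGamma (1 + z + of_real \<nu> + of_nat N)) \<le> B2"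
    using bdd[OF cont2] by blast
  have cont3: "continuous_on (cball 1 (1 / 2)) (\<lambda>z::complex. of_real c powr z)"
    by (intro holomorphic_on_imp_continuous_on holomorphic_intros) (use c in auto)
  obtain B3 where B3: "B3 \<ge> 0" "\<And>z. z \<in> ?S \<Longrightarrow> norm (of_real c powr z) \<le> B3"
    using bdd[OF cont3] by blast
  define h where "h n = c * B1 * norm (clifford_coeff (\<nu> + 1) n * (2 * c) ^ n) + B3 * B2 * 2 * (c ^ n / fact n)" for n
  have hsum: "summable h"
  proof -
    have "summable (\<lambda>n. norm (clifford_coeff (\<nu> + 1) n * (2 * c) ^ n))"
      using summable_norm_clifford[of "\<nu> + 1" "2 * c"] by simp
    moreover have "summable (\<lambda>n. c ^ n / fact n)"
      using sums_summable[OF exp_converges[of c]] by (simp add: divide_inverse mult.commute)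
    ultimately show ?thesis unfolding h_def by (intro summable_add summable_mult)
  qed
  have hb: "norm (?f n z) \<le> h n" if n: "n \<ge> N" and z: "z \<in> ?S" for n z
  proof -
    have "norm (rGamma (2 - z + of_nat n)) \<le> norm (rGamma (2 - z)) * 2 ^ n / fact n"
      by (rule norm_rGamma_shift_decay) (use Re_S[OF z] in simp)
    also have "\<dots> \<le> B1 * 2 ^ n / fact n" by (intro divide_right_mono mult_right_mono B1 z) auto
    finally have r1: "norm (rGamma (2 - z + of_nat n)) \<le> B1 * 2 ^ n / fact n" .
    have "norm (of_real (c ^ Suc n * rGamma (2 + \<nu> + real n) / (real n + 1)) * rGamma (2 - z + of_nat n))
        = c ^ Suc n * \<bar>rGamma (2 + \<nu> + real n)\<bar> / (real n + 1) * norm (rGamma (2 - z + of_nat n))"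
      unfolding norm_mult norm_of_real using c by (simp add: abs_mult)
    also have "\<dots> \<le> c ^ Suc n * \<bar>rGamma (2 + \<nu> + real n)\<bar> / 1 * (B1 * 2 ^ n / fact n)"
      using c B1(1) by (intro mult_mono frac_le r1) auto
    also have "\<dots> = c * B1 * norm (clifford_coeff (\<nu> + 1) n * (2 * c) ^ n)"
      using c by (simp add: clifford_coeff_def abs_mult power_mult_distrib add_ac)
    finally have t1: "norm (of_real (c ^ Suc n * rGamma (2 + \<nu> + real n) / (real n + 1)) * rGamma (2 - z + of_nat n))
        \<le> c * B1 * norm (clifford_coeff (\<nu> + 1) n * (2 * c) ^ n)" .
    have "norm (rGamma ((1 + z + of_real \<nu> + of_nat N) + of_nat (n - N))) \<le> norm (rGamma (1 + z + of_real \<nu> + of_nat N))"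
    proof (rule norm_rGamma_shift_mono)
      have "real N \<ge> \<bar>\<nu>\<bar>" by (simp add: N_def)
      thus "Re (1 + z + of_real \<nu> + of_nat N) \<ge> 1" using Re_S[OF z] by simp
    qed
    also have "\<dots> \<le> B2" by (rule B2(2)[OF z])
    also have "(1 + z + of_real \<nu> + of_nat N) + of_nat (n - N) = 1 + z + of_real \<nu> + of_nat n"
      using n by (simp add: of_nat_diff)
    finally have r2: "norm (rGamma (1 + z + of_real \<nu> + of_nat n)) \<le> B2" .
    have "1 / 2 \<le> Re (z + of_nat n)" using Re_S[OF z] by simp
    also have "\<dots> \<le> norm (z + of_nat n)" by (rule complex_Re_le_cmod)
    finally have zn: "1 / 2 \<le> norm (z + of_nat n)" .
    have "norm (of_real (c ^ n / fact n) * (of_real c powr z * rGamma (1 + z + of_real \<nu> + of_nat n) / (z + of_nat n)))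
        = c ^ n / fact n * (norm (of_real c powr z) * norm (rGamma (1 + z + of_real \<nu> + of_nat n)) / norm (z + of_nat n))"
      unfolding norm_mult norm_of_real norm_divide using c by simp
    also have "\<dots> \<le> c ^ n / fact n * (B3 * B2 / (1 / 2))"
      using c zn B2(1) B3(1) by (intro mult_left_mono frac_le mult_mono r2 B3(2)[OF z]) auto
    also have "\<dots> = B3 * B2 * 2 * (c ^ n / fact n)" by simp
    finally have t2: "norm (of_real (c ^ n / fact n) * (of_real c powr z * rGamma (1 + z + of_real \<nu> + of_nat n) / (z + of_nat n)))
        \<le> B3 * B2 * 2 * (c ^ n / fact n)" .
    show ?thesis unfolding residue_difference_def h_def
      by (rule order_trans[OF norm_triangle_ineq4 add_mono[OF t1 t2]])
  qed
  obtain g g' where gg: "\<forall>z\<in>?S. (\<lambda>n. ?f n z) sums g z \<and> (\<lambda>n. deriv (?f n) z) sums g' z \<and> (g has_field_derivative g' z) (at z)"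
  proof (rule series_and_derivative_comparison[OF open_ball hsum])
    show "(?f n has_field_derivative deriv (?f n) z) (at z)" if "z \<in> ?S" for n z
      using holomorphic_derivI[OF hol open_ball that] .
    show "\<forall>\<^sub>F n in sequentially. \<forall>z\<in>?S. norm (?f n z) \<le> h n"
      using eventually_ge_at_top[of N] by eventually_elim (use hb in auto)
  qed
  let ?d = "\<lambda>n. c ^ Suc n * rGamma (2 + \<nu> + real n) / fact (Suc n) * (Digamma (2 + real n) + Digamma (2 + \<nu> + real n) - ln c)"
  have dv: "deriv (?f n) 1 = of_real (?d n)" for n
    by (rule DERIV_imp_deriv, rule residue_difference_derivative_1[OF c nu])
  have one: "(1::complex) \<in> ?S" by simp
  with gg have "(\<lambda>n. deriv (?f n) 1) sums g' 1" by blast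
  hence d: "(\<lambda>n. complex_of_real (?d n)) sums g' 1" unfolding dv .
  have f1: "?f n 1 = 0" for n
  proof -
    have "pole_residue c \<nu> 1 n = power_residue c \<nu> 1 n"
    proof -
      have "rGamma (1 + real n) = 1 / fact n"
        using Gamma_fact[of n, where ?'a = real] by (simp add: rGamma_inverse_Gamma inverse_eq_divide)
      thus ?thesis using c by (simp add: pole_residue_def power_residue_def powr_add powr_realpow add.commute mult_ac)
    qed
    thus ?thesis using residue_difference_of_real[OF c, of 1 \<nu> n] by simp
  qed
  have "(\<lambda>n. ?f n 1) sums g 1" using gg one by blast
  hence g1: "g 1 = 0" unfolding f1 using sums_unique2[OF sums_zero] by metis
  let ?m = "\<lambda>i. 1 + 1 / (real i + 3)"
  let ?L = "LINT y:{0<..}|lborel. regular_kernel c \<nu> 1 y"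
  have m: "?m i > 0" "?m i \<notin> \<int>" "of_real (?m i) \<in> ?S" "2 * ?m i + \<nu> > - 1 / 2" for i
  proof -
    have b: "0 < 1 / (real i + 3)" "1 / (real i + 3) \<le> 1 / 3" by (auto simp: field_simps)
    show "?m i > 0" using b by linarith
    show "?m i \<notin> \<int>"
    proof
      assume "?m i \<in> \<int>"
      then obtain k where "?m i = of_int k" by (elim Ints_cases)
      hence "1 < real_of_int k" "real_of_int k < 2" using b by linarith+
      hence "1 < k" "k < 2" by simp_all
      thus False by simp
    qed
    have "2 * (1 + e) + \<nu> > - 1 / 2" if "e > 0" for e
    proof -
      have "2 * (1 + e) + \<nu> = (2 + \<nu>) + 2 * e" by simp
      moreover have "0 < 2 * e" using that by simp
      ultimately show ?thesis using cond by linarith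
    qed
    from this[OF b(1)] show "2 * ?m i + \<nu> > - 1 / 2" .
    have "dist 1 (complex_of_real (?m i)) = norm (complex_of_real (1 / (real i + 3)))"
      by (simp add: dist_norm)
    also have "\<dots> = 1 / (real i + 3)" unfolding norm_of_real by simp
    finally show "complex_of_real (?m i) \<in> ?S" using b by simp
  qed
  \<comment> \<open>The closed form is a difference quotient of the sum \<open>g\<close> at 1, times a factor with limit \<open>-1\<close>.\<close>
  have val: "(LINT y:{0<..}|lborel. regular_kernel c \<nu> (?m i) y)
      = (pi * (1 / (real i + 3)) / sin (pi * ?m i)) * rGamma (?m i)
        * Re ((g (of_real (?m i)) - g 1) / (of_real (?m i) - 1))" for i
  proof -
    obtain S1 S2 where S: "pole_residue c \<nu> (?m i) sums S1" "power_residue c \<nu> (?m i) sums S2"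
      and I: "(LINT y:{0<..}|lborel. regular_kernel c \<nu> (?m i) y) = pi * rGamma (?m i) / sin (pi * ?m i) * (S1 - S2)"
      by (rule integral_regular_kernel_closed_form[OF c m(1,2,4)])
    have "(\<lambda>n. ?f n (of_real (?m i))) sums of_real (S1 - S2)"
      unfolding residue_difference_of_real[OF c m(1)] by (intro sums_of_real sums_diff S)
    moreover have "(\<lambda>n. ?f n (of_real (?m i))) sums g (of_real (?m i))" using gg m(3)[of i] by blast
    ultimately have "g (of_real (?m i)) = of_real (S1 - S2)" by (rule sums_unique2[symmetric])
    moreover have "complex_of_real (?m i) - 1 = of_real (1 / (real i + 3))" by simp
    ultimately have "Re ((g (of_real (?m i)) - g 1) / (of_real (?m i) - 1)) = (S1 - S2) / (1 / (real i + 3))"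
      unfolding g1 by (simp only: diff_zero of_real_divide[symmetric] Re_complex_of_real)
    thus ?thesis unfolding I by simp
  qed
  have top: "filterlim (\<lambda>i. complex_of_real (?m i)) (at 1) sequentially"
    unfolding filterlim_at
  proof
    have "?m \<longlonglongrightarrow> 1" by real_asymp
    from tendsto_of_real[OF this, where ?'a = complex]
    show "(\<lambda>i. complex_of_real (?m i)) \<longlonglongrightarrow> 1" by (simp only: of_real_1)
    have "complex_of_real (?m i) \<noteq> 1" for i
    proof -
      have "?m i \<noteq> 1" by (simp add: add_nonneg_eq_0_iff)
      thus ?thesis by (metis of_real_1 of_real_eq_iff)
    qed
    thus "\<forall>\<^sub>F i in sequentially. complex_of_real (?m i) \<in> UNIV \<and> complex_of_real (?m i) \<noteq> 1" by simp
  qed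
  have "(g has_field_derivative g' 1) (at 1)" using gg one by blast
  hence "((\<lambda>z. (g z - g 1) / (z - 1)) \<longlongrightarrow> g' 1) (at 1)" by (simp add: has_field_derivative_iff)
  from tendsto_Re[OF filterlim_compose[OF this top]]
  have l1: "(\<lambda>i. Re ((g (of_real (?m i)) - g 1) / (of_real (?m i) - 1))) \<longlonglongrightarrow> Re (g' 1)" .
  have l2: "(\<lambda>i. rGamma (?m i)) \<longlonglongrightarrow> rGamma 1"
  proof (rule isCont_tendsto_compose[where g = rGamma and f = ?m])
    show "isCont rGamma (1::real)" by (intro continuous_intros)
    show "?m \<longlonglongrightarrow> 1" by real_asymp
  qed
  have l3: "(\<lambda>i. pi * (1 / (real i + 3)) / sin (pi * ?m i)) \<longlonglongrightarrow> -1"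
  proof -
    have "sin (pi * ?m i) = - sin (pi * (1 / (real i + 3)))" for i
      by (simp add: distrib_left sin_add)
    moreover have "(\<lambda>i. pi * (1 / (real i + 3)) / - sin (pi * (1 / (real i + 3)))) \<longlonglongrightarrow> -1"
      by real_asymp
    ultimately show ?thesis by (simp only:)
  qed
  have "(\<lambda>i. LINT y:{0<..}|lborel. regular_kernel c \<nu> (?m i) y) \<longlonglongrightarrow> -1 * rGamma 1 * Re (g' 1)"
    unfolding val by (intro tendsto_mult l1 l2 l3)
  hence "?L = -1 * rGamma 1 * Re (g' 1)"
    using LIMSEQ_unique tendsto_integral_regular_kernel_1[OF c cond] by blast
  hence L: "?L = - Re (g' 1)" by simp
  have "?d sums Re (g' 1)" using sums_Re[OF d] unfolding Re_complex_of_real .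
  thus ?thesis unfolding L by (rule sums_minus)
qed

section \<open>Decay of the summand and of its derivatives\<close>

text \<open>A neighbourhood of the real axis in which \<open>1 + z\<^sup>2\<close> avoids the cut of the complex
  power. Working with holomorphic functions makes all higher derivatives available.\<close>

definition unit_strip :: "complex set" where
  "unit_strip = {z. \<bar>Im z\<bar> < 1}"

lemma open_unit_strip: "open unit_strip"
proof -
  have "unit_strip = {z. Im z < 1} \<inter> {z. Im z > -1}" by (auto simp: unit_strip_def)
  moreover have "open ({z. Im z < 1} \<inter> {z. Im z > -1})"
    by (intro open_Int open_halfspace_Im_lt open_halfspace_Im_gt)
  ultimately show ?thesis by simp
qed

lemma of_real_in_unit_strip [simp]: "of_real t \<in> unit_strip"
  by (simp add: unit_strip_def)

definition decays_upto :: "nat \<Rightarrow> real \<Rightarrow> (complex \<Rightarrow> complex) \<Rightarrow> bool" where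
  "decays_upto m \<sigma> f \<longleftrightarrow> (\<forall>i\<le>m. (\<lambda>t. (deriv ^^ i) f (of_real t)) \<in> O[at_top](\<lambda>t::real. of_real (t powr \<sigma>)))"

lemma powr_bigo_at_top:
  assumes "\<sigma> \<le> \<tau>"
  shows "(\<lambda>t::real. of_real (t powr \<sigma>) :: complex) \<in> O[at_top](\<lambda>t. of_real (t powr \<tau>))"
proof (rule bigoI[of _ 1])
  show "\<forall>\<^sub>F t in at_top. norm (complex_of_real (t powr \<sigma>)) \<le> 1 * norm (complex_of_real (t powr \<tau>))"
    using eventually_ge_at_top[of 1] by eventually_elim (use assms in \<open>auto intro: powr_mono\<close>)
qed

lemma decays_upto_mono: "decays_upto m \<sigma> f \<Longrightarrow> \<sigma> \<le> \<tau> \<Longrightarrow> decays_upto m \<tau> f"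
  unfolding decays_upto_def by (blast intro: landau_o.big_trans[OF _ powr_bigo_at_top])

text \<open>Leibniz's rule.\<close>

lemma decays_upto_mult:
  assumes f: "decays_upto m \<sigma> f" "f holomorphic_on S" and g: "decays_upto m \<tau> g" "g holomorphic_on S"
    and S: "open S" "\<forall>\<^sub>F t in at_top. complex_of_real t \<in> S"
  shows "decays_upto m (\<sigma> + \<tau>) (\<lambda>z. f z * g z)"
  unfolding decays_upto_def
proof (intro allI impI)
  fix i assume i: "i \<le> m"
  have "(\<lambda>t. \<Sum>j=0..i. of_nat (i choose j) * (deriv ^^ j) f (of_real t) * (deriv ^^ (i - j)) g (of_real t))
      \<in> O[at_top](\<lambda>t::real. of_real (t powr (\<sigma> + \<tau>)))"
  proof (rule big_sum_in_bigo)
    fix j assume j: "j \<in> {0..i}"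
    have "(\<lambda>t. (deriv ^^ j) f (of_real t)) \<in> O[at_top](\<lambda>t::real. of_real (t powr \<sigma>))"
      "(\<lambda>t. (deriv ^^ (i - j)) g (of_real t)) \<in> O[at_top](\<lambda>t::real. of_real (t powr \<tau>))"
      using f(1) g(1) i j by (auto simp: decays_upto_def)
    from landau_o.big.mult[OF this]
    have p: "(\<lambda>t. (deriv ^^ j) f (of_real t) * (deriv ^^ (i - j)) g (of_real t)) \<in> O[at_top](\<lambda>t::real. of_real (t powr (\<sigma> + \<tau>)))"
      by (simp add: powr_add)
    thus "(\<lambda>t. of_nat (i choose j) * (deriv ^^ j) f (of_real t) * (deriv ^^ (i - j)) g (of_real t))
      \<in> O[at_top](\<lambda>t::real. of_real (t powr (\<sigma> + \<tau>)))"
      using landau_o.big.mult[OF bigo_const[of "of_nat (i choose j)"] p] by (simp add: mult.assoc)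
  qed
  thus "(\<lambda>t. (deriv ^^ i) (\<lambda>z. f z * g z) (of_real t)) \<in> O[at_top](\<lambda>t::real. of_real (t powr (\<sigma> + \<tau>)))"
  proof (rule landau_o.big.in_cong[THEN iffD2, rotated])
    show "\<forall>\<^sub>F t in at_top. (deriv ^^ i) (\<lambda>z. f z * g z) (of_real t) =
       (\<Sum>j=0..i. of_nat (i choose j) * (deriv ^^ j) f (of_real t) * (deriv ^^ (i - j)) g (of_real t))"
      using S(2) by eventually_elim (rule higher_deriv_mult[OF f(2) g(2) S(1)])
  qed
qed

lemma decays_upto_ident: "decays_upto m 1 (\<lambda>z. z)"
  unfolding decays_upto_def
proof (intro allI impI)
  fix i
  have "(\<lambda>t::real. of_real (t powr 0) :: complex) \<in> O[at_top](\<lambda>t. of_real (t powr 1))"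
    by (rule powr_bigo_at_top) simp
  moreover have "(\<lambda>t::real. 1 :: complex) \<in> O[at_top](\<lambda>t. of_real (t powr 0))"
    by (rule bigoI[of _ 1]) (use eventually_gt_at_top[of 0] in \<open>eventually_elim, simp\<close>)
  ultimately have 1: "(\<lambda>t::real. 1 :: complex) \<in> O[at_top](\<lambda>t. of_real (t powr 1))"
    by (rule landau_o.big_trans[rotated])
  have 2: "(\<lambda>t::real. complex_of_real t) \<in> O[at_top](\<lambda>t. of_real (t powr 1))"
    by (rule bigoI[of _ 1]) (use eventually_gt_at_top[of 0] in \<open>eventually_elim, simp\<close>)
  have "(\<lambda>t. (deriv ^^ i) (\<lambda>z. z) (complex_of_real t)) = (if i = 0 then of_real else if i = 1 then (\<lambda>_. 1) else (\<lambda>_. 0))"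
    by (auto simp: fun_eq_iff)
  thus "(\<lambda>t. (deriv ^^ i) (\<lambda>z. z) (complex_of_real t)) \<in> O[at_top](\<lambda>t::real. complex_of_real (t powr 1))"
    using 1 2 by (simp only: split: if_split) simp
qed

text \<open>If differentiation multiplies by \<open>z\<close> and raises the parameter, and raising the parameter
  gains the factor \<open>1/z\<close> back, then every derivative has the order of the function itself. For the
  oscillating Bessel factor nothing better is true.\<close>

lemma decays_upto_ladder:
  fixes f :: "real \<Rightarrow> complex \<Rightarrow> complex"
  assumes S: "open S" "\<forall>\<^sub>F t in at_top. complex_of_real t \<in> S"
    and hol: "\<And>x. f x holomorphic_on S"
    and der: "\<And>x z. z \<in> S \<Longrightarrow> deriv (f x) z = c x * (z * f (x + 1) z)"
    and base: "\<And>x. (\<lambda>t. f x (of_real t)) \<in> O[at_top](\<lambda>t::real. of_real (t powr \<sigma> x))"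
    and step: "\<And>x. \<sigma> (x + 1) + 1 \<le> \<sigma> x"
  shows "decays_upto m (\<sigma> x) (f x)"
proof (induction m arbitrary: x)
  case 0
  show ?case using base by (simp add: decays_upto_def)
next
  case (Suc m)
  have "decays_upto m (1 + \<sigma> (x + 1)) (\<lambda>z. z * f (x + 1) z)"
    by (rule decays_upto_mult[OF decays_upto_ident _ Suc.IH hol S]) (intro holomorphic_intros)
  hence "decays_upto m (\<sigma> x) (\<lambda>z. z * f (x + 1) z)"
    by (rule decays_upto_mono) (use step[of x] in simp)
  hence d: "(\<lambda>t. (deriv ^^ i) (\<lambda>z. z * f (x + 1) z) (of_real t)) \<in> O[at_top](\<lambda>t::real. of_real (t powr \<sigma> x))" if "i \<le> m" for i
    using that by (simp add: decays_upto_def)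
  show ?case unfolding decays_upto_def
  proof (intro allI impI)
    fix i assume i: "i \<le> Suc m"
    show "(\<lambda>t. (deriv ^^ i) (f x) (of_real t)) \<in> O[at_top](\<lambda>t::real. of_real (t powr \<sigma> x))"
    proof (cases i)
      case 0
      thus ?thesis using base by simp
    next
      case (Suc j)
      have hz: "(\<lambda>z. z * f (x + 1) z) holomorphic_on S" by (intro holomorphic_intros hol)
      have "(\<lambda>t. c x * (deriv ^^ j) (\<lambda>z. z * f (x + 1) z) (of_real t)) \<in> O[at_top](\<lambda>t::real. of_real (t powr \<sigma> x))"
        using landau_o.big.mult[OF bigo_const[of "c x"] d[of j]] i Suc by simp
      thus ?thesis
      proof (rule landau_o.big.in_cong[THEN iffD2, rotated])
        show "\<forall>\<^sub>F t in at_top. (deriv ^^ i) (f x) (of_real t) = c x * (deriv ^^ j) (\<lambda>z. z * f (x + 1) z) (of_real t)"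
          using S(2)
        proof eventually_elim
          case (elim t)
          have "(deriv ^^ i) (f x) (of_real t) = (deriv ^^ j) (deriv (f x)) (of_real t)"
            unfolding Suc funpow_Suc_right o_def ..
          also have "\<dots> = (deriv ^^ j) (\<lambda>z. c x * (z * f (x + 1) z)) (of_real t)"
            by (rule higher_deriv_transform_within_open[OF _ _ S(1) elim])
               (auto intro!: holomorphic_intros holomorphic_deriv hol hz S(1) simp: der)
          also have "\<dots> = c x * (deriv ^^ j) (\<lambda>z. z * f (x + 1) z) (of_real t)"
            by (rule higher_deriv_cmult[OF hz elim S(1)])
          finally show ?case .
        qed
      qed
    qed
  qed
qed

definition clifford_sq :: "real \<Rightarrow> real \<Rightarrow> complex \<Rightarrow> complex" where
  "clifford_sq c \<nu> z = clifford \<nu> (of_real c * z ^ 2)"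

definition lorentz_power :: "real \<Rightarrow> complex \<Rightarrow> complex" where
  "lorentz_power \<mu> z = (1 + z ^ 2) powr (- of_real \<mu>)"

lemma clifford_sq_deriv:
  "(clifford_sq c \<nu> has_field_derivative of_real (- 2 * c) * (z * clifford_sq c (\<nu> + 1) z)) (at z)"
  unfolding clifford_sq_def[abs_def] by (auto intro!: derivative_eq_intros)

lemma strip_square_slit:
  assumes "z \<in> unit_strip"
  shows "1 + z ^ 2 \<notin> \<real>\<^sub>\<le>\<^sub>0"
proof
  assume "1 + z ^ 2 \<in> \<real>\<^sub>\<le>\<^sub>0"
  hence re: "1 + (Re z)\<^sup>2 - (Im z)\<^sup>2 \<le> 0" and im: "Re z * Im z = 0"
    by (auto simp: complex_nonpos_Reals_iff power2_eq_square)
  have "(Im z)\<^sup>2 < 1" using assms by (simp add: unit_strip_def abs_square_less_1)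
  moreover have "(Re z)\<^sup>2 \<ge> 0" by simp
  ultimately show False using re by linarith
qed

lemma lorentz_power_deriv:
  assumes "z \<in> unit_strip"
  shows "(lorentz_power \<mu> has_field_derivative of_real (- 2 * \<mu>) * (z * lorentz_power (\<mu> + 1) z)) (at z)"
proof -
  have "((\<lambda>z. 1 + z ^ 2) has_field_derivative 2 * z) (at z)"
    by (auto intro!: derivative_eq_intros)
  from DERIV_chain2[OF has_field_derivative_powr[OF strip_square_slit[OF assms], of "- of_real \<mu>"] this]
  show ?thesis
  proof -
    have "- complex_of_real (\<mu> + 1) = - of_real \<mu> - 1" by simp
    thus ?thesis using \<open>((\<lambda>z. (1 + z\<^sup>2) powr - complex_of_real \<mu>) has_field_derivative _) (at z)\<close>
      unfolding lorentz_power_def[abs_def] by (simp only:) (simp add: mult_ac)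
  qed
qed

lemma holomorphic_clifford_sq: "clifford_sq c \<nu> holomorphic_on S"
  unfolding holomorphic_on_def field_differentiable_def
  using has_field_derivative_at_within[OF clifford_sq_deriv] by blast

lemma holomorphic_lorentz_power: "lorentz_power \<mu> holomorphic_on unit_strip"
  unfolding holomorphic_on_def field_differentiable_def
  using has_field_derivative_at_within[OF lorentz_power_deriv] by blast

lemma eventually_of_real_in_strip: "\<forall>\<^sub>F t in at_top. complex_of_real t \<in> unit_strip"
  by simp

lemma decays_clifford_sq:
  assumes c: "c > 0"
  shows "decays_upto m (- \<nu> - 1 / 2) (clifford_sq c \<nu>)"
proof (rule decays_upto_ladder[where S = unit_strip and f = "clifford_sq c" and c = "\<lambda>_. of_real (- 2 * c)" and \<sigma> = "\<lambda>\<nu>. - \<nu> - 1 / 2"])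
  show "deriv (clifford_sq c \<nu>) z = of_real (- 2 * c) * (z * clifford_sq c (\<nu> + 1) z)" for \<nu> z
    by (rule DERIV_imp_deriv[OF clifford_sq_deriv])
  fix \<nu>
  obtain C where C: "C > 0" "\<And>x::real. x \<ge> c \<Longrightarrow> \<bar>clifford \<nu> x\<bar> \<le> C * x powr (- \<nu> / 2 - 1 / 4)"
    using clifford_bound[OF c] by blast
  show "(\<lambda>t. clifford_sq c \<nu> (of_real t)) \<in> O[at_top](\<lambda>t::real. of_real (t powr (- \<nu> - 1 / 2)))"
  proof (rule bigoI[of _ "C * c powr (- \<nu> / 2 - 1 / 4)"])
    show "\<forall>\<^sub>F t in at_top. norm (clifford_sq c \<nu> (complex_of_real t))
        \<le> C * c powr (- \<nu> / 2 - 1 / 4) * norm (complex_of_real (t powr (- \<nu> - 1 / 2)))"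
      using eventually_ge_at_top[of 1]
    proof eventually_elim
      case (elim t)
      have "clifford_sq c \<nu> (complex_of_real t) = of_real (clifford \<nu> (c * t\<^sup>2))"
        by (simp add: clifford_sq_def flip: clifford_of_real)
      hence "norm (clifford_sq c \<nu> (complex_of_real t)) = \<bar>clifford \<nu> (c * t\<^sup>2)\<bar>" by simp
      also have "\<dots> \<le> C * (c * t\<^sup>2) powr (- \<nu> / 2 - 1 / 4)"
        using C(2)[of "c * t\<^sup>2"] elim c by simp
      also have "(c * t\<^sup>2) powr (- \<nu> / 2 - 1 / 4) = c powr (- \<nu> / 2 - 1 / 4) * t powr (- \<nu> - 1 / 2)"
      proof -
        have "t\<^sup>2 = t powr 2" using elim by simp
        hence "(t\<^sup>2) powr (- \<nu> / 2 - 1 / 4) = t powr (2 * (- \<nu> / 2 - 1 / 4))" by (simp only: powr_powr)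
        also have "2 * (- \<nu> / 2 - 1 / 4) = - \<nu> - 1 / 2" by simp
        finally show ?thesis using elim c by (simp only: powr_mult)
      qed
      finally show ?case by simp
    qed
  qed
qed (simp_all add: open_unit_strip holomorphic_clifford_sq)

lemma decays_lorentz_power: "decays_upto m (- 2 * \<mu>) (lorentz_power \<mu>)"
proof (rule decays_upto_ladder[where S = unit_strip and f = lorentz_power and c = "\<lambda>\<mu>. of_real (- 2 * \<mu>)" and \<sigma> = "\<lambda>\<mu>. - 2 * \<mu>"])
  show "deriv (lorentz_power \<mu>) z = of_real (- 2 * \<mu>) * (z * lorentz_power (\<mu> + 1) z)" if "z \<in> unit_strip" for \<mu> z
    by (rule DERIV_imp_deriv[OF lorentz_power_deriv[OF that]])
  fix \<mu>
  show "(\<lambda>t. lorentz_power \<mu> (of_real t)) \<in> O[at_top](\<lambda>t::real. of_real (t powr (- 2 * \<mu>)))"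
  proof (rule bigoI[of _ "max 1 (2 powr (- \<mu>))"])
    show "\<forall>\<^sub>F t in at_top. norm (lorentz_power \<mu> (complex_of_real t))
        \<le> max 1 (2 powr (- \<mu>)) * norm (complex_of_real (t powr (- 2 * \<mu>)))"
      using eventually_ge_at_top[of 1]
    proof eventually_elim
      case (elim t)
      have "1 + (complex_of_real t)\<^sup>2 = of_real (1 + t\<^sup>2)" by simp
      hence "lorentz_power \<mu> (complex_of_real t) = of_real (1 + t\<^sup>2) powr of_real (- \<mu>)"
        by (simp add: lorentz_power_def)
      also have "\<dots> = of_real ((1 + t\<^sup>2) powr (- \<mu>))" by (rule powr_of_real) simp
      finally have "norm (lorentz_power \<mu> (complex_of_real t)) = (1 + t\<^sup>2) powr (- \<mu>)" by simp
      also have "\<dots> \<le> max 1 (2 powr (- \<mu>)) * (t\<^sup>2) powr (- \<mu>)"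
      proof (cases "\<mu> \<ge> 0")
        case True
        have "(1 + t\<^sup>2) powr (- \<mu>) \<le> 1 * (t\<^sup>2) powr (- \<mu>)"
          using True elim by (simp, intro powr_mono2') auto
        also have "\<dots> \<le> max 1 (2 powr (- \<mu>)) * (t\<^sup>2) powr (- \<mu>)" by (intro mult_right_mono) auto
        finally show ?thesis .
      next
        case False
        have "1 \<le> t\<^sup>2" using elim by simp
        hence "(1 + t\<^sup>2) powr (- \<mu>) \<le> (2 * t\<^sup>2) powr (- \<mu>)"
          using False by (intro powr_mono2) auto
        also have "\<dots> = 2 powr (- \<mu>) * (t\<^sup>2) powr (- \<mu>)" by (simp add: powr_mult)
        also have "\<dots> \<le> max 1 (2 powr (- \<mu>)) * (t\<^sup>2) powr (- \<mu>)" by (intro mult_right_mono) auto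
        finally show ?thesis .
      qed
      also have "(t\<^sup>2) powr (- \<mu>) = t powr (- 2 * \<mu>)"
      proof -
        have "t\<^sup>2 = t powr 2" using elim by simp
        thus ?thesis by (simp only: powr_powr) simp
      qed
      finally show ?case by simp
    qed
  qed
qed (simp_all add: open_unit_strip holomorphic_lorentz_power)

text \<open>The part of the strip on which the powers of \<open>z\<close> are holomorphic as well.\<close>

definition half_strip :: "complex set" where
  "half_strip = unit_strip \<inter> {z. Re z > 0}"

lemma half_strip:
  "open half_strip" "\<forall>\<^sub>F t in at_top. complex_of_real t \<in> half_strip" "half_strip \<subseteq> unit_strip"
  "0 \<notin> half_strip" "z \<in> half_strip \<Longrightarrow> z \<notin> \<real>\<^sub>\<le>\<^sub>0"
  using open_Int[OF open_unit_strip open_halfspace_Re_gt[of 0]] eventually_gt_at_top[of "0::real"]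
  by (auto simp: half_strip_def elim!: eventually_mono simp: complex_nonpos_Reals_iff)

text \<open>A ladder in the exponent: the derivative of \<open>z powr (-2x)\<close> is a multiple of \<open>z \<cdot>
  z powr (-2(x+1))\<close>.\<close>

lemma decays_powr: "decays_upto m (- 2 * x) (\<lambda>z. z powr of_real (- 2 * x))"
proof (rule decays_upto_ladder[where S = half_strip and f = "\<lambda>x z. z powr of_real (- 2 * x)" and c = "\<lambda>x. of_real (- 2 * x)" and \<sigma> = "\<lambda>x. - 2 * x"])
  show "(\<lambda>z. z powr of_real (- 2 * x)) holomorphic_on half_strip" for x
    by (intro holomorphic_intros) (use half_strip in auto)
  show "deriv (\<lambda>z. z powr of_real (- 2 * x)) z = of_real (- 2 * x) * (z * z powr of_real (- 2 * (x + 1)))"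
    if "z \<in> half_strip" for x z
  proof -
    have z0: "z \<noteq> 0" using that half_strip(4) by auto
    have "deriv (\<lambda>z. z powr of_real (- 2 * x)) z = of_real (- 2 * x) * z powr (of_real (- 2 * x) - 1)"
      by (rule DERIV_imp_deriv[OF has_field_derivative_powr[OF half_strip(5)[OF that]]])
    also have "of_real (- 2 * x) - 1 = 1 + complex_of_real (- 2 * (x + 1))" by simp
    also have "z powr (1 + complex_of_real (- 2 * (x + 1))) = z * z powr of_real (- 2 * (x + 1))"
      using z0 by (subst powr_add) simp
    finally show ?thesis .
  qed
  fix x
  show "(\<lambda>t. complex_of_real t powr of_real (- 2 * x)) \<in> O[at_top](\<lambda>t::real. of_real (t powr (- 2 * x)))"
  proof (rule bigoI[of _ 1])
    show "\<forall>\<^sub>F t in at_top. norm (complex_of_real t powr of_real (- 2 * x)) \<le> 1 * norm (complex_of_real (t powr (- 2 * x)))"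
      using eventually_ge_at_top[of 0] by eventually_elim (simp add: powr_of_real del: of_real_mult of_real_minus)
  qed
qed (simp_all add: half_strip)

lemma bigo_cmult_const: "f \<in> O[F](g) \<Longrightarrow> (\<lambda>t. (k::complex) * f t) \<in> O[F](g)"
  using landau_o.big.mult[OF bigo_const[of k]] by fastforce

text \<open>The function \<open>h(t) = C(c t\<^sup>2) (1+t\<^sup>2) powr (-\<mu>)\<close>, whose values at
  \<open>n/a\<close> are summed against \<open>1/n\<close>.\<close>

definition profile :: "real \<Rightarrow> real \<Rightarrow> real \<Rightarrow> complex \<Rightarrow> complex" where
  "profile c \<nu> \<mu> z = clifford_sq c \<nu> z * lorentz_power \<mu> z"

text \<open>The function \<open>q(t) = (h(t) - h(0))/t\<close> with its removable singularity removed. The form with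
  \<open>z - 0\<close> is that of the removable singularity theorem.\<close>

definition profile_quotient :: "real \<Rightarrow> real \<Rightarrow> real \<Rightarrow> complex \<Rightarrow> complex" where
  "profile_quotient c \<nu> \<mu> z =
     (if z = 0 then deriv (profile c \<nu> \<mu>) 0 else (profile c \<nu> \<mu> z - profile c \<nu> \<mu> 0) / (z - 0))"

lemma holomorphic_profile: "profile c \<nu> \<mu> holomorphic_on unit_strip"
  unfolding profile_def[abs_def] by (intro holomorphic_intros holomorphic_clifford_sq holomorphic_lorentz_power)

lemma holomorphic_profile_quotient: "profile_quotient c \<nu> \<mu> holomorphic_on unit_strip"
  unfolding profile_quotient_def[abs_def] by (rule pole_lemma_open[OF holomorphic_profile open_unit_strip])

text \<open>The part \<open>h(z)/z\<close> and its derivatives are smaller than \<open>1/z\<close> by a power, since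
  \<open>h\<close> and its derivatives decay. The part \<open>-h(0)/z\<close> is only \<open>O(1/z)\<close>, but each
  of its derivatives gains a power.\<close>

lemma profile_quotient_decay:
  assumes c: "c > 0" and cond: "- \<nu> - 1 / 2 - 2 * \<mu> < 0"
  obtains \<epsilon> where "\<epsilon> > 0"
    "\<And>i. i \<ge> 1 \<Longrightarrow> (\<lambda>t. (deriv ^^ i) (profile_quotient c \<nu> \<mu>) (of_real t)) \<in> O[at_top](\<lambda>t::real. of_real (t powr (- 1 - \<epsilon>)))"
    "(\<lambda>t. profile_quotient c \<nu> \<mu> (of_real t)) \<in> O[at_top](\<lambda>t::real. of_real (t powr (- 1)))"
proof
  define \<sigma> where "\<sigma> = - \<nu> - 1 / 2 + - 2 * \<mu>"
  \<comment> \<open>Differentiating \<open>h(0)/z\<close> gains one power, and \<open>h\<close> itself contributes \<open>-\<sigma>\<close> powers.\<close>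
  define \<epsilon> where "\<epsilon> = min 1 (- \<sigma>)"
  show "\<epsilon> > 0" using cond by (simp add: \<epsilon>_def \<sigma>_def)
  define u where "u = (\<lambda>z::complex. z powr of_real (- 2 * (1 / 2)))"
  define a where "a = (\<lambda>z. profile c \<nu> \<mu> z * u z)"
  define k where "k = profile c \<nu> \<mu> 0"
  have hu: "u holomorphic_on half_strip"
    unfolding u_def by (intro holomorphic_intros) (use half_strip in auto)
  have hp: "profile c \<nu> \<mu> holomorphic_on half_strip"
    by (rule holomorphic_on_subset[OF holomorphic_profile half_strip(3)])
  have ha: "a holomorphic_on half_strip" unfolding a_def by (intro holomorphic_intros hp hu)
  have hq: "profile_quotient c \<nu> \<mu> holomorphic_on half_strip"
    by (rule holomorphic_on_subset[OF holomorphic_profile_quotient half_strip(3)])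
  have du: "decays_upto m (- 1) u" for m using decays_powr[of m "1 / 2"] by (simp add: u_def)
  have dp: "decays_upto m \<sigma> (profile c \<nu> \<mu>)" for m
    unfolding \<sigma>_def profile_def[abs_def]
    by (rule decays_upto_mult[OF decays_clifford_sq[OF c] holomorphic_clifford_sq decays_lorentz_power
          holomorphic_lorentz_power open_unit_strip eventually_of_real_in_strip])
  have da: "decays_upto m (\<sigma> + - 1) a" for m
    unfolding a_def by (rule decays_upto_mult[OF dp hp du hu half_strip(1,2)])
  have uv: "u z = 1 / z" if "z \<in> half_strip" for z
    using that half_strip(4) by (auto simp: u_def powr_minus_divide)
  have eq: "profile_quotient c \<nu> \<mu> z = a z - k * u z" if "z \<in> half_strip" for z
    using that half_strip(4) uv[OF that] by (auto simp: profile_quotient_def a_def k_def diff_divide_distrib)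
  have eq_deriv: "\<forall>\<^sub>F t in at_top. (deriv ^^ i) (profile_quotient c \<nu> \<mu>) (of_real t)
      = (deriv ^^ i) a (of_real t) - k * (deriv ^^ i) u (of_real t)" for i
    using half_strip(2)
  proof eventually_elim
    case (elim t)
    have hku: "(\<lambda>z. k * u z) holomorphic_on half_strip" by (intro holomorphic_intros hu)
    have "(deriv ^^ i) (profile_quotient c \<nu> \<mu>) (of_real t) = (deriv ^^ i) (\<lambda>z. a z - k * u z) (of_real t)"
      by (rule higher_deriv_transform_within_open[OF hq _ half_strip(1) elim eq]) (intro holomorphic_intros ha hu)
    also have "\<dots> = (deriv ^^ i) a (of_real t) - (deriv ^^ i) (\<lambda>z. k * u z) (of_real t)"
      by (rule higher_deriv_diff[OF ha hku half_strip(1) elim])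
    also have "(deriv ^^ i) (\<lambda>z. k * u z) (of_real t) = k * (deriv ^^ i) u (of_real t)"
      by (rule higher_deriv_cmult[OF hu elim half_strip(1)])
    finally show ?case .
  qed
  have ai: "(\<lambda>t. (deriv ^^ i) a (of_real t)) \<in> O[at_top](\<lambda>t::real. of_real (t powr (\<sigma> - 1)))" for i
    using da[of i] by (simp add: decays_upto_def)
  have ui: "(\<lambda>t. (deriv ^^ i) u (of_real t)) \<in> O[at_top](\<lambda>t::real. of_real (t powr (- 2)))" if i1: "i \<ge> 1" for i
  proof -
    obtain j where j: "i = Suc j" using i1 by (cases i) auto
    let ?v = "\<lambda>z::complex. z powr of_real (- 2 * 1)"
    have hv: "?v holomorphic_on half_strip"
      by (intro holomorphic_intros) (use half_strip in auto)
    have dv: "(\<lambda>t. (deriv ^^ j) ?v (of_real t)) \<in> O[at_top](\<lambda>t::real. of_real (t powr (- 2 * 1)))"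
      using decays_powr[of j 1] by (simp add: decays_upto_def)
    have "(\<lambda>t. -1 * (deriv ^^ j) ?v (of_real t)) \<in> O[at_top](\<lambda>t::real. of_real (t powr (- 2)))"
      using bigo_cmult_const[OF dv, of "-1"] by simp
    moreover have "\<forall>\<^sub>F t in at_top. (deriv ^^ i) u (of_real t) = -1 * (deriv ^^ j) ?v (of_real t)"
      using half_strip(2)
    proof eventually_elim
      case (elim t)
      have "(deriv ^^ i) u (of_real t) = (deriv ^^ j) (deriv u) (of_real t)"
        unfolding j funpow_Suc_right o_def ..
      also have "\<dots> = (deriv ^^ j) (\<lambda>z. -1 * ?v z) (of_real t)"
      proof (rule higher_deriv_transform_within_open[OF _ _ half_strip(1) elim])
        show "deriv u holomorphic_on half_strip" by (rule holomorphic_deriv[OF hu half_strip(1)])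
        show "(\<lambda>z. -1 * ?v z) holomorphic_on half_strip" by (rule holomorphic_on_mult[OF holomorphic_on_const hv])
        fix w assume w: "w \<in> half_strip"
        have "deriv u w = of_real (- 2 * (1 / 2)) * w powr (of_real (- 2 * (1 / 2)) - 1)"
          unfolding u_def by (rule DERIV_imp_deriv[OF has_field_derivative_powr[OF half_strip(5)[OF w]]])
        thus "deriv u w = -1 * ?v w" by simp
      qed
      also have "\<dots> = -1 * (deriv ^^ j) ?v (of_real t)" by (rule higher_deriv_cmult[OF hv elim half_strip(1)])
      finally show ?case .
    qed
    ultimately show ?thesis using landau_o.big.in_cong by fastforce
  qed
  show "(\<lambda>t. (deriv ^^ i) (profile_quotient c \<nu> \<mu>) (of_real t)) \<in> O[at_top](\<lambda>t::real. of_real (t powr (- 1 - \<epsilon>)))"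
    if i: "i \<ge> 1" for i
  proof (rule landau_o.big.in_cong[THEN iffD2, OF eq_deriv])
    have 1: "(\<lambda>t. (deriv ^^ i) a (of_real t)) \<in> O[at_top](\<lambda>t::real. of_real (t powr (- 1 - \<epsilon>)))"
      by (rule landau_o.big_trans[OF ai powr_bigo_at_top]) (simp add: \<epsilon>_def)
    have 2: "(\<lambda>t. k * (deriv ^^ i) u (of_real t)) \<in> O[at_top](\<lambda>t::real. of_real (t powr (- 1 - \<epsilon>)))"
      by (rule bigo_cmult_const, rule landau_o.big_trans[OF ui[OF i] powr_bigo_at_top]) (simp add: \<epsilon>_def)
    show "(\<lambda>t. (deriv ^^ i) a (of_real t) - k * (deriv ^^ i) u (of_real t)) \<in> O[at_top](\<lambda>t::real. of_real (t powr (- 1 - \<epsilon>)))"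
      by (rule sum_in_bigo(2)[OF 1 2])
  qed
  show "(\<lambda>t. profile_quotient c \<nu> \<mu> (of_real t)) \<in> O[at_top](\<lambda>t::real. of_real (t powr (- 1)))"
  proof (rule landau_o.big.in_cong[THEN iffD2, OF eq_deriv[of 0, simplified]])
    have 1: "(\<lambda>t. a (of_real t)) \<in> O[at_top](\<lambda>t::real. of_real (t powr (- 1)))"
      by (rule landau_o.big_trans[OF ai[of 0, simplified] powr_bigo_at_top]) (use cond in \<open>simp add: \<sigma>_def\<close>)
    have 2: "(\<lambda>t. k * u (of_real t)) \<in> O[at_top](\<lambda>t::real. of_real (t powr (- 1)))"
      using du[of 0] by (intro bigo_cmult_const) (simp add: decays_upto_def)
    show "(\<lambda>t. a (of_real t) - k * u (of_real t)) \<in> O[at_top](\<lambda>t::real. of_real (t powr (- 1)))"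
      by (rule sum_in_bigo(2)[OF 1 2])
  qed
qed

section \<open>Taylor coefficients of the summand\<close>

text \<open>The coefficient of \<open>t\<^bsup>2k\<^esup>\<close> in \<open>h\<close>: a Cauchy product of a
  Bessel--Clifford and a binomial series.\<close>

definition profile_coeff :: "real \<Rightarrow> real \<Rightarrow> real \<Rightarrow> nat \<Rightarrow> real" where
  "profile_coeff c \<nu> \<mu> k = (\<Sum>i\<le>k. clifford_coeff \<nu> i * c ^ i * (- \<mu> gchoose (k - i)))"

lemma profile_sums:
  assumes z: "norm z < 1"
  shows "(\<lambda>k. of_real (profile_coeff c \<nu> \<mu> k) * z ^ (2 * k)) sums profile c \<nu> \<mu> z"
proof -
  let ?a = "\<lambda>k. complex_of_real (clifford_coeff \<nu> k) * (of_real c * z ^ 2) ^ k"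
  let ?b = "\<lambda>k. (complex_of_real (- \<mu>) gchoose k) * (z ^ 2) ^ k"
  have z2: "norm (z ^ 2) < 1" using z by (simp add: norm_power power_less_one_iff)
  have a: "?a sums clifford_sq c \<nu> z" unfolding clifford_sq_def by (rule clifford_sums)
  have b: "?b sums lorentz_power \<mu> z"
    using gen_binomial_complex[OF z2, of "of_real (- \<mu>)"] by (simp add: lorentz_power_def)
  have sb: "summable (\<lambda>k. norm (?b k))"
  proof (rule abs_summable_in_conv_radius)
    have "conv_radius (\<lambda>n. complex_of_real (- \<mu>) gchoose n) \<ge> 1"
      by (cases "complex_of_real (- \<mu>) \<in> \<nat>") (simp_all add: conv_radius_gchoose)
    moreover have "ereal (norm (z ^ 2)) < 1" using z2 by simp
    ultimately show "ereal (norm (z ^ 2)) < conv_radius (\<lambda>n. complex_of_real (- \<mu>) gchoose n)"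
      by (rule less_le_trans[rotated])
  qed
  have "(\<lambda>k. \<Sum>i\<le>k. ?a i * ?b (k - i)) sums ((\<Sum>k. ?a k) * (\<Sum>k. ?b k))"
    by (rule Cauchy_product_sums[OF summable_norm_clifford sb])
  also have "(\<Sum>k. ?a k) * (\<Sum>k. ?b k) = profile c \<nu> \<mu> z"
    using a b by (simp add: sums_iff profile_def)
  also have "(\<lambda>k. \<Sum>i\<le>k. ?a i * ?b (k - i)) = (\<lambda>k. of_real (profile_coeff c \<nu> \<mu> k) * z ^ (2 * k))"
  proof
    fix k
    have eq: "?a i * ?b (k - i) = of_real (clifford_coeff \<nu> i * c ^ i * (- \<mu> gchoose (k - i))) * z ^ (2 * k)" if "i \<le> k" for i
    proof -
      have "(z ^ 2) ^ i * (z ^ 2) ^ (k - i) = z ^ (2 * k)"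
      proof -
        have "2 * i + 2 * (k - i) = 2 * k" using that by simp
        thus ?thesis by (simp only: power_mult[symmetric] power_add[symmetric])
      qed
      moreover have "(complex_of_real (- \<mu>) gchoose (k - i)) = of_real (- \<mu> gchoose (k - i))"
        by (simp add: gbinomial_pochhammer pochhammer_of_real)
      moreover have "A * (C * Z1) * (B * Z2) = A * C * B * (Z1 * Z2)" for A B C Z1 Z2 :: complex by simp
      ultimately show ?thesis by (simp only: power_mult_distrib of_real_mult of_real_power)
    qed
    show "(\<Sum>i\<le>k. ?a i * ?b (k - i)) = of_real (profile_coeff c \<nu> \<mu> k) * z ^ (2 * k)"
      unfolding profile_coeff_def of_real_sum sum_distrib_right
      by (intro sum.cong refl eq) simp
  qed
  finally show ?thesis .
qed

lemma profile_at_0: "profile c \<nu> \<mu> 0 = of_real (rGamma (1 + \<nu>))"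
  by (simp add: profile_def clifford_sq_def lorentz_power_def clifford_at_0)

text \<open>Since \<open>h\<close> is even, \<open>q\<close> is odd and its power series is that of \<open>h\<close>
  shifted by one.\<close>

lemma profile_quotient_derivs:
  "(deriv ^^ n) (profile_quotient c \<nu> \<mu>) 0 =
     (if odd n then of_real (fact n * profile_coeff c \<nu> \<mu> (Suc n div 2)) else 0)"
proof -
  define F :: "complex fps" where
    "F = Abs_fps (\<lambda>n. if odd n then of_real (profile_coeff c \<nu> \<mu> (Suc n div 2)) else 0)"
  have sums: "(\<lambda>n. fps_nth F n * z ^ n) sums profile_quotient c \<nu> \<mu> z" if z: "norm z < 1" "z \<noteq> 0" for z
  proof -
    let ?p = "\<lambda>k. of_real (profile_coeff c \<nu> \<mu> k) * z ^ (2 * k)"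
    have p0: "?p 0 = profile c \<nu> \<mu> 0"
      by (simp add: profile_coeff_def clifford_coeff_0 profile_at_0)
    have "(\<lambda>k. ?p (Suc k)) sums (profile c \<nu> \<mu> z - profile c \<nu> \<mu> 0)"
      using profile_sums[OF z(1), of c \<nu> \<mu>] by (subst sums_Suc_iff) (simp only: p0 diff_add_cancel)
    from sums_divide[OF this, of z]
    have S: "(\<lambda>k. ?p (Suc k) / z) sums profile_quotient c \<nu> \<mu> z"
      using z by (simp add: profile_quotient_def)
    have "(\<lambda>k. fps_nth F (2 * k + 1) * z ^ (2 * k + 1)) sums profile_quotient c \<nu> \<mu> z"
    proof -
      have "?p (Suc k) / z = fps_nth F (2 * k + 1) * z ^ (2 * k + 1)" for k
        using z by (simp add: F_def)
      with S show ?thesis by (simp only:)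
    qed
    moreover have "strict_mono (\<lambda>k::nat. 2 * k + 1)" by (rule strict_monoI) simp
    moreover have "fps_nth F n * z ^ n = 0" if "n \<notin> range (\<lambda>k. 2 * k + 1)" for n
      using that by (auto simp: F_def elim!: oddE)
    ultimately show ?thesis
      using sums_mono_reindex[of "\<lambda>k. 2 * k + 1" "\<lambda>n. fps_nth F n * z ^ n"] by simp
  qed
  have sums0: "(\<lambda>n. fps_nth F n * z ^ n) sums eval_fps F z" if "norm z < 1" for z
  proof (cases "z = 0")
    case True
    thus ?thesis by (simp add: eval_fps_at_0)
  next
    case False
    thus ?thesis using sums[OF that False] by (simp add: eval_fps_def sums_iff)
  qed
  have "eventually (\<lambda>z::complex. z \<in> ball 0 1) (nhds 0)"
    by (intro eventually_nhds_in_open) auto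
  hence "eventually (\<lambda>z. (\<lambda>n. fps_nth F n * z ^ n) sums eval_fps F z) (nhds 0)"
    by eventually_elim (use sums0 in auto)
  hence E: "eval_fps F has_fps_expansion F" by (rule has_fps_expansionI)
  have "profile_quotient c \<nu> \<mu> 0 = eval_fps F 0"
  proof -
    have "isCont (profile_quotient c \<nu> \<mu>) 0"
      using holomorphic_on_imp_continuous_on[OF holomorphic_profile_quotient] open_unit_strip
      by (metis continuous_on_eq_continuous_at of_real_0 of_real_in_unit_strip)
    hence "(profile_quotient c \<nu> \<mu> \<longlongrightarrow> profile_quotient c \<nu> \<mu> 0) (at 0)" by (simp add: isCont_def)
    moreover have "(profile_quotient c \<nu> \<mu> \<longlongrightarrow> eval_fps F 0) (at 0)"
    proof (rule Lim_transform_eventually)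
      have "isCont (eval_fps F) 0" using has_fps_expansion_imp_continuous[OF E, of UNIV] by simp
      thus "(eval_fps F \<longlongrightarrow> eval_fps F 0) (at 0)" by (simp add: isCont_def)
      have "eventually (\<lambda>z::complex. z \<in> ball 0 1) (at 0)"
        by (intro eventually_at_in_open') auto
      moreover have "eventually (\<lambda>z::complex. z \<noteq> 0) (at 0)" by (simp add: eventually_at_filter)
      ultimately show "eventually (\<lambda>z. eval_fps F z = profile_quotient c \<nu> \<mu> z) (at 0)"
        by eventually_elim (use sums sums0 sums_unique2 in fastforce)
    qed
    ultimately show ?thesis by (rule tendsto_unique[rotated]) simp
  qed
  hence "(\<lambda>n. fps_nth F n * z ^ n) sums profile_quotient c \<nu> \<mu> z" if "norm z < 1" for z
    using sums[OF that] sums0[OF that] by (cases "z = 0") auto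
  hence "eventually (\<lambda>z. (\<lambda>n. fps_nth F n * z ^ n) sums profile_quotient c \<nu> \<mu> z) (nhds 0)"
    using \<open>eventually (\<lambda>z::complex. z \<in> ball 0 1) (nhds 0)\<close> by (auto elim!: eventually_mono)
  hence "profile_quotient c \<nu> \<mu> has_fps_expansion F" by (rule has_fps_expansionI)
  from fps_nth_fps_expansion[OF this, of n] show ?thesis by (auto simp: F_def field_simps)
qed

section \<open>Euler--Maclaurin summation over the half line\<close>

text \<open>A bound near infinity and continuity give a bound on the whole half line, in a form without singularity at
  0.\<close>

lemma bigo_powr_uniform:
  fixes f :: "real \<Rightarrow> complex"
  assumes cont: "continuous_on {0..} f" and O: "f \<in> O[at_top](\<lambda>t. of_real (t powr (- e)))" and e: "e \<ge> 0"
  obtains D where "D > 0" "\<And>t. t \<ge> 0 \<Longrightarrow> norm (f t) \<le> D * (1 + t) powr (- e)"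
proof -
  obtain C where C: "C > 0" "\<forall>\<^sub>F t in at_top. norm (f t) \<le> C * norm (complex_of_real (t powr (- e)))"
    using O by (elim landau_o.bigE) auto
  then obtain T0 where T0: "\<And>t. t \<ge> T0 \<Longrightarrow> norm (f t) \<le> C * t powr (- e)"
    by (auto simp: eventually_at_top_linorder)
  define T where "T = max 1 T0"
  have "bounded (f ` {0..T})"
    by (intro compact_imp_bounded compact_continuous_image compact_Icc continuous_on_subset[OF cont]) auto
  then obtain B where B: "\<And>t. t \<in> {0..T} \<Longrightarrow> norm (f t) \<le> B" unfolding bounded_iff by blast
  have B0: "B \<ge> 0"
  proof -
    have "0 \<in> {0..T}" by (simp add: T_def)
    from B[OF this] show ?thesis using norm_ge_zero[of "f 0"] by (rule order_trans[rotated])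
  qed
  define D where "D = C * 2 powr e + B * (1 + T) powr e"
  have D0: "D > 0" unfolding D_def using C(1) B0 by (intro add_pos_nonneg) auto
  moreover have "norm (f t) \<le> D * (1 + t) powr (- e)" if t: "t \<ge> 0" for t
  proof (cases "t \<le> T")
    case True
    have "norm (f t) \<le> B * 1" using B[of t] t True by simp
    also have "1 = (1 + T) powr e * (1 + T) powr (- e)"
      using powr_mult_powr[of e "- e" 0 "1 + T"] by (simp add: T_def)
    also have "B * ((1 + T) powr e * (1 + T) powr (- e)) \<le> B * ((1 + T) powr e * (1 + t) powr (- e))"
      using True t e B0 by (intro mult_left_mono powr_mono2') auto
    also have "\<dots> \<le> D * (1 + t) powr (- e)"
      unfolding D_def mult.assoc[symmetric] using C(1) by (intro mult_right_mono) auto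
    finally show ?thesis .
  next
    case False
    hence t1: "t \<ge> 1" "t \<ge> T0" by (auto simp: T_def)
    have "norm (f t) \<le> C * t powr (- e)" by (rule T0[OF t1(2)])
    also have "t powr (- e) \<le> ((1 + t) / 2) powr (- e)" using t1 e by (intro powr_mono2') auto
    also have "((1 + t) / 2) powr (- e) = 2 powr e * (1 + t) powr (- e)"
    proof -
      have "((1 + t) / 2) powr (- e) = (1 + t) powr (- e) / 2 powr (- e)" using t1 by (simp add: powr_divide)
      also have "2 powr (- e) = inverse (2 powr e)" by (rule powr_minus)
      finally show ?thesis by (simp only: divide_inverse inverse_inverse_eq mult.commute)
    qed
    finally have "norm (f t) \<le> C * 2 powr e * (1 + t) powr (- e)" using C(1) by simp
    also have "\<dots> \<le> D * (1 + t) powr (- e)"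
      unfolding D_def using B0 by (intro mult_right_mono) auto
    finally show ?thesis .
  qed
  ultimately show ?thesis by (rule that)
qed

lemma bigo_powr_tendsto_0:
  fixes f :: "real \<Rightarrow> complex"
  assumes "f \<in> O[at_top](\<lambda>t. of_real (t powr (- e)))" and "e > 0"
  shows "(f \<longlongrightarrow> 0) at_top"
proof -
  have "((\<lambda>t::real. t powr (- e)) \<longlongrightarrow> 0) at_top"
    by (rule tendsto_neg_powr[OF _ filterlim_ident]) (use assms(2) in simp)
  hence l: "((\<lambda>t::real. C * t powr (- e)) \<longlongrightarrow> 0) at_top" for C by (rule tendsto_mult_right_zero)
  obtain C where "\<forall>\<^sub>F t in at_top. norm (f t) \<le> C * norm (complex_of_real (t powr (- e)))"
    using assms(1) by (elim landau_o.bigE)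
  hence "\<forall>\<^sub>F t in at_top. norm (f t) \<le> C * t powr (- e)" by simp
  thus ?thesis by (rule Lim_null_comparison[OF _ l])
qed

text \<open>The sequence that Euler--Maclaurin summation expects: a primitive, the function, and its
  derivatives.\<close>

definition quotient_derivs :: "real \<Rightarrow> real \<Rightarrow> real \<Rightarrow> (complex \<Rightarrow> complex) \<Rightarrow> nat \<Rightarrow> complex \<Rightarrow> complex" where
  "quotient_derivs c \<nu> \<mu> prim j = (case j of 0 \<Rightarrow> prim | Suc i \<Rightarrow> (deriv ^^ i) (profile_quotient c \<nu> \<mu>))"

text \<open>The strip is convex.\<close>

lemma profile_quotient_primitive:
  obtains prim where "\<And>z. z \<in> unit_strip \<Longrightarrow> (prim has_field_derivative profile_quotient c \<nu> \<mu> z) (at z)"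
proof -
  have "unit_strip = {z. Im z < 1} \<inter> {z. Im z > -1}" by (auto simp: unit_strip_def)
  moreover have "convex ({z. Im z < 1} \<inter> {z. Im z > -1})"
    by (intro convex_Int convex_halfspace_Im_lt convex_halfspace_Im_gt)
  ultimately have "convex unit_strip" by simp
  from holomorphic_convex_primitive'[OF this open_unit_strip holomorphic_profile_quotient]
  obtain prim where "\<And>z. z \<in> unit_strip \<Longrightarrow> (prim has_field_derivative profile_quotient c \<nu> \<mu> z) (at z within unit_strip)"
    by blast
  hence "\<And>z. z \<in> unit_strip \<Longrightarrow> (prim has_field_derivative profile_quotient c \<nu> \<mu> z) (at z)"
    using at_within_open[OF _ open_unit_strip] by metis
  thus ?thesis by (rule that)
qed

text \<open>The term \<open>h(0)/n\<close> sums to \<open>h(0)\<close> times a harmonic number. The rest is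
  \<open>1/a\<close> times \<open>q(n/a)\<close>, to which the one-step formula applies on each \<open>[n,
  n+1]\<close>. The boundary terms telescope, those at infinity vanish, and the \<open>j\<close>-th one at 0 carries
  \<open>a powr (-j)\<close>. The divergence of \<open>harm N\<close> and of the primitive cancel since \<open>ln N =
  ln (N/a) + ln a\<close>. The remainders, of order \<open>a powr (-M-2)\<close> each, have a majorant at scale
  \<open>a\<close>, which costs one power of \<open>a\<close>.\<close>

lemma profile_sum_euler_maclaurin:
  assumes c: "c > 0" and cond: "- \<nu> - 1 / 2 - 2 * \<mu> < 0"
    and prim: "\<And>z. z \<in> unit_strip \<Longrightarrow> (prim has_field_derivative profile_quotient c \<nu> \<mu> z) (at z)"
    and L: "((\<lambda>T. prim (of_real T) - prim 0 + of_real (rGamma (1 + \<nu>) * ln T)) \<longlongrightarrow> L) at_top"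
  obtains C where "C \<ge> 0" "\<And>a. a > 0 \<Longrightarrow> \<exists>E. norm E \<le> C * (1 / a) ^ Suc M \<and>
     (\<lambda>n. profile c \<nu> \<mu> (of_real ((real n + 1) / a)) / (of_nat n + 1)) sums
        (of_real (rGamma (1 + \<nu>) * (euler_mascheroni + ln a)) + L
         - (\<Sum>j=1..Suc M. (-1) ^ j * of_real (bernoulli_coeff j) * of_real ((1 / a) ^ j)
              * (deriv ^^ (j - 1)) (profile_quotient c \<nu> \<mu>) 0) + E)"
proof -
  let ?P = "quotient_derivs c \<nu> \<mu> prim"
  let ?h0 = "rGamma (1 + \<nu>)"
  let ?b = "\<lambda>j. (-1) ^ j * complex_of_real (bernoulli_coeff j)"
  obtain \<epsilon> where eps: "\<epsilon> > 0"
    and dec: "\<And>i. i \<ge> 1 \<Longrightarrow> (\<lambda>t. (deriv ^^ i) (profile_quotient c \<nu> \<mu>) (of_real t)) \<in> O[at_top](\<lambda>t::real. of_real (t powr (- 1 - \<epsilon>)))"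
    and dec0: "(\<lambda>t. profile_quotient c \<nu> \<mu> (of_real t)) \<in> O[at_top](\<lambda>t::real. of_real (t powr (- 1)))"
    using profile_quotient_decay[OF c cond] by blast
  have hol: "(deriv ^^ i) (profile_quotient c \<nu> \<mu>) holomorphic_on unit_strip" for i
    by (rule holomorphic_higher_deriv[OF holomorphic_profile_quotient open_unit_strip])
  have Pder: "(?P j has_field_derivative ?P (Suc j) z) (at z)" if "z \<in> unit_strip" for j z
  proof (cases j)
    case 0
    thus ?thesis using prim[OF that] by (simp add: quotient_derivs_def)
  next
    case (Suc i)
    thus ?thesis using holomorphic_derivI[OF hol[of i] open_unit_strip that] by (simp add: quotient_derivs_def)
  qed
  have lim0: "((\<lambda>t. ?P (Suc j) (of_real t)) \<longlongrightarrow> 0) at_top" for j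
  proof (cases j)
    case 0
    thus ?thesis using bigo_powr_tendsto_0[OF dec0] by (simp add: quotient_derivs_def)
  next
    case (Suc i)
    have "(\<lambda>t. (deriv ^^ j) (profile_quotient c \<nu> \<mu>) (of_real t)) \<in> O[at_top](\<lambda>t::real. of_real (t powr (- (1 + \<epsilon>))))"
      using dec[of j] Suc by (simp only:) simp
    from bigo_powr_tendsto_0[OF this] eps show ?thesis by (simp add: quotient_derivs_def)
  qed
  have cont: "continuous_on A (\<lambda>t. ?P j (complex_of_real t))" for A j
  proof (rule continuous_on_compose2[of unit_strip "?P j" A complex_of_real])
    show "continuous_on unit_strip (?P j)"
      by (rule continuous_at_imp_continuous_on) (auto intro!: DERIV_isCont Pder)
  qed (auto intro!: continuous_intros)
  obtain D where D: "D > 0" "\<And>t. t \<ge> 0 \<Longrightarrow> norm (?P (M + 2) (of_real t)) \<le> D * (1 + t) powr (- (1 + \<epsilon>))"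
  proof (rule bigo_powr_uniform[of "\<lambda>t. ?P (M + 2) (of_real t)" "1 + \<epsilon>"])
    show "continuous_on {0..} (\<lambda>t. ?P (M + 2) (of_real t))" by (rule cont)
    show "(\<lambda>t. ?P (M + 2) (of_real t)) \<in> O[at_top](\<lambda>t. of_real (t powr (- (1 + \<epsilon>))))"
      using dec[of "M + 1"] by (simp add: quotient_derivs_def)
  qed (use eps in auto)
  obtain Q where Q: "Q > 0" "\<And>t. t \<in> {0..1} \<Longrightarrow> \<bar>bernoulli_fun (Suc M) t\<bar> \<le> Q"
    using bernoulli_fun_bounded by blast
  show ?thesis
  proof (rule that[of "Q * (D / \<epsilon>)"])
    show "Q * (D / \<epsilon>) \<ge> 0" using Q(1) D(1) eps by simp
    fix a :: real assume a: "a > 0"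
    define F where "F j x = of_real ((1 / a) ^ j) * ?P j (of_real (x / a))" for j x
    have Fder: "(F j has_vector_derivative F (Suc j) x) (at x)" for j x
    proof -
      have "((\<lambda>x. complex_of_real (x / a)) has_vector_derivative of_real (1 / a)) (at x)"
        by (intro has_vector_derivative_of_real)
           (use a in \<open>auto intro!: derivative_eq_intros simp: has_real_derivative_iff_has_vector_derivative[symmetric]\<close>)
      from field_vector_diff_chain_at[OF this Pder[OF of_real_in_unit_strip[of "x / a"], of j]]
      have "((\<lambda>x. ?P j (of_real (x / a))) has_vector_derivative of_real (1 / a) * ?P (Suc j) (of_real (x / a))) (at x)"
        by (simp add: o_def)
      from has_vector_derivative_mult_right[OF this, of "of_real ((1 / a) ^ j)"]
      show ?thesis unfolding F_def[abs_def] by (simp add: mult_ac)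
    qed
    define R where "R n = (-1) ^ M * em_remainder (Suc M) (F (M + 2)) (real n)" for n
    define V where "V x = (1 / a) ^ Suc M * (D / \<epsilon>) * (1 + x / a) powr (- \<epsilon>)" for x
    have step: "F 1 (real n + 1) = (\<Sum>j\<le>Suc M. ?b j * (F j (real n + 1) - F j (real n))) + R n" for n
      unfolding R_def by (rule euler_maclaurin_step) (rule Fder)
    have Rb: "norm (R n) \<le> Q * (V (real n) - V (real n + 1))" for n
    proof -
      have "norm (em_remainder (Suc M) (F (M + 2)) (real n)) \<le> Q * (V (real n) - V (real n + 1))"
      proof (rule norm_em_remainder_le[where v = "\<lambda>x. (1 / a) ^ (M + 2) * (D * (1 + x / a) powr (- (1 + \<epsilon>)))"])
        show "continuous_on {real n..real n + 1} (F (M + 2))"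
          by (rule continuous_at_imp_continuous_on) (auto intro!: has_vector_derivative_continuous Fder)
      next
        fix x assume x: "x \<in> {real n..real n + 1}"
        hence x0: "x \<ge> 0" by (meson atLeastAtMost_iff of_nat_0_le_iff order_trans)
        hence pos: "1 + x / a > 0" using a by (simp add: add_pos_nonneg)
        have "((\<lambda>x. 1 + x / a) has_real_derivative 1 / a) (at x)" using a by (auto intro!: derivative_eq_intros)
        from DERIV_cmult[OF DERIV_chain2[OF has_real_derivative_powr[OF pos, of "- \<epsilon>"] this], of "(1 / a) ^ Suc M * (D / \<epsilon>)"]
        have "(V has_real_derivative (1 / a) ^ Suc M * (D / \<epsilon>) * (- \<epsilon> * (1 + x / a) powr (- \<epsilon> - 1) * (1 / a))) (at x)"
          unfolding V_def[abs_def] .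
        moreover have "(1 / a) ^ Suc M * (D / \<epsilon>) * (- \<epsilon> * p * (1 / a)) = - ((1 / a) ^ (M + 2) * (D * p))" for p
          using eps by simp
        moreover have "- \<epsilon> - 1 = - (1 + \<epsilon>)" by simp
        ultimately show "(V has_real_derivative - ((1 / a) ^ (M + 2) * (D * (1 + x / a) powr (- (1 + \<epsilon>))))) (at x)"
          by (simp only:)
        show "norm (F (M + 2) x) \<le> (1 / a) ^ (M + 2) * (D * (1 + x / a) powr (- (1 + \<epsilon>)))"
          unfolding F_def norm_mult norm_of_real using a x0 D(2)[of "x / a"]
          by (simp only: abs_of_nonneg zero_le_power zero_le_divide_1_iff order_less_imp_le)
             (intro mult_left_mono, auto)
      qed (use Q in auto)
      thus ?thesis by (simp add: R_def norm_mult norm_power)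
    qed
    have V0: "V x \<ge> 0" for x unfolding V_def using a D(1) eps by simp
    have tel: "(\<Sum>n<N. Q * (V (real n) - V (real n + 1))) = Q * (V 0 - V (real N))" for N
      by (induction N) (simp_all add: algebra_simps)
    have Rsum: "summable (\<lambda>n. norm (R n))"
    proof (rule bounded_imp_summable[of _ "Q * V 0"])
      fix N
      have "(\<Sum>n\<le>N. norm (R n)) \<le> (\<Sum>n<Suc N. Q * (V (real n) - V (real n + 1)))"
        unfolding lessThan_Suc_atMost by (intro sum_mono Rb)
      also have "\<dots> \<le> Q * V 0" unfolding tel using V0 Q(1) by (simp add: mult_left_mono)
      finally show "(\<Sum>n\<le>N. norm (R n)) \<le> Q * V 0" .
    qed simp
    define E where "E = (\<Sum>n. R n)"
    have RE: "R sums E" unfolding E_def by (intro summable_sums summable_norm_cancel[OF Rsum])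
    have Eb: "norm E \<le> Q * (D / \<epsilon>) * (1 / a) ^ Suc M"
    proof -
      have "norm E \<le> (\<Sum>n. norm (R n))" unfolding E_def by (rule summable_norm[OF Rsum])
      also have "\<dots> \<le> Q * V 0"
      proof (rule suminf_le_const[OF Rsum])
        fix N
        have "(\<Sum>n<N. norm (R n)) \<le> (\<Sum>n<N. Q * (V (real n) - V (real n + 1)))" by (intro sum_mono Rb)
        also have "\<dots> \<le> Q * V 0" unfolding tel using V0 Q(1) by (simp add: mult_left_mono)
        finally show "(\<Sum>n<N. norm (R n)) \<le> Q * V 0" .
      qed
      also have "\<dots> = Q * (D / \<epsilon>) * (1 / a) ^ Suc M" by (simp add: V_def mult_ac)
      finally show ?thesis .
    qed
    have Fsum: "(\<Sum>n<N. F 1 (real n + 1)) = (\<Sum>j\<le>Suc M. ?b j * (F j (real N) - F j 0)) + (\<Sum>n<N. R n)" for N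
    proof (induction N)
      case (Suc N)
      have "(\<Sum>n<Suc N. F 1 (real n + 1)) = (\<Sum>j\<le>Suc M. ?b j * (F j (real N) - F j 0)) + (\<Sum>n<N. R n)
           + ((\<Sum>j\<le>Suc M. ?b j * (F j (real N + 1) - F j (real N))) + R N)"
        unfolding sum.lessThan_Suc Suc.IH step[of N] ..
      also have "\<dots> = ((\<Sum>j\<le>Suc M. ?b j * (F j (real N) - F j 0)) + (\<Sum>j\<le>Suc M. ?b j * (F j (real N + 1) - F j (real N))))
           + (\<Sum>n<Suc N. R n)"
        unfolding sum.lessThan_Suc by (simp only: add_ac)
      also have "(\<Sum>j\<le>Suc M. ?b j * (F j (real N) - F j 0)) + (\<Sum>j\<le>Suc M. ?b j * (F j (real N + 1) - F j (real N)))
          = (\<Sum>j\<le>Suc M. ?b j * (F j (real (Suc N)) - F j 0))"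
        unfolding sum.distrib[symmetric] by (intro sum.cong refl) (simp add: algebra_simps)
      finally show ?case .
    qed simp
    have top: "filterlim (\<lambda>N. real N / a) at_top sequentially" using a by real_asymp
    have Flim: "(\<lambda>N. F (Suc j) (real N)) \<longlonglongrightarrow> 0" for j
      unfolding F_def by (intro tendsto_mult_right_zero filterlim_compose[OF lim0 top])
    have split0: "(\<Sum>j\<le>Suc M. ?b j * (F j (real N) - F j 0))
        = (F 0 (real N) - F 0 0) + (\<Sum>j=1..Suc M. ?b j * (F j (real N) - F j 0))" for N
    proof -
      have "{..Suc M} = insert 0 {1..Suc M}" by auto
      thus ?thesis by simp
    qed
    have term_eq: "profile c \<nu> \<mu> (of_real ((real n + 1) / a)) / (of_nat n + 1)
        = of_real (?h0 * (1 / (real n + 1))) + F 1 (real n + 1)" for n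
    proof -
      have nz: "(real n + 1) / a \<noteq> 0" using a by (simp add: add_nonneg_eq_0_iff)
      have "F 1 (real n + 1) = of_real (1 / a) * ((profile c \<nu> \<mu> (of_real ((real n + 1) / a)) - of_real ?h0) / of_real ((real n + 1) / a))"
        using nz by (simp add: F_def quotient_derivs_def profile_quotient_def profile_at_0 del: of_real_divide of_real_add)
      also have "\<dots> = (profile c \<nu> \<mu> (of_real ((real n + 1) / a)) - of_real ?h0) / of_real (real n + 1)"
        using a by simp
      finally show ?thesis by (simp add: diff_divide_distrib)
    qed
    have harm: "(\<Sum>n<N. 1 / (real n + 1)) = harm N" for N
      unfolding harm_def by (rule sum.reindex_bij_witness[of _ "\<lambda>n. n - 1" Suc]) (auto simp: inverse_eq_divide add.commute)
    have part: "(\<Sum>n<N. profile c \<nu> \<mu> (of_real ((real n + 1) / a)) / (of_nat n + 1))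
        = of_real (?h0 * (harm N - ln (real N))) + (F 0 (real N) - F 0 0 + of_real (?h0 * ln (real N / a)))
          + of_real (?h0 * ln a) + (\<Sum>j=1..Suc M. ?b j * (F j (real N) - F j 0)) + (\<Sum>n<N. R n)"
      if "N > 0" for N
    proof -
      have "(\<Sum>n<N. profile c \<nu> \<mu> (of_real ((real n + 1) / a)) / (of_nat n + 1))
          = of_real (?h0 * (\<Sum>n<N. 1 / (real n + 1))) + (\<Sum>n<N. F 1 (real n + 1))"
        unfolding term_eq sum.distrib of_real_sum[symmetric] sum_distrib_left ..
      also have "?h0 * (\<Sum>n<N. 1 / (real n + 1)) = ?h0 * (harm N - ln (real N)) + ?h0 * ln (real N / a) + ?h0 * ln a"
        unfolding harm using that a by (simp add: ln_div algebra_simps)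
      finally show ?thesis unfolding Fsum split0 of_real_add by (simp only: add_ac)
    qed
    have "(\<lambda>N. of_real (?h0 * (harm N - ln (real N))) + (F 0 (real N) - F 0 0 + of_real (?h0 * ln (real N / a)))
          + of_real (?h0 * ln a) + (\<Sum>j=1..Suc M. ?b j * (F j (real N) - F j 0)) + (\<Sum>n<N. R n))
       \<longlonglongrightarrow> of_real (?h0 * euler_mascheroni) + L + of_real (?h0 * ln a) + (\<Sum>j=1..Suc M. ?b j * (0 - F j 0)) + E"
    proof (intro tendsto_intros)
      show "(\<lambda>N. harm N - ln (real N) :: real) \<longlonglongrightarrow> euler_mascheroni" by (rule euler_mascheroni_LIMSEQ)
      show "(\<lambda>N. F 0 (real N) - F 0 0 + of_real (?h0 * ln (real N / a))) \<longlonglongrightarrow> L"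
        using filterlim_compose[OF L top] by (simp add: F_def quotient_derivs_def)
      show "(\<lambda>N. F j (real N)) \<longlonglongrightarrow> 0" if "j \<in> {1..Suc M}" for j
        using Flim[of "j - 1"] that by simp
      show "(\<lambda>N. \<Sum>n<N. R n) \<longlonglongrightarrow> E" using RE by (simp add: sums_def)
    qed
    moreover have "\<forall>\<^sub>F N in sequentially. of_real (?h0 * (harm N - ln (real N))) + (F 0 (real N) - F 0 0 + of_real (?h0 * ln (real N / a)))
          + of_real (?h0 * ln a) + (\<Sum>j=1..Suc M. ?b j * (F j (real N) - F j 0)) + (\<Sum>n<N. R n)
        = (\<Sum>n<N. profile c \<nu> \<mu> (of_real ((real n + 1) / a)) / (of_nat n + 1))"
      using eventually_gt_at_top[of 0] by eventually_elim (simp only: part)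
    ultimately have "(\<lambda>n. profile c \<nu> \<mu> (of_real ((real n + 1) / a)) / (of_nat n + 1)) sums
        (of_real (?h0 * euler_mascheroni) + L + of_real (?h0 * ln a) + (\<Sum>j=1..Suc M. ?b j * (0 - F j 0)) + E)"
      unfolding sums_def by (rule Lim_transform_eventually)
    moreover have "of_real (?h0 * euler_mascheroni) + L + of_real (?h0 * ln a) + (\<Sum>j=1..Suc M. ?b j * (0 - F j 0)) + E
       = of_real (?h0 * (euler_mascheroni + ln a)) + L
         - (\<Sum>j=1..Suc M. ?b j * of_real ((1 / a) ^ j) * (deriv ^^ (j - 1)) (profile_quotient c \<nu> \<mu>) 0) + E"
    proof -
      have "(\<Sum>j=1..Suc M. ?b j * (0 - F j 0)) = - (\<Sum>j=1..Suc M. ?b j * of_real ((1 / a) ^ j) * (deriv ^^ (j - 1)) (profile_quotient c \<nu> \<mu>) 0)"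
        unfolding sum_negf[symmetric]
      proof (intro sum.cong refl)
        fix j assume "j \<in> {1..Suc M}"
        then obtain i where "j = Suc i" by (cases j) auto
        thus "?b j * (0 - F j 0) = - (?b j * of_real ((1 / a) ^ j) * (deriv ^^ (j - 1)) (profile_quotient c \<nu> \<mu>) 0)"
          by (simp add: F_def quotient_derivs_def)
      qed
      thus ?thesis by (simp only: distrib_left of_real_add) simp
    qed
    ultimately show "\<exists>E. norm E \<le> Q * (D / \<epsilon>) * (1 / a) ^ Suc M \<and>
     (\<lambda>n. profile c \<nu> \<mu> (of_real ((real n + 1) / a)) / (of_nat n + 1)) sums
        (of_real (?h0 * (euler_mascheroni + ln a)) + L
         - (\<Sum>j=1..Suc M. ?b j * of_real ((1 / a) ^ j) * (deriv ^^ (j - 1)) (profile_quotient c \<nu> \<mu>) 0) + E)"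
      using Eb by (intro exI[of _ E]) (simp only:)
  qed
qed

section \<open>The special functions of the main term and of the expansion\<close>

text \<open>Term by term, \<open>\<chi>\<close> times the \<open>2F3\<close> series is the series of residues at
  integers, and \<open>\<chi>\<^sup>\<mu>\<close> times the \<open>1F2\<close> series is the other one.\<close>

lemma coeff_A_eq_integral:
  assumes b: "b > 0" and mu: "\<mu> > 0" "\<mu> \<notin> \<int>" and cond: "2 * \<mu> + \<nu> > - 1 / 2"
  shows "coeff_A \<mu> \<nu> b = Gamma (1 + \<nu>) * (LINT y:{0<..}|lborel. regular_kernel (chi b) \<nu> \<mu> y)"
proof -
  have c: "chi b > 0" using b by (simp add: chi_def)
  obtain S1 S2 where S1: "pole_residue (chi b) \<nu> \<mu> sums S1" and S2: "power_residue (chi b) \<nu> \<mu> sums S2"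
    and I: "(LINT y:{0<..}|lborel. regular_kernel (chi b) \<nu> \<mu> y) = pi * rGamma \<mu> / sin (pi * \<mu>) * (S1 - S2)"
    by (rule integral_regular_kernel_closed_form[OF c mu cond])
  have G: "Gamma (1 - \<mu>) = pi * rGamma \<mu> / sin (pi * \<mu>)"
  proof -
    have sin0: "sin (pi * \<mu>) \<noteq> 0" using mu(2) by (auto simp: sin_zero_iff_int2)
    have "rGamma \<mu> * rGamma (1 - \<mu>) = sin (pi * \<mu>) / pi" by (rule rGamma_reflection_real)
    moreover from this have "rGamma (1 - \<mu>) \<noteq> 0" using sin0 by auto
    ultimately show ?thesis using sin0 unfolding Gamma_def by (simp add: field_simps)
  qed
  have "chi b * hypergeo_reg [1, 1] [2, 2 - \<mu>, 2 + \<nu>] (chi b) = S1"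
  proof -
    have "(\<lambda>n. pole_residue (chi b) \<nu> \<mu> n / chi b) sums (S1 / chi b)" by (rule sums_divide[OF S1])
    moreover have "pole_residue (chi b) \<nu> \<mu> n / chi b
       = (\<Prod>\<alpha>\<leftarrow>[1, 1]. pochhammer \<alpha> n) * (\<Prod>\<beta>\<leftarrow>[2, 2 - \<mu>, 2 + \<nu>]. rGamma (\<beta> + real n)) * chi b ^ n / fact n" for n
    proof -
      have "rGamma (2 + real n) = 1 / fact (Suc n)"
        using Gamma_fact[of "Suc n", where ?'a = real] by (simp add: rGamma_inverse_Gamma inverse_eq_divide add.commute)
      moreover have "pochhammer 1 n = (fact n :: real)" by (simp add: pochhammer_fact)
      moreover have "C * x * r * s / (n + 1) / C = f * f * (1 / ((n + 1) * f) * (r * s)) * x / f"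
        if "C \<noteq> 0" "f \<noteq> 0" for C x r s n f :: real
        using that by simp
      ultimately show ?thesis using c unfolding pole_residue_def by (simp add: add.commute)
    qed
    ultimately have "hypergeo_reg [1, 1] [2, 2 - \<mu>, 2 + \<nu>] (chi b) = S1 / chi b"
      unfolding hypergeo_reg_def by (simp only: sums_iff)
    thus ?thesis using c by simp
  qed
  moreover have "chi b powr \<mu> * hypergeo_reg [\<mu>] [1 + \<mu>, 1 + \<mu> + \<nu>] (chi b) = rGamma \<mu> * S2"
  proof -
    have "(\<lambda>n. (rGamma \<mu> / chi b powr \<mu>) * power_residue (chi b) \<nu> \<mu> n) sums ((rGamma \<mu> / chi b powr \<mu>) * S2)"
      by (rule sums_mult[OF S2])
    moreover have "(rGamma \<mu> / chi b powr \<mu>) * power_residue (chi b) \<nu> \<mu> n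
       = (\<Prod>\<alpha>\<leftarrow>[\<mu>]. pochhammer \<alpha> n) * (\<Prod>\<beta>\<leftarrow>[1 + \<mu>, 1 + \<mu> + \<nu>]. rGamma (\<beta> + real n)) * chi b ^ n / fact n" for n
    proof -
      have ps: "pochhammer \<mu> n * rGamma (1 + \<mu> + real n) = rGamma \<mu> / (\<mu> + real n)"
        using pochhammer_rGamma[of \<mu> "Suc n"] mu(1) by (simp add: pochhammer_Suc field_simps add_ac)
      have "(\<Prod>\<alpha>\<leftarrow>[\<mu>]. pochhammer \<alpha> n) * (\<Prod>\<beta>\<leftarrow>[1 + \<mu>, 1 + \<mu> + \<nu>]. rGamma (\<beta> + real n)) * chi b ^ n / fact n
          = (pochhammer \<mu> n * rGamma (1 + \<mu> + real n)) * rGamma (1 + \<mu> + \<nu> + real n) * chi b ^ n / fact n"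
        by simp
      also have "\<dots> = (rGamma \<mu> / chi b powr \<mu>) * power_residue (chi b) \<nu> \<mu> n"
        unfolding ps power_residue_def using c by (simp add: powr_add powr_realpow)
      finally show ?thesis ..
    qed
    ultimately have "hypergeo_reg [\<mu>] [1 + \<mu>, 1 + \<mu> + \<nu>] (chi b) = (rGamma \<mu> / chi b powr \<mu>) * S2"
      unfolding hypergeo_reg_def by (simp only: sums_iff)
    thus ?thesis using c by simp
  qed
  moreover have "coeff_A \<mu> \<nu> b = Gamma (1 + \<nu>) *
       (Gamma (1 - \<mu>) * (chi b * hypergeo_reg [1, 1] [2, 2 - \<mu>, 2 + \<nu>] (chi b))
        - pi / sin (pi * \<mu>) * (chi b powr \<mu> * hypergeo_reg [\<mu>] [1 + \<mu>, 1 + \<mu> + \<nu>] (chi b)))"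
    unfolding coeff_A_def by (simp add: mult_ac)
  ultimately show ?thesis unfolding I G by (simp add: right_diff_distrib)
qed

text \<open>The weight common to all terms sums to \<open>I\<^sub>\<nu>\<close> without its first term. Separating
  \<open>\<psi>(2) + \<psi>(2+\<nu>) - log \<chi> = \<kappa>\<close> from the digamma values produces the term with
  \<open>\<kappa>\<close>, and the remaining differences are those in \<open>F\<^sub>*\<close>.\<close>

lemma integral_kernel_1_eq:
  assumes b: "b > 0" and nu: "\<And>m::nat. m \<ge> 1 \<Longrightarrow> \<nu> \<noteq> - real m" and cond: "2 + \<nu> > - 1 / 2"
  shows "kappa \<nu> b * (1 - normalized_I \<nu> b) - chi b * F_star \<nu> b / (1 + \<nu>)
       = Gamma (1 + \<nu>) * (LINT y:{0<..}|lborel. regular_kernel (chi b) \<nu> 1 y)"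
proof -
  define c where "c = chi b"
  have c: "c > 0" using b by (simp add: c_def chi_def)
  let ?L = "LINT y:{0<..}|lborel. regular_kernel c \<nu> 1 y"
  define w where "w n = c ^ Suc n * rGamma (2 + \<nu> + real n) / fact (Suc n)" for n
  let ?psi = "\<lambda>n. Digamma (2 + real n) + Digamma (2 + \<nu> + real n)"
  have L: "(\<lambda>n. - (w n * (?psi n - ln c))) sums ?L"
    unfolding w_def by (rule integral_regular_kernel_1[OF c nu cond])
  have nn: "1 + \<nu> + real k \<noteq> 0" for k using nu[of "Suc k"] by auto
  have G: "Gamma (1 + \<nu>) * rGamma (1 + \<nu>) = 1"
  proof -
    have "1 + \<nu> \<notin> \<int>\<^sub>\<le>\<^sub>0"
    proof
      assume "1 + \<nu> \<in> \<int>\<^sub>\<le>\<^sub>0"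
      then obtain k where "1 + \<nu> = - real k" by (auto elim!: nonpos_Ints_cases')
      thus False using nn[of k] by simp
    qed
    hence "rGamma (1 + \<nu>) \<noteq> 0" by (simp add: rGamma_eq_zero_iff)
    thus ?thesis by (simp add: Gamma_def)
  qed
  have I: "bessel_I \<nu> b = (b / 2) powr \<nu> * clifford \<nu> (- c)"
  proof -
    have "rGamma (\<nu> + real k + 1) / fact k * (b / 2) ^ (2 * k) = clifford_coeff \<nu> k * (- c) ^ k" for k
    proof -
      have "(b / 2) ^ (2 * k) = c ^ k" by (simp add: c_def chi_def power_mult power_divide)
      moreover have "(- c) ^ k = (- 1) ^ k * c ^ k" by (rule power_minus)
      moreover have "(- 1) ^ k * (- 1) ^ k = (1::real)" by (simp add: power_mult_distrib[symmetric])
      hence "((- 1) ^ k * r / f) * ((- 1) ^ k * C) = r / f * C" for r f C :: real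
        by (simp add: field_simps mult.assoc[symmetric])
      ultimately show ?thesis by (simp only: clifford_coeff_def)
    qed
    thus ?thesis by (simp add: bessel_I_def clifford_def)
  qed
  have wsum: "w sums (clifford \<nu> (- c) - rGamma (1 + \<nu>))"
  proof -
    have "(\<lambda>k. clifford_coeff \<nu> (Suc k) * (- c) ^ Suc k) sums (clifford \<nu> (- c) - rGamma (1 + \<nu>))"
      using clifford_sums[of \<nu> "- c"] by (subst sums_Suc_iff) (simp add: clifford_coeff_0)
    moreover have "clifford_coeff \<nu> (Suc k) * (- c) ^ Suc k = w k" for k
    proof -
      have "(- c) ^ Suc k = (- 1) ^ Suc k * c ^ Suc k" by (rule power_minus)
      moreover have "(- 1) ^ Suc k * (- 1) ^ Suc k = (1::real)" by (simp add: power_mult_distrib[symmetric])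
      moreover have "((e * r) / f) * (e * C) = C * r / f" if "e * e = 1" for e r f C :: real
      proof -
        have "((e * r) / f) * (e * C) = (e * e) * (C * r / f)" by (simp only: mult_ac times_divide_eq_left times_divide_eq_right)
        thus ?thesis using that by simp
      qed
      moreover have "\<nu> + real (Suc k) + 1 = 2 + \<nu> + real k" by simp
      ultimately show ?thesis unfolding clifford_coeff_def w_def by (simp only:)
    qed
    ultimately show ?thesis by simp
  qed
  have nI: "Gamma (1 + \<nu>) * (clifford \<nu> (- c) - rGamma (1 + \<nu>)) = normalized_I \<nu> b - 1"
  proof -
    have "(b / 2) powr (- \<nu>) * (b / 2) powr \<nu> = 1" using powr_mult_powr[of "- \<nu>" \<nu> 0 "b / 2"] b by simp
    hence "normalized_I \<nu> b = Gamma (1 + \<nu>) * clifford \<nu> (- c)"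
      unfolding normalized_I_def I by (simp add: mult.assoc[symmetric])
    thus ?thesis using G by (simp add: right_diff_distrib)
  qed
  have kap: "kappa \<nu> b = Digamma 2 + Digamma (2 + \<nu>) - ln c"
  proof -
    have "Digamma (2::real) = 1 - euler_mascheroni"
      using Digamma_plus1[of "1::real"] by simp
    thus ?thesis by (simp add: kappa_def c_def)
  qed
  let ?D = "\<lambda>n. (Digamma (2 + real n) - Digamma 2) + (Digamma (2 + \<nu> + real n) - Digamma (2 + \<nu>))"
  have wD: "(\<lambda>n. w n * ?D n) sums (- ?L - kappa \<nu> b * (clifford \<nu> (- c) - rGamma (1 + \<nu>)))"
  proof -
    have "(\<lambda>n. - (- (w n * (?psi n - ln c))) - kappa \<nu> b * w n) sums (- ?L - kappa \<nu> b * (clifford \<nu> (- c) - rGamma (1 + \<nu>)))"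
      by (intro sums_diff sums_minus L sums_mult wsum)
    moreover have "- (- (w n * (?psi n - ln c))) - kappa \<nu> b * w n = w n * ?D n" for n
      unfolding kap by (simp add: algebra_simps)
    ultimately show ?thesis by simp
  qed
  have trm: "Gamma (1 + \<nu>) * (w n * ?D n) = c / (1 + \<nu>) * (c ^ n / (pochhammer 2 n * pochhammer (2 + \<nu>) n) * ?D n)" for n
  proof -
    have 1: "rGamma (1 + \<nu>) = (1 + \<nu>) * rGamma (2 + \<nu>)" using rGamma_plus1[of "1 + \<nu>"] by (simp add: add_ac)
    have 2: "rGamma (2 + \<nu>) = pochhammer (2 + \<nu>) n * rGamma (2 + \<nu> + real n)" by (rule pochhammer_rGamma)
    have e: "Gamma (1 + \<nu>) * ((1 + \<nu>) * (pochhammer (2 + \<nu>) n * rGamma (2 + \<nu> + real n))) = 1"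
      using G unfolding 1 2 .
    have p0: "pochhammer (2 + \<nu>) n \<noteq> 0" "1 + \<nu> \<noteq> 0" using e by auto
    have "Gamma (1 + \<nu>) * rGamma (2 + \<nu> + real n) * ((1 + \<nu>) * pochhammer (2 + \<nu>) n) = 1"
      using e by (simp only: mult_ac)
    hence "Gamma (1 + \<nu>) * rGamma (2 + \<nu> + real n) = 1 / ((1 + \<nu>) * pochhammer (2 + \<nu>) n)"
      using p0 by (subst eq_divide_eq) simp
    moreover have "pochhammer 2 n = (fact (Suc n) :: real)"
      using pochhammer_rec[of "1::real" n] by (simp add: pochhammer_fact[symmetric] del: fact_Suc)
    moreover have "g * ((C * c) * r / f * d) = c / x * (C / (f * p) * d)" if "g * r = 1 / (x * p)" for g C r f d x p
    proof -
      have "g * ((C * c) * r / f * d) = (g * r) * (C * c) / f * d" by simp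
      thus ?thesis unfolding that by (simp add: mult_ac)
    qed
    moreover have "c ^ Suc n = c ^ n * c" by simp
    ultimately show ?thesis unfolding w_def by (simp only:)
  qed
  have "(\<lambda>n. Gamma (1 + \<nu>) * (w n * ?D n)) sums (Gamma (1 + \<nu>) * (- ?L - kappa \<nu> b * (clifford \<nu> (- c) - rGamma (1 + \<nu>))))"
    by (rule sums_mult[OF wD])
  hence s: "(\<lambda>n. c / (1 + \<nu>) * (c ^ n / (pochhammer 2 n * pochhammer (2 + \<nu>) n) * ?D n)) sums
      (Gamma (1 + \<nu>) * (- ?L - kappa \<nu> b * (clifford \<nu> (- c) - rGamma (1 + \<nu>))))"
    unfolding trm .
  have x0: "c / (1 + \<nu>) \<noteq> 0" using c nn[of 0] by simp
  have "c / (1 + \<nu>) * F_star \<nu> b = Gamma (1 + \<nu>) * (- ?L - kappa \<nu> b * (clifford \<nu> (- c) - rGamma (1 + \<nu>)))"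
  proof -
    from sums_mult[OF s, of "(1 + \<nu>) / c"]
    have "(\<lambda>n. c ^ n / (pochhammer 2 n * pochhammer (2 + \<nu>) n) * ?D n) sums
      ((1 + \<nu>) / c * (Gamma (1 + \<nu>) * (- ?L - kappa \<nu> b * (clifford \<nu> (- c) - rGamma (1 + \<nu>)))))"
      using c nn[of 0] by simp
    hence "F_star \<nu> b = (1 + \<nu>) / c * (Gamma (1 + \<nu>) * (- ?L - kappa \<nu> b * (clifford \<nu> (- c) - rGamma (1 + \<nu>))))"
      unfolding F_star_def c_def[symmetric] by (simp only: sums_iff)
    thus ?thesis using c nn[of 0] by simp
  qed
  also have "\<dots> = - Gamma (1 + \<nu>) * ?L - kappa \<nu> b * (Gamma (1 + \<nu>) * (clifford \<nu> (- c) - rGamma (1 + \<nu>)))"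
    by (simp add: algebra_simps)
  finally show ?thesis unfolding nI by (simp add: c_def algebra_simps)
qed

text \<open>The polynomial \<open>F\<^sub>k\<close> is the Cauchy product that gives the Taylor coefficient of
  \<open>h\<close>. The quotients of Pochhammer symbols are the binomial coefficients, after \<open>(\<mu>)\<^sub>k =
  (\<mu>)\<^bsub>k-i\<^esub> (\<mu>+k-i)\<^sub>i\<close> has been used.\<close>

lemma F_poly_eq_profile_coeff:
  assumes mu: "\<mu> > 0" and nu: "\<And>m::nat. m \<ge> 1 \<Longrightarrow> \<nu> \<noteq> - real m"
  shows "(-1) ^ k / fact k * pochhammer \<mu> k * F_poly k \<mu> \<nu> b = Gamma (1 + \<nu>) * profile_coeff (chi b) \<nu> \<mu> k"
proof -
  let ?c = "chi b"
  have np: "1 + \<nu> \<notin> \<int>\<^sub>\<le>\<^sub>0"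
  proof
    assume "1 + \<nu> \<in> \<int>\<^sub>\<le>\<^sub>0"
    then obtain j where "1 + \<nu> = - real j" by (auto elim!: nonpos_Ints_cases')
    thus False using nu[of "Suc j"] by simp
  qed
  have trm: "(-1) ^ k / fact k * pochhammer \<mu> k *
      (pochhammer (- real k) i / (pochhammer (1 - \<mu> - real k) i * pochhammer (1 + \<nu>) i) * (?c ^ i / fact i))
      = Gamma (1 + \<nu>) * (clifford_coeff \<nu> i * ?c ^ i * (- \<mu> gchoose (k - i)))" if i: "i \<le> k" for i
  proof -
    have 1: "pochhammer (- real k) i = (-1) ^ i * (fact k / fact (k - i))"
    proof -
      have "complex_of_real ((-1) ^ i * pochhammer (- real k) i) = of_real (fact k / fact (k - i))"
        using pochhammer_minus_of_nat[OF i] by (simp add: pochhammer_of_real[symmetric])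
      hence "(-1) ^ i * pochhammer (- real k) i = fact k / fact (k - i)" by (simp only: of_real_eq_iff)
      hence "(-1) ^ i * ((-1) ^ i * pochhammer (- real k) i) = (-1) ^ i * (fact k / fact (k - i))" by simp
      thus ?thesis by (simp add: mult.assoc[symmetric] power_mult_distrib[symmetric])
    qed
    define p where "p = pochhammer (\<mu> + real (k - i)) i"
    have 2: "pochhammer (1 - \<mu> - real k) i = (-1) ^ i * p"
      using pochhammer_minus[of "\<mu> + real k - 1" i] i by (simp add: p_def of_nat_diff algebra_simps)
    have 3: "pochhammer \<mu> k = pochhammer \<mu> (k - i) * p"
      using pochhammer_product[of "k - i" k \<mu>] i by (simp add: p_def)
    have p0: "p \<noteq> 0" unfolding p_def using mu by (intro pochhammer_pos less_imp_neq[symmetric]) simp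
    have 4: "Gamma (1 + \<nu>) * rGamma (\<nu> + real i + 1) = 1 / pochhammer (1 + \<nu>) i"
    proof -
      have "rGamma (1 + \<nu>) = pochhammer (1 + \<nu>) i * rGamma (\<nu> + real i + 1)"
        using pochhammer_rGamma[of "1 + \<nu>" i] by (simp add: add_ac)
      moreover have "rGamma (1 + \<nu>) \<noteq> 0" using np by (simp add: rGamma_eq_zero_iff)
      ultimately show ?thesis unfolding Gamma_def by (auto simp: inverse_eq_divide)
    qed
    have 5: "(- \<mu> gchoose (k - i)) = (-1) ^ (k - i) * pochhammer \<mu> (k - i) / fact (k - i)"
      by (simp add: gbinomial_pochhammer)
    have sgn: "(-1) ^ i * (-1) ^ (k - i) = (-1 :: real) ^ k" using i by (simp add: power_add[symmetric])
    have "(-1) ^ k / fact k * pochhammer \<mu> k *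
      (pochhammer (- real k) i / (pochhammer (1 - \<mu> - real k) i * pochhammer (1 + \<nu>) i) * (?c ^ i / fact i))
      = (-1) ^ k * (pochhammer \<mu> (k - i) / fact (k - i)) * (1 / pochhammer (1 + \<nu>) i) * (?c ^ i / fact i)"
    proof -
      have gen: "s / f * (q * p) * ((e * (f / g)) / ((e * p) * n) * C) = s * (q / g) * (1 / n) * C"
        if "f \<noteq> 0" "e \<noteq> 0" "p \<noteq> 0" for s f q p e g n C :: real
        using that by (cases "g = 0"; cases "n = 0") (simp_all add: field_simps)
      show ?thesis unfolding 1 2 3 by (rule gen) (simp_all add: p0)
    qed
    also have "\<dots> = ((-1) ^ i * (-1) ^ (k - i)) * (pochhammer \<mu> (k - i) / fact (k - i)) * (Gamma (1 + \<nu>) * rGamma (\<nu> + real i + 1)) * (?c ^ i / fact i)"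
      unfolding 4 sgn ..
    also have "\<dots> = Gamma (1 + \<nu>) * (clifford_coeff \<nu> i * ?c ^ i * (- \<mu> gchoose (k - i)))"
      unfolding 5 clifford_coeff_def by (simp add: mult_ac)
    finally show ?thesis .
  qed
  have "(-1) ^ k / fact k * pochhammer \<mu> k * F_poly k \<mu> \<nu> b
      = (\<Sum>i\<le>k. (-1) ^ k / fact k * pochhammer \<mu> k *
      (pochhammer (- real k) i / (pochhammer (1 - \<mu> - real k) i * pochhammer (1 + \<nu>) i) * (?c ^ i / fact i)))"
    unfolding F_poly_def sum_distrib_left atLeast0AtMost ..
  also have "\<dots> = (\<Sum>i\<le>k. Gamma (1 + \<nu>) * (clifford_coeff \<nu> i * ?c ^ i * (- \<mu> gchoose (k - i))))"
    by (intro sum.cong refl trm) simp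
  finally show ?thesis by (simp add: profile_coeff_def sum_distrib_left)
qed

section \<open>The constant of the expansion\<close>

lemma profile_of_real:
  "profile c \<nu> \<mu> (of_real t) = of_real (clifford \<nu> (c * t ^ 2) * (1 + t ^ 2) powr (- \<mu>))"
proof -
  have "clifford_sq c \<nu> (of_real t) = of_real (clifford \<nu> (c * t ^ 2))"
    by (simp add: clifford_sq_def flip: clifford_of_real)
  moreover have "lorentz_power \<mu> (of_real t) = of_real ((1 + t ^ 2) powr (- \<mu>))"
    using powr_of_real[of "1 + t ^ 2" "- \<mu>"] by (simp add: lorentz_power_def)
  ultimately show ?thesis by (simp add: profile_def)
qed

text \<open>The substitution \<open>y = c t\<^sup>2\<close>, for which \<open>dt/t = dy/(2y)\<close>: the function
  \<open>y \<mapsto> prim (sqrt (y/c))\<close> is a primitive of half the integrand of the regularized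
  integral.\<close>

lemma primitive_limit:
  assumes c: "c > 0" and mu: "\<mu> > 0" and cond: "2 * \<mu> + \<nu> > - 1 / 2"
    and prim: "\<And>z. z \<in> unit_strip \<Longrightarrow> (prim has_field_derivative profile_quotient c \<nu> \<mu> z) (at z)"
  shows "((\<lambda>T. prim (of_real T) - prim 0 + of_real (rGamma (1 + \<nu>) * ln T)) \<longlongrightarrow>
     of_real (((LINT y:{0<..}|lborel. regular_kernel c \<nu> \<mu> y) - rGamma (1 + \<nu>) * (Digamma \<mu> + euler_mascheroni)) / 2)) at_top"
proof -
  let ?a = "rGamma (1 + \<nu>)"
  define \<eta> where "\<eta> = (\<lambda>y. (clifford \<nu> y * (1 + y / c) powr (- \<mu>) - ?a) / y)"
  let ?Q = "\<lambda>y. complex_of_real (sqrt (y / c))"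
  have lim: "((\<lambda>Y. integral {0..Y} \<eta> + ?a * ln (Y / c)) \<longlongrightarrow>
     (LINT y:{0<..}|lborel. regular_kernel c \<nu> \<mu> y) - ?a * (Digamma \<mu> + euler_mascheroni)) at_top"
    unfolding \<eta>_def by (rule regularized_integral_limit[OF c mu cond])
  have eta: "((\<lambda>y. complex_of_real (\<eta> y / 2)) has_integral (prim (?Q Y) - prim (?Q 0))) {0..Y}" if Y: "Y \<ge> 0" for Y
  proof (rule fundamental_theorem_of_calculus_interior[OF Y, of "\<lambda>y. prim (?Q y)"])
    have cp: "isCont prim (?Q y)" for y using DERIV_isCont[OF prim[OF of_real_in_unit_strip]] .
    show "continuous_on {0..Y} (\<lambda>y. prim (?Q y))"
    proof (intro continuous_at_imp_continuous_on ballI)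
      fix y
      have "isCont ?Q y" using c by (auto intro!: continuous_intros)
      thus "isCont (\<lambda>y. prim (?Q y)) y" by (rule isCont_o2) (rule cp)
    qed
  next
    fix y assume "y \<in> {0<..<Y}"
    hence y: "y > 0" by simp
    have s: "((\<lambda>y. sqrt (y / c)) has_field_derivative (inverse (sqrt (y / c)) / 2 * (1 / c))) (at y)"
      using y c by (auto intro!: derivative_eq_intros simp: field_simps)
    have "((prim \<circ> ?Q) has_vector_derivative (of_real (inverse (sqrt (y / c)) / 2 * (1 / c)) * profile_quotient c \<nu> \<mu> (?Q y))) (at y)"
      by (rule field_vector_diff_chain_at[OF has_vector_derivative_of_real[OF s] prim[OF of_real_in_unit_strip]])
    moreover have "of_real (inverse (sqrt (y / c)) / 2 * (1 / c)) * profile_quotient c \<nu> \<mu> (?Q y) = complex_of_real (\<eta> y / 2)"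
    proof -
      have nz: "sqrt (y / c) \<noteq> 0" and sq: "(sqrt (y / c))\<^sup>2 = y / c" using y c by simp_all
      have "profile_quotient c \<nu> \<mu> (?Q y) = of_real ((clifford \<nu> y * (1 + y / c) powr (- \<mu>) - ?a) / sqrt (y / c))"
        using nz c unfolding profile_quotient_def profile_of_real sq profile_at_0 by simp
      moreover have "inverse (sqrt (y / c)) / 2 * (1 / c) * (h / sqrt (y / c)) = h / y / 2" for h
      proof -
        have "inverse (sqrt (y / c)) / 2 * (1 / c) * (h / sqrt (y / c)) = h / (2 * c * (sqrt (y / c))\<^sup>2)"
          by (simp only: power2_eq_square) (simp add: field_simps)
        thus ?thesis unfolding sq using c by simp
      qed
      ultimately show ?thesis unfolding \<eta>_def by (simp only: of_real_mult[symmetric])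
    qed
    ultimately show "((\<lambda>y. prim (?Q y)) has_vector_derivative complex_of_real (\<eta> y / 2)) (at y)"
      by (simp only: o_def)
  qed
  \<comment> \<open>The integral is real, so the primitive has real increments along the real axis.\<close>
  have prim_eq: "prim (of_real T) - prim 0 = of_real (integral {0..c * T\<^sup>2} \<eta> / 2)" if T: "T > 0" for T
  proof -
    have Y: "c * T\<^sup>2 \<ge> 0" using c by simp
    note e = eta[OF Y]
    have "((\<lambda>y. Re (complex_of_real (\<eta> y / 2))) has_integral Re (prim (?Q (c * T\<^sup>2)) - prim (?Q 0))) {0..c * T\<^sup>2}"
      by (rule has_integral_Re[OF e])
    hence r: "((\<lambda>y. \<eta> y / 2) has_integral Re (prim (?Q (c * T\<^sup>2)) - prim (?Q 0))) {0..c * T\<^sup>2}" by simp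
    have "prim (?Q (c * T\<^sup>2)) - prim (?Q 0) = of_real (Re (prim (?Q (c * T\<^sup>2)) - prim (?Q 0)))"
      by (rule has_integral_unique[OF e has_integral_of_real[OF r]])
    moreover have "Re (prim (?Q (c * T\<^sup>2)) - prim (?Q 0)) = integral {0..c * T\<^sup>2} \<eta> / 2"
      using integral_unique[OF r] by simp
    moreover have "?Q (c * T\<^sup>2) = of_real T" "?Q 0 = 0" using c T by simp_all
    ultimately show ?thesis by (simp only:)
  qed
  have "filterlim (\<lambda>T. c * T\<^sup>2) at_top at_top"
    using c by real_asymp
  from filterlim_compose[OF lim this]
  have "((\<lambda>T. integral {0..c * T\<^sup>2} \<eta> + ?a * ln (c * T\<^sup>2 / c)) \<longlongrightarrow>
     (LINT y:{0<..}|lborel. regular_kernel c \<nu> \<mu> y) - ?a * (Digamma \<mu> + euler_mascheroni)) at_top" .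
  hence "((\<lambda>T. complex_of_real ((integral {0..c * T\<^sup>2} \<eta> + ?a * ln (c * T\<^sup>2 / c)) / 2)) \<longlongrightarrow>
     of_real (((LINT y:{0<..}|lborel. regular_kernel c \<nu> \<mu> y) - ?a * (Digamma \<mu> + euler_mascheroni)) / 2)) at_top"
    by (intro tendsto_intros) auto
  moreover have "\<forall>\<^sub>F T in at_top. complex_of_real ((integral {0..c * T\<^sup>2} \<eta> + ?a * ln (c * T\<^sup>2 / c)) / 2)
      = prim (of_real T) - prim 0 + of_real (?a * ln T)"
    using eventually_gt_at_top[of 0]
  proof eventually_elim
    case (elim T)
    have "ln (c * T\<^sup>2 / c) = 2 * ln T" using c elim by (simp add: ln_realpow)
    thus ?case unfolding prim_eq[OF elim] by (simp add: add_divide_distrib)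
  qed
  ultimately show ?thesis by (rule Lim_transform_eventually)
qed

section \<open>The asymptotic expansion\<close>

lemma bessel_J_eq_clifford: "bessel_J \<nu> x = (x / 2) powr \<nu> * clifford \<nu> ((x / 2)\<^sup>2)"
  by (simp add: bessel_J_def clifford_def clifford_coeff_def power_mult)

text \<open>The powers of \<open>n\<close> combine to \<open>1/n\<close> because the exponents add up to
  \<open>-1\<close>.\<close>

lemma bessel_sum_term:
  assumes b: "b > 0" and a: "a > 0" and N: "N > 0"
  shows "N powr (- 1 - \<nu>) * bessel_J \<nu> (N * b / a) / (N\<^sup>2 + a\<^sup>2) powr \<mu>
    = a powr (- \<nu> - 2 * \<mu>) * (b / 2) powr \<nu> * (clifford \<nu> (chi b * (N / a)\<^sup>2) * (1 + (N / a)\<^sup>2) powr (- \<mu>) / N)"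
proof -
  have arg: "(N * b / a / 2)\<^sup>2 = chi b * (N / a)\<^sup>2" by (simp add: chi_def power_mult_distrib power_divide mult.commute)
  have "(N * b / a / 2) powr \<nu> = (N * (b / 2) * (1 / a)) powr \<nu>" by (simp add: mult_ac)
  also have "\<dots> = N powr \<nu> * (b / 2) powr \<nu> * a powr (- \<nu>)"
    using a b N by (simp only: powr_mult) (simp add: powr_divide powr_minus_divide)
  finally have p: "(N * b / a / 2) powr \<nu> = N powr \<nu> * (b / 2) powr \<nu> * a powr (- \<nu>)" .
  have "N\<^sup>2 + a\<^sup>2 = a\<^sup>2 * (1 + (N / a)\<^sup>2)" using a by (simp add: field_simps)
  hence "(N\<^sup>2 + a\<^sup>2) powr \<mu> = (a\<^sup>2) powr \<mu> * (1 + (N / a)\<^sup>2) powr \<mu>" by (simp only: powr_mult)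
  also have "(a\<^sup>2) powr \<mu> = a powr (2 * \<mu>)" using a by (simp add: powr_powr flip: powr_numeral)
  finally have "1 / (N\<^sup>2 + a\<^sup>2) powr \<mu> = a powr (- 2 * \<mu>) * (1 + (N / a)\<^sup>2) powr (- \<mu>)"
    by (simp add: powr_minus_divide)
  moreover have "N powr (- 1 - \<nu>) * N powr \<nu> = 1 / N"
    using powr_mult_powr[of "- 1 - \<nu>" \<nu> "- 1" N] N by (simp add: powr_minus_divide)
  moreover have "a powr (- \<nu>) * a powr (- 2 * \<mu>) = a powr (- \<nu> - 2 * \<mu>)"
    by (rule powr_mult_powr) simp
  moreover have "n * (n' * B * a1 * J) / D = a3 * B * (J * y / N)"
    if "1 / D = a2 * y" "n * n' = 1 / N" "a1 * a2 = a3" for n n' B a1 J D a2 y a3 :: real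
  proof -
    have "n * (n' * B * a1 * J) / D = (n * n') * (B * a1 * J) * (1 / D)" by simp
    also have "\<dots> = (a1 * a2) * B * (J * y / N)" unfolding that(1,2) by simp
    finally show ?thesis unfolding that(3) .
  qed
  ultimately show ?thesis unfolding bessel_J_eq_clifford p arg by blast
qed

text \<open>Terms with odd \<open>j\<close> contain an even derivative of the odd function \<open>q\<close> at 0 and
  vanish. In those with \<open>j = 2k\<close> the factorial from the Taylor coefficient completes the Bernoulli
  coefficient to a zeta value.\<close>

lemma euler_maclaurin_terms_eq_zeta_values:
  "(\<Sum>j=1..2 * K. (-1) ^ j * of_real (bernoulli_coeff j) * of_real ((1 / a) ^ j) * (deriv ^^ (j - 1)) (profile_quotient c \<nu> \<mu>) 0)
     = of_real (- (\<Sum>k=1..K. Re (riemann_zeta (1 - 2 * of_nat k)) * profile_coeff c \<nu> \<mu> k * (1 / a) ^ (2 * k)))"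
proof (induction K)
  case (Suc K)
  let ?t = "\<lambda>j. (-1) ^ j * of_real (bernoulli_coeff j) * of_real ((1 / a) ^ j) * (deriv ^^ (j - 1)) (profile_quotient c \<nu> \<mu>) 0"
  have "(\<Sum>j=1..2 * Suc K. ?t j) = (\<Sum>j=1..2 * K. ?t j) + ?t (Suc (2 * K)) + ?t (2 * Suc K)"
    by (simp add: sum.atLeast1_atMost_eq)
  moreover have "?t (Suc (2 * K)) = 0" by (simp add: profile_quotient_derivs)
  moreover have "?t (2 * Suc K) = of_real (- (Re (riemann_zeta (1 - 2 * of_nat (Suc K))) * profile_coeff c \<nu> \<mu> (Suc K) * (1 / a) ^ (2 * Suc K)))"
  proof -
    have z: "Re (riemann_zeta (1 - 2 * of_nat (Suc K))) = - (bernoulli_coeff (2 * Suc K) * fact (2 * Suc K - 1))"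
      unfolding riemann_zeta_neg_odd[of "Suc K", OF le_add1[of 1 K, unfolded plus_1_eq_Suc]]
      by (simp only: uminus_complex.sel Re_complex_of_real)
    have d: "(deriv ^^ (2 * Suc K - 1)) (profile_quotient c \<nu> \<mu>) 0 = of_real (fact (2 * Suc K - 1) * profile_coeff c \<nu> \<mu> (Suc K))"
      by (subst profile_quotient_derivs) (simp del: fact_Suc funpow.simps)
    have "(-1) ^ (2 * Suc K) = (1 :: complex)" by (simp add: power_mult)
    thus ?thesis unfolding z d by (simp only: of_real_mult of_real_minus mult_1) (simp only: mult_ac mult_minus_left mult_minus_right minus_minus)
  qed
  ultimately show ?case unfolding Suc.IH by simp
qed simp

text \<open>The expansion with its constant as an integral, and with as many terms as the error allows: the sum
  includes the term \<open>k = K\<close>.\<close>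

lemma bessel_sum_expansion:
  assumes b: "b > 0" and mu: "\<mu> > 0" and cond: "2 * \<mu> + \<nu> > - 1 / 2" and K: "K \<ge> 1"
  shows "\<exists>C\<ge>0. \<forall>a>0. \<exists>E. \<bar>E\<bar> \<le> C * (1 / a) ^ (2 * K) \<and>
     bessel_sum (- 1 - \<nu>) \<mu> \<nu> a b = a powr (- \<nu> - 2 * \<mu>) * (b / 2) powr \<nu> *
       (rGamma (1 + \<nu>) * (euler_mascheroni + ln a)
        + ((LINT y:{0<..}|lborel. regular_kernel (chi b) \<nu> \<mu> y) - rGamma (1 + \<nu>) * (Digamma \<mu> + euler_mascheroni)) / 2
        + (\<Sum>k=1..K. Re (riemann_zeta (1 - 2 * of_nat k)) * profile_coeff (chi b) \<nu> \<mu> k * (1 / a) ^ (2 * k)) + E)"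
proof -
  let ?c = "chi b"
  let ?L = "((LINT y:{0<..}|lborel. regular_kernel (chi b) \<nu> \<mu> y) - rGamma (1 + \<nu>) * (Digamma \<mu> + euler_mascheroni)) / 2"
  let ?S = "\<lambda>a. \<Sum>k=1..K. Re (riemann_zeta (1 - 2 * of_nat k)) * profile_coeff ?c \<nu> \<mu> k * (1 / a) ^ (2 * k)"
  have c: "?c > 0" using b by (simp add: chi_def)
  have cond': "- \<nu> - 1 / 2 - 2 * \<mu> < 0" using cond by linarith
  obtain prim where prim: "\<And>z. z \<in> unit_strip \<Longrightarrow> (prim has_field_derivative profile_quotient ?c \<nu> \<mu> z) (at z)"
    using profile_quotient_primitive[of ?c \<nu> \<mu>] by blast
  \<comment> \<open>Stopping at \<open>j = 2K\<close> makes the error \<open>O(a powr (-2K))\<close>.\<close>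
  have M: "Suc (2 * K - 1) = 2 * K" using K by simp
  show ?thesis
  proof (rule profile_sum_euler_maclaurin[where M = "2 * K - 1", OF c cond' prim primitive_limit[OF c mu cond prim]])
    fix C :: real assume C: "C \<ge> 0" and E: "\<And>a. a > 0 \<Longrightarrow> \<exists>E. norm E \<le> C * (1 / a) ^ Suc (2 * K - 1) \<and>
     (\<lambda>n. profile ?c \<nu> \<mu> (of_real ((real n + 1) / a)) / (of_nat n + 1)) sums
        (of_real (rGamma (1 + \<nu>) * (euler_mascheroni + ln a)) + of_real ?L
         - (\<Sum>j=1..Suc (2 * K - 1). (-1) ^ j * of_real (bernoulli_coeff j) * of_real ((1 / a) ^ j)
              * (deriv ^^ (j - 1)) (profile_quotient ?c \<nu> \<mu>) 0) + E)"
    show ?thesis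
    proof (rule exI[of _ C], intro conjI C allI impI)
      fix a :: real assume a: "a > 0"
      let ?P = "a powr (- \<nu> - 2 * \<mu>) * (b / 2) powr \<nu>"
      obtain E where E1: "norm E \<le> C * (1 / a) ^ (2 * K)" and E2:
        "(\<lambda>n. profile ?c \<nu> \<mu> (of_real ((real n + 1) / a)) / (of_nat n + 1)) sums
          (of_real (rGamma (1 + \<nu>) * (euler_mascheroni + ln a)) + of_real ?L - of_real (- ?S a) + E)"
        using E[OF a] unfolding M euler_maclaurin_terms_eq_zeta_values by blast
      have "(\<lambda>n. ?P * Re (profile ?c \<nu> \<mu> (of_real ((real n + 1) / a)) / (of_nat n + 1))) sums
          (?P * Re (of_real (rGamma (1 + \<nu>) * (euler_mascheroni + ln a)) + of_real ?L - of_real (- ?S a) + E))"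
        by (intro sums_mult sums_Re E2)
      moreover have "?P * Re (profile ?c \<nu> \<mu> (of_real ((real n + 1) / a)) / (of_nat n + 1))
         = real (Suc n) powr (- 1 - \<nu>) * bessel_J \<nu> (real (Suc n) * b / a) / ((real (Suc n))\<^sup>2 + a\<^sup>2) powr \<mu>" for n
      proof -
        have "complex_of_nat n + 1 = of_real (real (Suc n))" "real n + 1 = real (Suc n)" by simp_all
        hence "Re (profile ?c \<nu> \<mu> (of_real ((real n + 1) / a)) / (of_nat n + 1))
          = clifford \<nu> (?c * (real (Suc n) / a)\<^sup>2) * (1 + (real (Suc n) / a)\<^sup>2) powr (- \<mu>) / real (Suc n)"
          unfolding profile_of_real by (simp only: of_real_divide[symmetric] Re_complex_of_real)
        thus ?thesis using bessel_sum_term[OF b a, of "real (Suc n)" \<nu> \<mu>] by simp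
      qed
      ultimately have "bessel_sum (- 1 - \<nu>) \<mu> \<nu> a b
          = ?P * Re (of_real (rGamma (1 + \<nu>) * (euler_mascheroni + ln a)) + of_real ?L - of_real (- ?S a) + E)"
        unfolding bessel_sum_def by (simp only: sums_iff)
      also have "\<dots> = ?P * (rGamma (1 + \<nu>) * (euler_mascheroni + ln a) + ?L + ?S a + Re E)"
        by (simp only: plus_complex.sel minus_complex.sel Re_complex_of_real diff_minus_eq_add)
      finally have "bessel_sum (- 1 - \<nu>) \<mu> \<nu> a b = ?P * (rGamma (1 + \<nu>) * (euler_mascheroni + ln a) + ?L + ?S a + Re E)" .
      moreover have "\<bar>Re E\<bar> \<le> C * (1 / a) ^ (2 * K)"
        using abs_Re_le_cmod[of E] E1 by linarith
      ultimately show "\<exists>E. \<bar>E\<bar> \<le> C * (1 / a) ^ (2 * K) \<and>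
         bessel_sum (- 1 - \<nu>) \<mu> \<nu> a b = ?P * (rGamma (1 + \<nu>) * (euler_mascheroni + ln a) + ?L + ?S a + E)" by blast
    qed
  qed
qed

text \<open>Both forms of \<open>R(a)\<close> express the same integral. At \<open>\<mu> = 1\<close> the digamma
  contribution disappears since \<open>\<psi>(1) = -\<gamma>\<^sub>E\<close>.\<close>

lemma main_term_eq:
  assumes b: "b > 0" and a: "a > 0" and mu: "\<mu> > 0" and cond: "2 * \<mu> + \<nu> > - 1 / 2"
    and nu: "\<And>m::nat. m \<ge> 1 \<Longrightarrow> \<nu> \<noteq> - real m" and alt: "\<mu> \<notin> \<int> \<or> \<mu> = 1"
  shows "a powr (- 1 - \<nu> - 2 * \<mu>) * main_term \<mu> \<nu> b a
    = a powr (- \<nu> - 2 * \<mu>) * (b / 2) powr \<nu> * (rGamma (1 + \<nu>) * (euler_mascheroni + ln a)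
        + ((LINT y:{0<..}|lborel. regular_kernel (chi b) \<nu> \<mu> y) - rGamma (1 + \<nu>) * (Digamma \<mu> + euler_mascheroni)) / 2)"
proof -
  let ?I = "LINT y:{0<..}|lborel. regular_kernel (chi b) \<nu> \<mu> y"
  let ?r = "rGamma (1 + \<nu>)"
  have G0: "Gamma \<mu> > 0" using mu by (rule Gamma_real_pos)
  have "1 + \<nu> \<notin> \<int>\<^sub>\<le>\<^sub>0"
  proof
    assume "1 + \<nu> \<in> \<int>\<^sub>\<le>\<^sub>0"
    then obtain j where "1 + \<nu> = - real j" by (auto elim!: nonpos_Ints_cases')
    thus False using nu[of "Suc j"] by simp
  qed
  hence r: "?r \<noteq> 0" "Gamma (1 + \<nu>) = 1 / ?r" by (simp_all add: rGamma_eq_zero_iff Gamma_def inverse_eq_divide)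
  have "main_term \<mu> \<nu> b a = a * ((b / 2) powr \<nu> * (?r * (euler_mascheroni + ln a) + (?I - ?r * (Digamma \<mu> + euler_mascheroni)) / 2))"
  proof (cases "\<mu> = 1")
    case True
    have "main_term \<mu> \<nu> b a = a * coeff_B 1 \<nu> b / Gamma (1 + \<nu>) *
          (2 * ln a + 2 * euler_mascheroni + (kappa \<nu> b * (1 - normalized_I \<nu> b) - chi b * F_star \<nu> b / (1 + \<nu>)))"
      using True by (simp add: main_term_def)
    also have "kappa \<nu> b * (1 - normalized_I \<nu> b) - chi b * F_star \<nu> b / (1 + \<nu>) = Gamma (1 + \<nu>) * ?I"
      using integral_kernel_1_eq[OF b nu] cond True by simp
    also have "a * coeff_B 1 \<nu> b / Gamma (1 + \<nu>) * (2 * ln a + 2 * euler_mascheroni + Gamma (1 + \<nu>) * ?I)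
        = a * ((b / 2) powr \<nu> * (?r * (euler_mascheroni + ln a) + ?I / 2))"
    proof -
      have "a * (B / 2) / (1 / r) * (2 * l + 2 * e + 1 / r * I) = a * (B * (r * (e + l) + I / 2))"
        if "r \<noteq> 0" for B r l e I :: real
        using that by (simp add: distrib_left)
      moreover have "coeff_B 1 \<nu> b = (b / 2) powr \<nu> / 2" by (simp add: coeff_B_def)
      ultimately show ?thesis using r(1) unfolding r(2) by (simp only:)
    qed
    finally show ?thesis using True by simp
  next
    case False
    hence "coeff_A \<mu> \<nu> b = Gamma (1 + \<nu>) * ?I" using coeff_A_eq_integral[OF b mu _ cond] alt by blast
    moreover have "main_term \<mu> \<nu> b a = 2 * a * coeff_B \<mu> \<nu> b * Gamma \<mu> / Gamma (1 + \<nu>) *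
          (ln a + (1 / 2) * (coeff_A \<mu> \<nu> b + euler_mascheroni - Digamma \<mu>))"
      using False by (simp add: main_term_def)
    ultimately show ?thesis using r G0 by (simp add: coeff_B_def field_simps)
  qed
  moreover have "a powr (- 1 - \<nu> - 2 * \<mu>) * a = a powr (- \<nu> - 2 * \<mu>)"
    using powr_mult_powr[of "- 1 - \<nu> - 2 * \<mu>" 1 "- \<nu> - 2 * \<mu>" a] a by simp
  ultimately show ?thesis by (simp add: mult.assoc[symmetric])
qed

text \<open>The term \<open>k = K\<close> of the expansion has the order of the error, so the first \<open>K -
  1\<close> terms leave the claimed remainder.\<close>

theorem theorem2:
  fixes b \<mu> \<gamma> \<nu> :: real
  assumes "b > 0" and "\<mu> > 0"
    and "\<gamma> + \<nu> = -1"
    and "2 * \<mu> - \<gamma> > 1 / 2"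
    and "\<forall>m::nat. m \<ge> 1 \<longrightarrow> \<nu> \<noteq> - real m"
    and "(\<forall>m::nat. m \<ge> 1 \<longrightarrow> \<mu> \<noteq> real m) \<or> \<mu> = 1"
  shows "\<forall>K::nat. K \<ge> 1 \<longrightarrow>
    (\<lambda>a. (bessel_sum \<gamma> \<mu> \<nu> a b - a powr (\<gamma> - 2 * \<mu>) * main_term \<mu> \<nu> b a)
         - a powr (- \<nu> - 2 * \<mu>) * (b / 2) powr \<nu> / Gamma (1 + \<nu>) *
           (\<Sum>k=1..<K. (-1) ^ k / fact k * pochhammer \<mu> k
              * Re (riemann_zeta (1 - 2 * of_nat k)) * F_poly k \<mu> \<nu> b * a powr (- 2 * real k)))
    \<in> O[at_top](\<lambda>a. a powr (- \<nu> - 2 * \<mu> - 2 * real K))"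
proof (intro allI impI)
  fix K :: nat
  assume K: "K \<ge> 1"
  have gam: "\<gamma> = - 1 - \<nu>" using assms(3) by linarith
  have cond: "2 * \<mu> + \<nu> > - 1 / 2" using assms(4) unfolding gam by linarith
  have nu: "\<nu> \<noteq> - real m" if "m \<ge> 1" for m :: nat using assms(5) that by blast
  \<comment> \<open>As \<open>\<mu>\<close> is positive, being no positive integer means being no integer.\<close>
  have alt: "\<mu> \<notin> \<int> \<or> \<mu> = 1"
  proof (rule disjCI)
    assume ne: "\<mu> \<noteq> 1"
    show "\<mu> \<notin> \<int>"
    proof
      assume "\<mu> \<in> \<int>"
      then obtain m where m: "\<mu> = of_int m" by (rule Ints_cases)
      hence "\<mu> = real (nat m)" "nat m \<ge> 1" using assms(2) by simp_all
      thus False using assms(6) ne by blast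
    qed
  qed
  have G0: "Gamma (1 + \<nu>) \<noteq> 0"
    unfolding Gamma_eq_zero_iff
  proof
    assume "1 + \<nu> \<in> \<int>\<^sub>\<le>\<^sub>0"
    then obtain j where "1 + \<nu> = - real j" by (auto elim!: nonpos_Ints_cases')
    thus False using nu[of "Suc j"] by simp
  qed
  let ?P = "\<lambda>a. a powr (- \<nu> - 2 * \<mu>) * (b / 2) powr \<nu>"
  let ?p = "\<lambda>k. Re (riemann_zeta (1 - 2 * of_nat k)) * profile_coeff (chi b) \<nu> \<mu> k"
  obtain C where C: "C \<ge> 0" and E: "\<forall>a>0. \<exists>E. \<bar>E\<bar> \<le> C * (1 / a) ^ (2 * K) \<and>
     bessel_sum (- 1 - \<nu>) \<mu> \<nu> a b = ?P a *
       (rGamma (1 + \<nu>) * (euler_mascheroni + ln a)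
        + ((LINT y:{0<..}|lborel. regular_kernel (chi b) \<nu> \<mu> y) - rGamma (1 + \<nu>) * (Digamma \<mu> + euler_mascheroni)) / 2
        + (\<Sum>k=1..K. ?p k * (1 / a) ^ (2 * k)) + E)"
    using bessel_sum_expansion[OF assms(1,2) cond K] by blast
  show "(\<lambda>a. (bessel_sum \<gamma> \<mu> \<nu> a b - a powr (\<gamma> - 2 * \<mu>) * main_term \<mu> \<nu> b a)
         - a powr (- \<nu> - 2 * \<mu>) * (b / 2) powr \<nu> / Gamma (1 + \<nu>) *
           (\<Sum>k=1..<K. (-1) ^ k / fact k * pochhammer \<mu> k
              * Re (riemann_zeta (1 - 2 * of_nat k)) * F_poly k \<mu> \<nu> b * a powr (- 2 * real k)))
    \<in> O[at_top](\<lambda>a. a powr (- \<nu> - 2 * \<mu> - 2 * real K))"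
  proof (rule bigoI[where c = "(b / 2) powr \<nu> * (\<bar>?p K\<bar> + C)"])
    show "\<forall>\<^sub>F a in at_top. norm ((bessel_sum \<gamma> \<mu> \<nu> a b - a powr (\<gamma> - 2 * \<mu>) * main_term \<mu> \<nu> b a)
         - a powr (- \<nu> - 2 * \<mu>) * (b / 2) powr \<nu> / Gamma (1 + \<nu>) *
           (\<Sum>k=1..<K. (-1) ^ k / fact k * pochhammer \<mu> k
              * Re (riemann_zeta (1 - 2 * of_nat k)) * F_poly k \<mu> \<nu> b * a powr (- 2 * real k)))
        \<le> (b / 2) powr \<nu> * (\<bar>?p K\<bar> + C) * norm (a powr (- \<nu> - 2 * \<mu> - 2 * real K))"
      using eventually_gt_at_top[of 0]
    proof eventually_elim
      case (elim a)
      obtain E where E1: "\<bar>E\<bar> \<le> C * (1 / a) ^ (2 * K)" and E2: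
        "bessel_sum (- 1 - \<nu>) \<mu> \<nu> a b = ?P a *
       (rGamma (1 + \<nu>) * (euler_mascheroni + ln a)
        + ((LINT y:{0<..}|lborel. regular_kernel (chi b) \<nu> \<mu> y) - rGamma (1 + \<nu>) * (Digamma \<mu> + euler_mascheroni)) / 2
        + (\<Sum>k=1..K. ?p k * (1 / a) ^ (2 * k)) + E)"
        using E elim by blast
      have pw: "a powr (- 2 * real k) = (1 / a) ^ (2 * k)" for k
        using elim by (simp add: powr_minus powr_realpow[symmetric] power_divide inverse_eq_divide)
      have "(\<Sum>k=1..<K. (-1) ^ k / fact k * pochhammer \<mu> k
              * Re (riemann_zeta (1 - 2 * of_nat k)) * F_poly k \<mu> \<nu> b * a powr (- 2 * real k))
          = (\<Sum>k=1..<K. Gamma (1 + \<nu>) * (?p k * (1 / a) ^ (2 * k)))"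
      proof (rule sum.cong[OF refl])
        fix k
        have F: "(-1) ^ k / fact k * pochhammer \<mu> k * F_poly k \<mu> \<nu> b = Gamma (1 + \<nu>) * profile_coeff (chi b) \<nu> \<mu> k"
          by (rule F_poly_eq_profile_coeff[OF assms(2)]) (rule nu)
        have "(-1) ^ k / fact k * pochhammer \<mu> k * Re (riemann_zeta (1 - 2 * of_nat k)) * F_poly k \<mu> \<nu> b * a powr (- 2 * real k)
          = ((-1) ^ k / fact k * pochhammer \<mu> k * F_poly k \<mu> \<nu> b) * (Re (riemann_zeta (1 - 2 * of_nat k)) * (1 / a) ^ (2 * k))"
          unfolding pw by (simp only: mult_ac)
        also have "\<dots> = Gamma (1 + \<nu>) * (?p k * (1 / a) ^ (2 * k))"
          unfolding F by (simp only: mult_ac)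
        finally show "(-1) ^ k / fact k * pochhammer \<mu> k
              * Re (riemann_zeta (1 - 2 * of_nat k)) * F_poly k \<mu> \<nu> b * a powr (- 2 * real k)
            = Gamma (1 + \<nu>) * (?p k * (1 / a) ^ (2 * k))" .
      qed
      hence s: "?P a / Gamma (1 + \<nu>) * (\<Sum>k=1..<K. (-1) ^ k / fact k * pochhammer \<mu> k
              * Re (riemann_zeta (1 - 2 * of_nat k)) * F_poly k \<mu> \<nu> b * a powr (- 2 * real k))
          = ?P a * (\<Sum>k=1..<K. ?p k * (1 / a) ^ (2 * k))"
        using G0 by (simp add: sum_distrib_left[symmetric])
      have split: "(\<Sum>k=1..K. ?p k * (1 / a) ^ (2 * k)) = (\<Sum>k=1..<K. ?p k * (1 / a) ^ (2 * k)) + ?p K * (1 / a) ^ (2 * K)"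
        using K sum.last_plus[of 1 K "\<lambda>k. ?p k * (1 / a) ^ (2 * k)"] by (simp add: add.commute)
      have "(bessel_sum \<gamma> \<mu> \<nu> a b - a powr (\<gamma> - 2 * \<mu>) * main_term \<mu> \<nu> b a)
         - ?P a / Gamma (1 + \<nu>) *
           (\<Sum>k=1..<K. (-1) ^ k / fact k * pochhammer \<mu> k
              * Re (riemann_zeta (1 - 2 * of_nat k)) * F_poly k \<mu> \<nu> b * a powr (- 2 * real k))
         = ?P a * (?p K * (1 / a) ^ (2 * K) + E)"
      proof -
        have "P * (x + y + (s + t) + e) - P * (x + y) - P * s = P * (t + e)" for P x y s t e :: real
          by (simp add: algebra_simps)
        moreover have "a powr (- 1 - \<nu> - 2 * \<mu>) * main_term \<mu> \<nu> b a
          = ?P a * (rGamma (1 + \<nu>) * (euler_mascheroni + ln a)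
             + ((LINT y:{0<..}|lborel. regular_kernel (chi b) \<nu> \<mu> y) - rGamma (1 + \<nu>) * (Digamma \<mu> + euler_mascheroni)) / 2)"
          by (rule main_term_eq[OF assms(1) elim assms(2) cond _ alt]) (rule nu)
        ultimately show ?thesis unfolding s gam E2 split by (simp only:)
      qed
      also have "norm \<dots> = ?P a * \<bar>?p K * (1 / a) ^ (2 * K) + E\<bar>"
        by (simp add: abs_mult)
      also have "\<dots> \<le> ?P a * ((\<bar>?p K\<bar> + C) * (1 / a) ^ (2 * K))"
      proof (rule mult_left_mono)
        have "\<bar>?p K * (1 / a) ^ (2 * K)\<bar> = \<bar>?p K\<bar> * (1 / a) ^ (2 * K)" using elim by (simp add: abs_mult)
        thus "\<bar>?p K * (1 / a) ^ (2 * K) + E\<bar> \<le> (\<bar>?p K\<bar> + C) * (1 / a) ^ (2 * K)"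
          using E1 abs_triangle_ineq[of "?p K * (1 / a) ^ (2 * K)" E] by (simp only: distrib_right)
      qed simp
      also have "\<dots> = (b / 2) powr \<nu> * (\<bar>?p K\<bar> + C) * (a powr (- \<nu> - 2 * \<mu>) * a powr (- 2 * real K))"
        unfolding pw by (simp only: mult_ac)
      also have "a powr (- \<nu> - 2 * \<mu>) * a powr (- 2 * real K) = norm (a powr (- \<nu> - 2 * \<mu> - 2 * real K))"
        by (subst powr_mult_powr[OF refl]) simp
      finally show ?case .
    qed
  qed
qed

end
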